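(* The smallest length $n$ for which there is a Hermitian self-dual code of length $n$ over $\mathbb{F}_4$ with a trivial automorphism group is $n=20$.
   Context: Let $\mathbb{F}_4=\{0,1,\omega,\bar\omega\}$ be the field of order four, where $\bar\omega=\omega^2=\omega+1$. A code of length $n$ (with $n$ a positive integer) is an $\mathbb{F}_4$-linear subspace $C$ of $\mathbb{F}_4^n$. The Hermitian inner product of $x=(x_1,\ldots,x_n)$ and $y=(y_1,\ldots,y_n)$ in $\mathbb{F}_4^n$ is $x\cdot y=\sum_{i=1}^n x_i y_i^2$. The Hermitian dual code of $C$ is $C^\perp=\{x\in\mathbb{F}_4^n \mid x\cdot c=0 \text{ for all } c\in C\}$, and $C$ is Hermitian self-dual if $C=C^\perp$. The automorphism group $\operatorname{Aut}(C)$ is the group of all $n\times n$ monomial matrices $M$ over $\mathbb{F}_4$ (exactly one nonzero entry in each row and each column, the nonzero entries being arbitrary elements of $\mathbb{F}_4\setminus\{0\}$) such that $CM=\{cM\mid c\in C\}=C$. It always contains $\{I,\omega I,\bar\omega I\}$, where $I$ is the identity matrix; the automorphism group is called trivial if $\operatorname{Aut}(C)=\{I,\omega I,\bar\omega I\}$. *)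

theory Defs
  imports "Jordan_Normal_Form.VS_Connect"
begin

section \<open>The field of order four\<close>

datatype gf4 = GF4_0 | GF4_1 | GF4_w | GF4_wb

instantiation gf4 :: field
begin

definition zero_gf4 :: gf4 where "0 = GF4_0"

definition one_gf4 :: gf4 where "1 = GF4_1"

fun plus_gf4 :: "gf4 \<Rightarrow> gf4 \<Rightarrow> gf4" where
  "GF4_0 + y = y"
| "x + GF4_0 = x"
| "GF4_1 + GF4_1 = GF4_0"
| "GF4_1 + GF4_w = GF4_wb"
| "GF4_1 + GF4_wb = GF4_w"
| "GF4_w + GF4_1 = GF4_wb"
| "GF4_w + GF4_w = GF4_0"
| "GF4_w + GF4_wb = GF4_1"
| "GF4_wb + GF4_1 = GF4_w"
| "GF4_wb + GF4_w = GF4_1"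
| "GF4_wb + GF4_wb = GF4_0"

fun times_gf4 :: "gf4 \<Rightarrow> gf4 \<Rightarrow> gf4" where
  "GF4_0 * y = GF4_0"
| "x * GF4_0 = GF4_0"
| "GF4_1 * y = y"
| "x * GF4_1 = x"
| "GF4_w * GF4_w = GF4_wb"
| "GF4_w * GF4_wb = GF4_1"
| "GF4_wb * GF4_w = GF4_1"
| "GF4_wb * GF4_wb = GF4_w"

definition uminus_gf4 :: "gf4 \<Rightarrow> gf4" where "- x = (x :: gf4)"

definition minus_gf4 :: "gf4 \<Rightarrow> gf4 \<Rightarrow> gf4" where "x - y = x + (y :: gf4)"

fun inverse_gf4 :: "gf4 \<Rightarrow> gf4" where
  "inverse GF4_0 = GF4_0"
| "inverse GF4_1 = GF4_1"
| "inverse GF4_w = GF4_wb"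
| "inverse GF4_wb = GF4_w"

definition divide_gf4 :: "gf4 \<Rightarrow> gf4 \<Rightarrow> gf4" where "x div y = x * inverse (y :: gf4)"

instance
proof
  fix a b c :: gf4
  show "a * b * c = a * (b * c)" by (cases a; cases b; cases c; simp)
  show "a * b = b * a" by (cases a; cases b; simp)
  show "1 * a = a" by (cases a; simp add: one_gf4_def)
  show "a + b + c = a + (b + c)" by (cases a; cases b; cases c; simp)
  show "a + b = b + a" by (cases a; cases b; simp)
  show "0 + a = a" by (simp add: zero_gf4_def)
  show "- a + a = 0" by (cases a; simp add: zero_gf4_def uminus_gf4_def)
  show "a - b = a + - b" by (simp add: minus_gf4_def uminus_gf4_def)
  show "(a + b) * c = a * c + b * c" by (cases a; cases b; cases c; simp)
  show "(0::gf4) \<noteq> 1" by (simp add: zero_gf4_def one_gf4_def)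
  show "a \<noteq> 0 \<Longrightarrow> inverse a * a = 1"
    by (cases a; simp add: zero_gf4_def one_gf4_def)
  show "a div b = a * inverse b" by (simp add: divide_gf4_def)
  show "inverse (0::gf4) = 0" by (simp add: zero_gf4_def)
qed

end

abbreviation omega :: gf4 where "omega \<equiv> GF4_w"

abbreviation omega_bar :: gf4 where "omega_bar \<equiv> GF4_wb"

lemma UNIV_gf4: "(UNIV :: gf4 set) = {0, 1, omega, omega_bar}"
  using gf4.exhaust by (auto simp: zero_gf4_def one_gf4_def)

instance gf4 :: finite
  by standard (simp add: UNIV_gf4)

lemma card_gf4: "card (UNIV :: gf4 set) = 4"
  by (simp add: UNIV_gf4 zero_gf4_def one_gf4_def)

lemma omega_bar_eq: "omega_bar = omega ^ 2" "omega_bar = omega + 1"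
  by (simp_all add: power2_eq_square one_gf4_def)


section \<open>Hermitian self-dual codes\<close>

definition linear_code :: "nat \<Rightarrow> gf4 vec set \<Rightarrow> bool" where
  "linear_code n C \<longleftrightarrow> VectorSpace.subspace class_ring C (module_vec TYPE(gf4) n)"

lemma linear_code_iff:
  "linear_code n C \<longleftrightarrow> C \<subseteq> carrier_vec n \<and> 0\<^sub>v n \<in> C
     \<and> (\<forall>x\<in>C. \<forall>y\<in>C. x + y \<in> C) \<and> (\<forall>a. \<forall>x\<in>C. a \<cdot>\<^sub>v x \<in> C)"
proof -
  interpret vec_space "TYPE(gf4)" n .
  show ?thesis
    unfolding linear_code_def VectorSpace.subspace_def submodule_def
    using vectorspace_axioms module_axioms
    by (auto simp: module_vec_simps class_ring_simps)
qed

definition hermitian_prod :: "gf4 vec \<Rightarrow> gf4 vec \<Rightarrow> gf4" where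
  "hermitian_prod x y = (\<Sum>i<dim_vec x. x $ i * (y $ i)\<^sup>2)"

definition hermitian_dual :: "nat \<Rightarrow> gf4 vec set \<Rightarrow> gf4 vec set" where
  "hermitian_dual n C = {x \<in> carrier_vec n. \<forall>c\<in>C. hermitian_prod x c = 0}"

definition hermitian_self_dual :: "nat \<Rightarrow> gf4 vec set \<Rightarrow> bool" where
  "hermitian_self_dual n C \<longleftrightarrow> linear_code n C \<and> C = hermitian_dual n C"


section \<open>Automorphism groups\<close>

definition monomial_mat :: "nat \<Rightarrow> gf4 mat \<Rightarrow> bool" where
  "monomial_mat n M \<longleftrightarrow> M \<in> carrier_mat n n
     \<and> (\<forall>i<n. \<exists>!j. j < n \<and> M $$ (i, j) \<noteq> 0)
     \<and> (\<forall>j<n. \<exists>!i. i < n \<and> M $$ (i, j) \<noteq> 0)"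

text \<open>Codewords are row vectors, while the library's matrix-vector product treats vectors as
  columns; so the row vector \<open>c M\<close> is obtained by multiplying with the transpose.\<close>

definition row_vec_mult_mat :: "gf4 vec \<Rightarrow> gf4 mat \<Rightarrow> gf4 vec" where
  "row_vec_mult_mat c M = transpose_mat M *\<^sub>v c"

lemma mat_of_row_mult:
  assumes "c \<in> carrier_vec n" "M \<in> carrier_mat n m"
  shows "mat_of_row c * M = mat_of_row (row_vec_mult_mat c M)"
  by (rule eq_matI)
     (use assms in \<open>auto simp: row_vec_mult_mat_def scalar_prod_def mult.commute\<close>)

definition code_aut :: "nat \<Rightarrow> gf4 vec set \<Rightarrow> gf4 mat set" where
  "code_aut n C = {M. monomial_mat n M \<and> (\<lambda>c. row_vec_mult_mat c M) ` C = C}"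

lemma scalar_in_code_aut:
  assumes C: "linear_code n C" and a: "a \<noteq> 0"
  shows "a \<cdot>\<^sub>m 1\<^sub>m n \<in> code_aut n C"
proof -
  have Cn: "C \<subseteq> carrier_vec n" and smult: "b \<cdot>\<^sub>v x \<in> C" if "x \<in> C" for b x
    using C that by (auto simp: linear_code_iff)
  have act: "row_vec_mult_mat c (a \<cdot>\<^sub>m 1\<^sub>m n) = a \<cdot>\<^sub>v c" if "c \<in> C" for c
  proof -
    have c: "c \<in> carrier_vec n" using C that by (auto simp: linear_code_iff)
    have "transpose_mat (a \<cdot>\<^sub>m 1\<^sub>m n) = a \<cdot>\<^sub>m 1\<^sub>m n" by (rule eq_matI) auto
    then show ?thesis
      unfolding row_vec_mult_mat_def using c
      by (intro eq_vecI) (auto simp: smult_scalar_prod_distrib[of _ n])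
  qed
  have "(\<lambda>c. row_vec_mult_mat c (a \<cdot>\<^sub>m 1\<^sub>m n)) ` C = (\<lambda>c. a \<cdot>\<^sub>v c) ` C"
    using act by (rule image_cong[OF refl])
  also have "\<dots> = C"
  proof
    show "(\<lambda>c. a \<cdot>\<^sub>v c) ` C \<subseteq> C" using smult by auto
    show "C \<subseteq> (\<lambda>c. a \<cdot>\<^sub>v c) ` C"
    proof
      fix x assume x: "x \<in> C"
      have "x = a \<cdot>\<^sub>v (inverse a \<cdot>\<^sub>v x)" using a by (simp add: smult_smult_assoc)
      then show "x \<in> (\<lambda>c. a \<cdot>\<^sub>v c) ` C" using smult[OF x, of "inverse a"] by blast
    qed
  qed
  finally show ?thesis
    using a by (auto simp: code_aut_def monomial_mat_def split: if_splits)
qed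

definition trivial_code_aut :: "nat \<Rightarrow> gf4 vec set \<Rightarrow> bool" where
  "trivial_code_aut n C \<longleftrightarrow>
     code_aut n C = {1\<^sub>m n, omega \<cdot>\<^sub>m 1\<^sub>m n, omega_bar \<cdot>\<^sub>m 1\<^sub>m n}"

end

theory Submission
  imports Defs "HOL-Combinatorics.Permutations" "HOL-Computational_Algebra.Polynomial"
begin

text \<open>The number of self-dual codes of length \<open>2 m\<close> is \<open>\<Prod>i<m. 2 ^ (2 i + 1) + 1\<close>, while a code
  with trivial automorphism group has \<open>3 ^ (n - 1) * fact n\<close> images under monomial maps; this is too
  many for \<open>n \<le> 16\<close>. For \<open>n = 18\<close>, a self-dual code with a word of weight 4 has a nontrivial
  automorphism that fixes all codewords modulo that word. A Bonferroni bound on the number of codes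
  without words of weight 4 leaves room for fewer than \<open>3.498\<close> orbits of the maximal size, and
  twelve explicit codes with small, but nontrivial automorphism groups fill more than \<open>2.527\<close> of it,
  so that no orbit of maximal size fits. For \<open>n = 20\<close> there is an explicit code. The
  automorphism groups are bounded by the permutations that preserve the supports of all words of
  weight 6.\<close>


text \<open>At length 18 the plain count fails: all self-dual codes together leave room for more
  than five orbits of maximal size, hence the detour through weight 4. The contradiction is that
  less than one orbit remains after the twelve codes. All certificates are one-sided: an upper bound
  on a stabilizer is a lower bound on an orbit, so it is enough that a search misses no
  automorphism. Such a bound does not show that a group is nontrivial. Each of the twelve codes
  therefore also carries an explicit automorphism, which keeps its orbit apart from that of a
  hypothetical code with trivial group. The orbits of the twelve are taken under semilinear maps,
  which doubles their guaranteed size; for the hypothetical code only monomial maps are used,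
  because nothing is known about its semilinear symmetries.\<close>

lemmas gf4_def_simps = zero_gf4_def one_gf4_def

section \<open>Arithmetic in characteristic 2 and an additive character\<close>

lemma gf4_add_self [simp]: "(a :: gf4) + a = 0"
  by (cases a) (auto simp: gf4_def_simps)

lemma gf4_uminus [simp]: "- a = (a :: gf4)"
  by (simp add: uminus_gf4_def)

lemma gf4_diff [simp]: "a - b = a + (b :: gf4)"
  by (simp add: minus_gf4_def)

lemma gf4_add_eq_0_iff: "a + b = 0 \<longleftrightarrow> a = (b :: gf4)"
  by (metis add_left_cancel gf4_add_self)

lemma gf4_power2_add: "(a + b)\<^sup>2 = a\<^sup>2 + (b\<^sup>2 :: gf4)"
  by (cases a; cases b) (auto simp: gf4_def_simps power2_eq_square)

lemma gf4_power2_sum: "(\<Sum>i\<in>A. f i)\<^sup>2 = (\<Sum>i\<in>A. (f i :: gf4)\<^sup>2)"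
  by (induction A rule: infinite_finite_induct) (auto simp: gf4_power2_add)

lemma gf4_power4 [simp]: "a ^ 4 = (a :: gf4)"
  by (cases a) (auto simp: gf4_def_simps numeral_eq_Suc)

lemma gf4_mult_power2: "a * a\<^sup>2 = (if a = 0 then 0 else 1 :: gf4)"
  by (cases a) (auto simp: gf4_def_simps power2_eq_square)

lemma gf4_of_nat: "(of_nat k :: gf4) = (if even k then 0 else 1)"
  by (induction k) auto

lemma gf4_inverse: "inverse a = (a\<^sup>2 :: gf4)"
  by (cases a) (auto simp: gf4_def_simps power2_eq_square)

text \<open>The sign given by the absolute trace: the additive character whose kernel is the prime
  field. In characteristic 2 its values are integers, so all character sums stay in
  \<open>int\<close>.\<close>

definition chi :: "gf4 \<Rightarrow> int" where
  "chi a = (if a = 0 \<or> a = 1 then 1 else - 1)"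

lemma chi_0 [simp]: "chi 0 = 1"
  by (simp add: chi_def)

lemma chi_add: "chi (a + b) = chi a * chi b"
  by (cases a; cases b) (simp_all add: chi_def gf4_def_simps)

lemma chi_sum: "finite A \<Longrightarrow> chi (\<Sum>i\<in>A. f i) = (\<Prod>i\<in>A. chi (f i))"
  by (induction A rule: finite_induct) (auto simp: chi_add)

lemma ex_chi_mult: "c \<noteq> 0 \<Longrightarrow> \<exists>a. chi (c * a\<^sup>2) = - 1"
  \<comment> \<open>The fourth power is the identity, so squaring this witness gives
    \<open>omega * inverse c\<close>, and the argument of \<open>chi\<close> becomes
    \<open>omega\<close>.\<close>
  by (rule exI [of _ "(omega * inverse c)\<^sup>2"], cases c)
     (simp_all add: chi_def gf4_def_simps)

lemma sum_UNIV_gf4: "(\<Sum>a\<in>UNIV. f a) = f 0 + f 1 + f omega + f omega_bar"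
  for f :: "gf4 \<Rightarrow> 'a :: comm_monoid_add"
  by (simp add: UNIV_gf4 gf4_def_simps add.assoc)

section \<open>Sums over all vectors\<close>

lemma bij_betw_vec_PiE: "bij_betw (vec n) ({..<n} \<rightarrow>\<^sub>E UNIV) (carrier_vec n)"
proof (rule bij_betwI [where g = "\<lambda>x. restrict (vec_index x) {..<n}"])
  show "restrict (vec_index (vec n f)) {..<n} = f" if "f \<in> {..<n} \<rightarrow>\<^sub>E UNIV" for f :: "nat \<Rightarrow> 'a"
    using that by (auto simp: fun_eq_iff PiE_def extensional_def)
qed auto

lemma finite_carrier_vec_gf4 [simp]: "finite (carrier_vec n :: gf4 vec set)"
  using bij_betw_finite [OF bij_betw_vec_PiE [of n, where ?'a = gf4]] by (auto simp: finite_PiE)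

lemma sum_prod_carrier_vec:
  fixes f :: "nat \<Rightarrow> gf4 \<Rightarrow> 'a :: comm_semiring_1"
  shows "(\<Sum>x\<in>carrier_vec n. \<Prod>i<n. f i (x $ i)) = (\<Prod>i<n. \<Sum>a\<in>UNIV. f i a)"
proof -
  have "(\<Sum>x\<in>carrier_vec n. \<Prod>i<n. f i (x $ i))
      = (\<Sum>g\<in>{..<n} \<rightarrow>\<^sub>E UNIV. \<Prod>i<n. f i (vec n g $ i))"
    by (rule sum.reindex_bij_betw [OF bij_betw_vec_PiE, symmetric])
  also have "\<dots> = (\<Sum>g\<in>{..<n} \<rightarrow>\<^sub>E UNIV. \<Prod>i<n. f i (g i))"
    by (intro sum.cong prod.cong) auto
  also have "\<dots> = (\<Prod>i<n. \<Sum>a\<in>UNIV. f i a)"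
    by (rule prod_sum_PiE [symmetric]) auto
  finally show ?thesis .
qed

section \<open>Weights and Hermitian products\<close>

definition wt :: "gf4 vec \<Rightarrow> nat" where
  "wt x = card {i. i < dim_vec x \<and> x $ i \<noteq> 0}"

lemma prod_wt:
  assumes "x \<in> carrier_vec n"
  shows "(\<Prod>i<n. if x $ i = 0 then a else b :: 'a :: comm_monoid_mult) = a ^ (n - wt x) * b ^ wt x"
proof -
  have "{i. i < n \<and> x $ i = 0} = {..<n} - {i. i < n \<and> x $ i \<noteq> 0}" by auto
  then have "card {i. i < n \<and> x $ i = 0} = n - wt x"
    using assms by (simp add: card_Diff_subset wt_def subset_iff)
  moreover have "{..<n} \<inter> {i. x $ i = 0} = {i. i < n \<and> x $ i = 0}"
    "{..<n} \<inter> - {i. x $ i = 0} = {i. i < n \<and> x $ i \<noteq> 0}" by auto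
  ultimately show ?thesis
    using assms by (simp add: prod.If_cases wt_def)
qed

lemma wt_le: "x \<in> carrier_vec n \<Longrightarrow> wt x \<le> n"
  using card_mono [of "{..<n}" "{i. i < n \<and> x $ i \<noteq> 0}"] by (auto simp: wt_def)

lemma wt_eq_0_iff: "x \<in> carrier_vec n \<Longrightarrow> wt x = 0 \<longleftrightarrow> x = 0\<^sub>v n"
  by (auto simp: wt_def vec_eq_iff)

lemma wt_smult: "a \<noteq> 0 \<Longrightarrow> wt (a \<cdot>\<^sub>v x) = wt x"
  unfolding wt_def by (rule arg_cong [of _ _ card]) auto

lemma hermitian_prod_add_left:
  "x \<in> carrier_vec n \<Longrightarrow> y \<in> carrier_vec n \<Longrightarrow>
    hermitian_prod (x + y) z = hermitian_prod x z + hermitian_prod y z"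
  by (simp add: hermitian_prod_def distrib_right sum.distrib)

lemma hermitian_prod_smult_left: "hermitian_prod (a \<cdot>\<^sub>v x) z = a * hermitian_prod x z"
  by (simp add: hermitian_prod_def sum_distrib_left mult.assoc)

lemma hermitian_prod_commute:
  "x \<in> carrier_vec n \<Longrightarrow> y \<in> carrier_vec n \<Longrightarrow> hermitian_prod y x = (hermitian_prod x y)\<^sup>2"
  by (simp add: hermitian_prod_def gf4_power2_sum power_mult_distrib mult.commute)

lemma hermitian_prod_add_right:
  assumes "x \<in> carrier_vec n" "y \<in> carrier_vec n" "z \<in> carrier_vec n"
  shows "hermitian_prod z (x + y) = hermitian_prod z x + hermitian_prod z y"
  using assms by (simp add: hermitian_prod_def distrib_left gf4_power2_add sum.distrib)

lemma hermitian_prod_smult_right: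
  assumes "x \<in> carrier_vec n" "z \<in> carrier_vec n"
  shows "hermitian_prod z (a \<cdot>\<^sub>v x) = a\<^sup>2 * hermitian_prod z x"
  using assms by (simp add: hermitian_prod_def sum_distrib_left power_mult_distrib mult_ac)

lemma hermitian_prod_zero_right: "x \<in> carrier_vec n \<Longrightarrow> hermitian_prod x (0\<^sub>v n) = 0"
  by (simp add: hermitian_prod_def)

text \<open>The cube of a nonzero scalar is 1, so every coordinate of the support contributes
  1.\<close>

lemma hermitian_prod_self: "hermitian_prod x x = of_nat (wt x)"
proof -
  have "hermitian_prod x x = (\<Sum>i<dim_vec x. if x $ i = 0 then 0 else 1)"
    by (simp add: hermitian_prod_def gf4_mult_power2)
  also have "\<dots> = (\<Sum>i\<in>{..<dim_vec x} \<inter> - {i. x $ i = 0}. 1)"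
    by (subst sum.If_cases) auto
  also have "{..<dim_vec x} \<inter> - {i. x $ i = 0} = {i. i < dim_vec x \<and> x $ i \<noteq> 0}"
    by auto
  finally show ?thesis by (simp add: wt_def)
qed

lemma hermitian_prod_self_eq_0_iff: "hermitian_prod x x = 0 \<longleftrightarrow> even (wt x)"
  by (simp add: hermitian_prod_self gf4_of_nat)

text \<open>The Fourier transform of \<open>z ^ wt y\<close>, which factors over the coordinates.
  The variable lives in any commutative ring because three instances are used: 1 gives the size of
  the dual, -1 the parities of its weights, and a polynomial variable the words of one fixed
  weight.\<close>

lemma sum_chi_weight:
  fixes z :: "'a :: comm_ring_1"
  assumes x: "x \<in> carrier_vec n"
  shows "(\<Sum>y\<in>carrier_vec n. of_int (chi (hermitian_prod y x)) * z ^ wt y)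
    = (1 - z) ^ wt x * (1 + 3 * z) ^ (n - wt x)"
proof -
  have "(\<Sum>y\<in>carrier_vec n. of_int (chi (hermitian_prod y x)) * z ^ wt y)
      = (\<Sum>y\<in>carrier_vec n. \<Prod>i<n. of_int (chi (y $ i * (x $ i)\<^sup>2)) * (if y $ i = 0 then 1 else z))"
  proof (rule sum.cong [OF refl])
    fix y :: "gf4 vec" assume y: "y \<in> carrier_vec n"
    then show "of_int (chi (hermitian_prod y x)) * z ^ wt y
      = (\<Prod>i<n. of_int (chi (y $ i * (x $ i)\<^sup>2)) * (if y $ i = 0 then 1 else z))"
      by (simp add: prod.distrib prod_wt [OF y] hermitian_prod_def chi_sum of_int_prod)
  qed
  also have "\<dots> = (\<Prod>i<n. \<Sum>a\<in>UNIV. of_int (chi (a * (x $ i)\<^sup>2)) * (if a = 0 then 1 else z))"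
    by (rule sum_prod_carrier_vec)
  also have "\<dots> = (\<Prod>i<n. if x $ i = 0 then 1 + 3 * z else 1 - z)"
  proof (rule prod.cong [OF refl])
    fix i
    \<comment> \<open>If \<open>x $ i\<close> is nonzero, the argument of \<open>chi\<close> runs
      through the field, with values 1, -1, -1 on the nonzero elements, so the coefficient of
      \<open>z\<close> is -1; otherwise it is 3.\<close>
    show "(\<Sum>a\<in>UNIV. of_int (chi (a * (x $ i)\<^sup>2)) * (if a = 0 then 1 else z))
      = (if x $ i = 0 then 1 + 3 * z else 1 - z)"
      by (cases "x $ i") (simp_all add: sum_UNIV_gf4 chi_def gf4_def_simps power2_eq_square)
  qed
  also have "\<dots> = (1 - z) ^ wt x * (1 + 3 * z) ^ (n - wt x)"
    by (simp add: prod_wt [OF x] mult.commute)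
  finally show ?thesis .
qed


section \<open>Duality\<close>

lemma linear_codeD:
  assumes "linear_code n C"
  shows "C \<subseteq> carrier_vec n" "0\<^sub>v n \<in> C" "x \<in> C \<Longrightarrow> y \<in> C \<Longrightarrow> x + y \<in> C" "x \<in> C \<Longrightarrow> a \<cdot>\<^sub>v x \<in> C"
  using assms by (auto simp: linear_code_iff)

lemma finite_linear_code: "linear_code n C \<Longrightarrow> finite C"
  using finite_carrier_vec_gf4 finite_subset linear_codeD(1) by blast

text \<open>A codeword that is not orthogonal to \<open>y\<close> can be rescaled so that
  translation by it flips every sign; the sum then equals its own negative.\<close>

lemma sum_chi_code:
  assumes C: "linear_code n C" and y: "y \<in> carrier_vec n"
  shows "(\<Sum>x\<in>C. chi (hermitian_prod y x)) = (if y \<in> hermitian_dual n C then int (card C) else 0)"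
proof (cases "y \<in> hermitian_dual n C")
  case True
  then show ?thesis by (simp add: hermitian_dual_def)
next
  case False
  then obtain x where x: "x \<in> C" "hermitian_prod y x \<noteq> 0"
    using y by (auto simp: hermitian_dual_def)
  obtain a where a: "chi (hermitian_prod y x * a\<^sup>2) = - 1"
    using ex_chi_mult [OF x(2)] by blast
  define t where "t = a \<cdot>\<^sub>v x"
  have t: "t \<in> C" using x C by (simp add: t_def linear_codeD)
  have Cn: "z \<in> carrier_vec n" if "z \<in> C" for z using that linear_codeD(1) [OF C] by blast
  have ht: "chi (hermitian_prod y t) = - 1"
    using a hermitian_prod_smult_right [OF Cn [OF x(1)] y] by (simp add: t_def mult.commute)
  have "(z + t) + t = z" if "z \<in> C" for z
    using Cn [OF that] Cn [OF t] by (intro eq_vecI) (auto simp: add.assoc)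
  then have "bij_betw (\<lambda>z. z + t) C C"
    by (intro bij_betwI [where g = "\<lambda>z. z + t"]) (use t linear_codeD(3) [OF C] in auto)
  then have "(\<Sum>z\<in>C. chi (hermitian_prod y z)) = (\<Sum>z\<in>C. chi (hermitian_prod y (z + t)))"
    by (rule sum.reindex_bij_betw [symmetric])
  also have "\<dots> = - (\<Sum>z\<in>C. chi (hermitian_prod y z))"
    using hermitian_prod_add_right [OF Cn Cn [OF t] y] by (simp add: chi_add ht flip: sum_negf)
  finally show ?thesis using False by simp
qed

text \<open>Poisson summation: summed over \<open>C\<close>, the characters give
  \<open>card C\<close> times the indicator function of the dual.\<close>

lemma sum_hermitian_dual:
  fixes f :: "gf4 vec \<Rightarrow> int"
  assumes C: "linear_code n C"
  shows "int (card C) * (\<Sum>y\<in>hermitian_dual n C. f y)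
    = (\<Sum>x\<in>C. \<Sum>y\<in>carrier_vec n. chi (hermitian_prod y x) * f y)"
proof -
  have "(\<Sum>x\<in>C. \<Sum>y\<in>carrier_vec n. chi (hermitian_prod y x) * f y)
    = (\<Sum>y\<in>carrier_vec n. (\<Sum>x\<in>C. chi (hermitian_prod y x)) * f y)"
    by (subst sum.swap) (simp add: sum_distrib_right)
  also have "\<dots> = (\<Sum>y\<in>carrier_vec n. if y \<in> hermitian_dual n C then int (card C) * f y else 0)"
    using sum_chi_code [OF C] by (intro sum.cong) auto
  also have "\<dots> = (\<Sum>y\<in>carrier_vec n \<inter> hermitian_dual n C. int (card C) * f y)"
    by (simp add: sum.inter_restrict)
  also have "carrier_vec n \<inter> hermitian_dual n C = hermitian_dual n C"
    by (auto simp: hermitian_dual_def)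
  finally show ?thesis by (simp add: sum_distrib_left)
qed

lemma card_hermitian_dual:
  assumes C: "linear_code n C"
  shows "card C * card (hermitian_dual n C) = 4 ^ n"
proof -
  have "int (card C) * int (card (hermitian_dual n C))
    = (\<Sum>x\<in>C. \<Sum>y\<in>carrier_vec n. chi (hermitian_prod y x) * 1)"
    using sum_hermitian_dual [OF C, of "\<lambda>_. 1"] by simp
  also have "\<dots> = (\<Sum>x\<in>C. if x = 0\<^sub>v n then 4 ^ n else 0)"
  proof (rule sum.cong [OF refl])
    fix x assume "x \<in> C"
    then have x: "x \<in> carrier_vec n" using linear_codeD(1) [OF C] by blast
    show "(\<Sum>y\<in>carrier_vec n. chi (hermitian_prod y x) * 1) = (if x = 0\<^sub>v n then 4 ^ n else 0)"
      using sum_chi_weight [OF x, of "1 :: int"] wt_eq_0_iff [OF x] by (auto simp: power_0_left)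
  qed
  also have "\<dots> = 4 ^ n"
    using linear_codeD(2) [OF C] finite_linear_code [OF C] by simp
  finally have "int (card C * card (hermitian_dual n C)) = int (4 ^ n)" by simp
  then show ?thesis by (simp only: of_nat_eq_iff)
qed

text \<open>With -1 for the variable, the transform at an even word is
  \<open>2 ^ wt x * (- 2) ^ (n - wt x)\<close>, which does not depend on the word. The sum is the
  excess of even over odd words in the dual, from which the mass formula obtains the number of even
  words.\<close>

lemma sum_sign_hermitian_dual:
  assumes C: "linear_code n C" and ev: "\<And>x. x \<in> C \<Longrightarrow> even (wt x)"
  shows "(\<Sum>y\<in>hermitian_dual n C. (- 1) ^ wt y) = (- 2 :: int) ^ n"
proof -
  have "int (card C) * (\<Sum>y\<in>hermitian_dual n C. (- 1) ^ wt y)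
    = (\<Sum>x\<in>C. \<Sum>y\<in>carrier_vec n. chi (hermitian_prod y x) * (- 1) ^ wt y)"
    by (rule sum_hermitian_dual [OF C])
  also have "\<dots> = (\<Sum>x\<in>C. (- 2) ^ n)"
  proof (rule sum.cong [OF refl])
    fix x assume xC: "x \<in> C"
    then have x: "x \<in> carrier_vec n" using linear_codeD(1) [OF C] by blast
    have "(2 :: int) ^ wt x = (- 2) ^ wt x" using ev [OF xC] by simp
    then show "(\<Sum>y\<in>carrier_vec n. chi (hermitian_prod y x) * (- 1) ^ wt y) = (- 2) ^ n"
      using sum_chi_weight [OF x, of "- 1 :: int"] wt_le [OF x]
      by (simp flip: power_add)
  qed
  finally have "int (card C) * (\<Sum>y\<in>hermitian_dual n C. (- 1) ^ wt y) = int (card C) * (- 2) ^ n"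
    by simp
  moreover have "card C \<noteq> 0"
    using linear_codeD(2) [OF C] finite_linear_code [OF C] by auto
  ultimately show ?thesis by simp
qed

definition self_orthogonal :: "nat \<Rightarrow> gf4 vec set \<Rightarrow> bool" where
  "self_orthogonal n C \<longleftrightarrow> linear_code n C \<and> C \<subseteq> hermitian_dual n C"

lemma self_orthogonal_even: "self_orthogonal n C \<Longrightarrow> x \<in> C \<Longrightarrow> even (wt x)"
  by (auto simp: self_orthogonal_def hermitian_dual_def hermitian_prod_self_eq_0_iff
      simp flip: hermitian_prod_self_eq_0_iff)

lemma self_dual_self_orthogonal: "hermitian_self_dual n C \<Longrightarrow> self_orthogonal n C"
  by (simp add: self_orthogonal_def hermitian_self_dual_def)

lemma card_self_dual: "hermitian_self_dual n C \<Longrightarrow> card C = 2 ^ n"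
proof -
  assume C: "hermitian_self_dual n C"
  then have "card C * card C = 4 ^ n"
    using card_hermitian_dual [of n C] by (simp add: hermitian_self_dual_def)
  also have "\<dots> = (2 ^ n)\<^sup>2"
    by (metis power2_eq_square power_mult_distrib num_double numeral_times_numeral)
  finally show "card C = 2 ^ n"
    by (metis power2_eq_square power2_eq_imp_eq zero_le)
qed

text \<open>A self-dual code is its own dual and all its words are even, so the signed count
  \<open>(- 2) ^ n\<close> agrees with the size \<open>2 ^ n\<close>.\<close>

lemma self_dual_even_length:
  assumes C: "hermitian_self_dual n C" shows "even n"
proof -
  have "(- 2 :: int) ^ n = (\<Sum>y\<in>C. (- 1) ^ wt y)"
    using sum_sign_hermitian_dual [of n C] self_orthogonal_even [OF self_dual_self_orthogonal [OF C]] C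
    by (auto simp: hermitian_self_dual_def)
  also have "\<dots> = (\<Sum>y\<in>C. 1)"
    using self_orthogonal_even [OF self_dual_self_orthogonal [OF C]] by (intro sum.cong) auto
  finally have "(- 2 :: int) ^ n = 2 ^ n"
    by (simp add: card_self_dual [OF C])
  then show "even n"
    by (metis neg_equal_iff_equal power_minus_odd numeral_power_eq_of_nat_cancel_iff zero_neq_numeral power_not_zero equal_neg_zero)
qed


section \<open>Counting self-dual codes\<close>

definition code_ext :: "gf4 vec set \<Rightarrow> gf4 vec \<Rightarrow> gf4 vec set" where
  "code_ext C v = (\<lambda>(x, a). x + a \<cdot>\<^sub>v v) ` (C \<times> UNIV)"

lemma code_extI: "x \<in> C \<Longrightarrow> x + a \<cdot>\<^sub>v v \<in> code_ext C v"
  by (auto simp: code_ext_def)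

context
  fixes n :: nat and C :: "gf4 vec set" and v :: "gf4 vec"
  assumes C: "linear_code n C" and v: "v \<in> carrier_vec n"
begin

private lemma Cn: "x \<in> C \<Longrightarrow> x \<in> carrier_vec n"
  using linear_codeD(1) [OF C] by blast

lemma code_ext_superset: "C \<subseteq> code_ext C v" "v \<in> code_ext C v"
proof -
  show "C \<subseteq> code_ext C v"
  proof
    fix x assume x: "x \<in> C"
    have "x + 0 \<cdot>\<^sub>v v = x" using Cn [OF x] v by (intro eq_vecI) auto
    then show "x \<in> code_ext C v" using code_extI [OF x, of 0 v] by simp
  qed
  show "v \<in> code_ext C v" using code_extI [of "0\<^sub>v n" C 1 v] v linear_codeD(2) [OF C] by simp
qed

lemma linear_code_ext: "linear_code n (code_ext C v)"
  unfolding linear_code_iff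
proof (intro conjI ballI allI)
  show "code_ext C v \<subseteq> carrier_vec n" using Cn v by (auto simp: code_ext_def)
  show "0\<^sub>v n \<in> code_ext C v" using code_ext_superset linear_codeD(2) [OF C] by blast
next
  fix x y assume "x \<in> code_ext C v" "y \<in> code_ext C v"
  then obtain x' y' a b where x: "x = x' + a \<cdot>\<^sub>v v" "x' \<in> C" and y: "y = y' + b \<cdot>\<^sub>v v" "y' \<in> C"
    by (auto simp: code_ext_def)
  have "x + y = (x' + y') + (a + b) \<cdot>\<^sub>v v"
    using Cn [OF x(2)] Cn [OF y(2)] v by (intro eq_vecI) (auto simp: x(1) y(1) algebra_simps)
  then show "x + y \<in> code_ext C v"
    using code_extI linear_codeD(3) [OF C x(2) y(2)] by metis
next
  fix a x assume "x \<in> code_ext C v"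
  then obtain x' b where x: "x = x' + b \<cdot>\<^sub>v v" "x' \<in> C" by (auto simp: code_ext_def)
  have "a \<cdot>\<^sub>v x = a \<cdot>\<^sub>v x' + (a * b) \<cdot>\<^sub>v v"
    using Cn [OF x(2)] v by (intro eq_vecI) (auto simp: x(1) algebra_simps)
  then show "a \<cdot>\<^sub>v x \<in> code_ext C v"
    using code_extI linear_codeD(4) [OF C x(2)] by metis
qed

lemma code_ext_subset_iff:
  assumes D: "linear_code n D"
  shows "code_ext C v \<subseteq> D \<longleftrightarrow> C \<subseteq> D \<and> v \<in> D"
  using code_ext_superset linear_codeD(3,4) [OF D] by (auto simp: code_ext_def)

lemma card_code_ext:
  assumes "v \<notin> C"
  shows "card (code_ext C v) = 4 * card C"
proof -
  have "inj_on (\<lambda>(x, a). x + a \<cdot>\<^sub>v v) (C \<times> UNIV)"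
  proof (rule inj_onI, clarify)
    fix x y a b
    assume xy: "x \<in> C" "y \<in> C" and eq: "x + a \<cdot>\<^sub>v v = y + b \<cdot>\<^sub>v v"
    have "x $ i + y $ i = (a + b) * v $ i" if "i < n" for i
    proof -
      have "x $ i + a * v $ i = y $ i + b * v $ i"
        using arg_cong [OF eq, of "\<lambda>z. z $ i"] that Cn [OF xy(1)] Cn [OF xy(2)] v by simp
      then have "(x $ i + a * v $ i) + (y $ i + b * v $ i) = 0"
        by simp
      then have "(x $ i + y $ i) + (a + b) * v $ i = 0"
        by (simp add: algebra_simps)
      then show ?thesis by (simp add: gf4_add_eq_0_iff)
    qed
    then have sum: "x + y = (a + b) \<cdot>\<^sub>v v"
      using Cn [OF xy(1)] Cn [OF xy(2)] v by (intro eq_vecI) auto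
    have "a = b"
    proof (rule ccontr)
      assume "a \<noteq> b"
      then have "inverse (a + b) \<cdot>\<^sub>v (x + y) = v"
        by (simp add: sum smult_smult_assoc gf4_add_eq_0_iff)
      then show False
        using \<open>v \<notin> C\<close> linear_codeD(3,4) [OF C] xy by metis
    qed
    moreover have "x = y"
    proof (rule eq_vecI)
      show "x $ i = y $ i" if "i < dim_vec y" for i
        using arg_cong [OF sum, of "\<lambda>z. z $ i"] that Cn [OF xy(1)] Cn [OF xy(2)] v \<open>a = b\<close>
        by (simp add: gf4_add_eq_0_iff)
    qed (use Cn [OF xy(1)] Cn [OF xy(2)] in simp)
    ultimately show "x = y \<and> a = b" by simp
  qed
  then show ?thesis
    by (simp add: code_ext_def card_image card_cartesian_product card_gf4)
qed

lemma self_orthogonal_code_ext: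
  assumes "self_orthogonal n C" and vd: "v \<in> hermitian_dual n C" and "even (wt v)"
  shows "self_orthogonal n (code_ext C v)"
proof -
  have "hermitian_prod x y = 0" if "x \<in> code_ext C v" "y \<in> code_ext C v" for x y
  proof -
    obtain x' y' a b where x: "x = x' + a \<cdot>\<^sub>v v" "x' \<in> C" and y: "y = y' + b \<cdot>\<^sub>v v" "y' \<in> C"
      using \<open>x \<in> code_ext C v\<close> \<open>y \<in> code_ext C v\<close> by (auto simp: code_ext_def)
    note carr = Cn [OF x(2)] Cn [OF y(2)] v
    have "hermitian_prod x' y' = 0" "hermitian_prod v y' = 0"
      using assms(1) vd x(2) y(2) by (auto simp: self_orthogonal_def hermitian_dual_def)
    moreover have "hermitian_prod x' v = 0"
      using hermitian_prod_commute [OF v Cn [OF x(2)]] vd x(2) by (simp add: hermitian_dual_def)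
    moreover have "hermitian_prod v v = 0"
      using \<open>even (wt v)\<close> by (simp add: hermitian_prod_self_eq_0_iff)
    ultimately show ?thesis
      using carr
      by (simp add: x(1) y(1) hermitian_prod_add_left [of _ n] hermitian_prod_add_right [of _ n]
          hermitian_prod_smult_left hermitian_prod_smult_right [of _ n])
  qed
  then show ?thesis
    using linear_code_ext linear_codeD(1) [OF linear_code_ext]
    by (auto simp: self_orthogonal_def hermitian_dual_def)
qed

end

definition self_dual_over :: "nat \<Rightarrow> gf4 vec set \<Rightarrow> gf4 vec set set" where
  "self_dual_over n S = {C. hermitian_self_dual n C \<and> S \<subseteq> C}"

lemma hermitian_self_dual_subset: "hermitian_self_dual n C \<Longrightarrow> C \<subseteq> carrier_vec n"
  using linear_codeD(1) by (auto simp: hermitian_self_dual_def)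

lemma finite_self_dual_over: "finite (self_dual_over n S)"
  by (rule finite_subset [of _ "Pow (carrier_vec n)"])
     (use hermitian_self_dual_subset in \<open>auto simp: self_dual_over_def\<close>)

text \<open>The dual has \<open>4 ^ (k + 2 * r)\<close> words, and the even ones exceed the odd ones
  by \<open>4 ^ (k + r)\<close>; the sum of both numbers counts the even words twice. Those outside
  \<open>S\<close> are the vectors that extend \<open>S\<close> to a larger self-orthogonal
  code.\<close>

lemma card_even_hermitian_dual:
  assumes S: "self_orthogonal (2 * m) S" and card: "card S = 4 ^ k" and "k + r = m"
  shows "2 * card {v \<in> hermitian_dual (2 * m) S - S. even (wt v)} = 4 ^ k * ((4 ^ r - 1) * (4 ^ r + 2))"
proof -
  let ?D = "hermitian_dual (2 * m) S"
  have lin: "linear_code (2 * m) S" using S by (simp add: self_orthogonal_def)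
  have fin: "finite ?D"
    by (rule finite_subset [of _ "carrier_vec (2 * m)"]) (auto simp: hermitian_dual_def)
  define E where "E = {v \<in> ?D. even (wt v)}"
  have "4 ^ k * card ?D = 4 ^ (2 * m)"
    using card_hermitian_dual [OF lin] by (simp add: card)
  also have "(4 :: nat) ^ (2 * m) = 4 ^ k * 4 ^ (k + 2 * r)"
    using \<open>k + r = m\<close> by (simp flip: power_add add: mult_2)
  finally have cD: "card ?D = 4 ^ (k + 2 * r)" by simp
  have "(\<Sum>y\<in>?D. (- 1) ^ wt y) = (- 2 :: int) ^ (2 * m)"
    by (rule sum_sign_hermitian_dual [OF lin self_orthogonal_even [OF S]])
  also have "\<dots> = 4 ^ (k + r)"
    using \<open>k + r = m\<close> by (simp add: power_mult)
  finally have "(\<Sum>y\<in>?D. (- 1) ^ wt y + 1) = (4 ^ (k + r) + 4 ^ (k + 2 * r) :: int)"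
    by (simp add: sum.distrib cD)
  moreover have "(\<Sum>y\<in>?D. (- 1) ^ wt y + 1) = (\<Sum>y\<in>?D. if even (wt y) then 2 else (0 :: int))"
    by (rule sum.cong) auto
  moreover have "\<dots> = 2 * int (card E)"
    using fin by (simp add: E_def flip: sum.inter_filter)
  ultimately have "int (2 * card E) = int (4 ^ (k + r) + 4 ^ (k + 2 * r))"
    by simp
  then have "2 * card E = 4 ^ (k + r) + 4 ^ (k + 2 * r)"
    by (simp only: of_nat_eq_iff)
  moreover have "S \<subseteq> E"
    using S self_orthogonal_even [OF S] by (auto simp: E_def self_orthogonal_def)
  moreover have "{v \<in> ?D - S. even (wt v)} = E - S" by (auto simp: E_def)
  ultimately have "2 * card {v \<in> ?D - S. even (wt v)} = 4 ^ (k + r) + 4 ^ (k + 2 * r) - 2 * 4 ^ k"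
    using finite_linear_code [OF lin] by (simp add: card_Diff_subset card diff_mult_distrib2)
  also have "\<dots> = 4 ^ k * (4 ^ r + 4 ^ r * 4 ^ r - 2)"
    by (simp add: power_add mult_2 diff_mult_distrib2 distrib_left mult.left_commute)
  also have "(4 :: nat) ^ r + 4 ^ r * 4 ^ r - 2 = (4 ^ r - 1) * (4 ^ r + 2)"
  proof -
    obtain q where "(4 :: nat) ^ r = Suc q" by (metis not0_implies_Suc power_not_zero zero_neq_numeral)
    then show ?thesis by (simp add: algebra_simps)
  qed
  finally show ?thesis .
qed

text \<open>The mass formula relative to \<open>S\<close>, by double counting pairs of an even
  vector \<open>v\<close> of the dual outside \<open>S\<close> and a self-dual code containing
  \<open>S\<close> and \<open>v\<close>. For fixed \<open>v\<close> these are the codes over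
  \<open>code_ext S v\<close>, known by induction; a fixed code contains
  \<open>4 ^ m - 4 ^ k\<close> such vectors. The quotient is the new factor.\<close>

theorem card_self_dual_over:
  assumes "self_orthogonal (2 * m) S" "card S = 4 ^ k" "k + r = m"
  shows "card (self_dual_over (2 * m) S) = (\<Prod>i<r. 2 ^ (2 * i + 1) + 1)"
  using assms
proof (induction r arbitrary: S k)
  case 0
  let ?n = "2 * m"
  have lin: "linear_code ?n S" using 0 by (simp add: self_orthogonal_def)
  have pos: "(0 :: nat) < 4 ^ m" by simp
  have "4 ^ m * card (hermitian_dual ?n S) = 4 ^ m * 4 ^ m"
    using card_hermitian_dual [OF lin] 0 by (simp add: mult_2 power_add)
  then have card_dual: "card (hermitian_dual ?n S) = card S"
    using 0 pos by simp
  have fin: "finite (hermitian_dual ?n S)"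
    by (rule finite_subset [of _ "carrier_vec ?n"]) (auto simp: hermitian_dual_def)
  have "S = hermitian_dual ?n S"
    by (rule card_subset_eq [OF fin]) (use 0 card_dual in \<open>auto simp: self_orthogonal_def\<close>)
  then have S: "hermitian_self_dual ?n S" using lin by (simp add: hermitian_self_dual_def)
  have "C = S" if "hermitian_self_dual ?n C" "S \<subseteq> C" for C
  proof (rule sym, rule card_subset_eq)
    show "finite C" using that(1) finite_linear_code by (auto simp: hermitian_self_dual_def)
    show "card S = card C" using card_self_dual [OF that(1)] card_self_dual [OF S] by simp
  qed fact
  then have "self_dual_over ?n S = {S}" using S by (auto simp: self_dual_over_def)
  then show ?case by simp
next
  case (Suc r)
  let ?n = "2 * m" and ?P = "\<Prod>i<r. 2 ^ (2 * i + 1) + 1 :: nat"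
  let ?X = "self_dual_over ?n S"
  have lin: "linear_code ?n S" using Suc.prems by (simp add: self_orthogonal_def)
  define E where "E = {v \<in> hermitian_dual ?n S - S. even (wt v)}"
  have finE: "finite E"
    by (rule finite_subset [of _ "carrier_vec ?n"]) (auto simp: E_def hermitian_dual_def)
  have inE: "C - S \<subseteq> E" if "C \<in> ?X" for C
  proof
    fix v assume v: "v \<in> C - S"
    have C: "hermitian_self_dual ?n C" "S \<subseteq> C" using that by (auto simp: self_dual_over_def)
    have "v \<in> hermitian_dual ?n C" using C(1) v by (auto simp: hermitian_self_dual_def)
    then have "v \<in> hermitian_dual ?n S" using C(2) by (auto simp: hermitian_dual_def)
    then show "v \<in> E"
      using v self_orthogonal_even [OF self_dual_self_orthogonal [OF C(1)]] by (auto simp: E_def)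
  qed
  have "(\<Sum>v\<in>E. card {C \<in> ?X. v \<in> C}) = (\<Sum>C\<in>?X. card {v \<in> E. v \<in> C})"
    by (rule sum_multicount_gen [OF finE finite_self_dual_over]) auto
  also have "\<dots> = (\<Sum>C\<in>?X. 4 ^ m - 4 ^ k)"
  proof (rule sum.cong [OF refl])
    fix C assume CX: "C \<in> ?X"
    then have C: "hermitian_self_dual ?n C" "S \<subseteq> C" by (auto simp: self_dual_over_def)
    have "{v \<in> E. v \<in> C} = C - S" using inE [OF CX] by (auto simp: E_def)
    moreover have "card C = 4 ^ m" using card_self_dual [OF C(1)] by (simp add: power_mult)
    ultimately show "card {v \<in> E. v \<in> C} = 4 ^ m - 4 ^ k"
      using C(2) Suc.prems finite_linear_code [OF lin] by (simp add: card_Diff_subset)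
  qed
  also have "(\<Sum>v\<in>E. card {C \<in> ?X. v \<in> C}) = (\<Sum>v\<in>E. ?P)"
  proof (rule sum.cong [OF refl])
    fix v assume vE: "v \<in> E"
    then have v: "v \<in> carrier_vec ?n" "v \<notin> S" "v \<in> hermitian_dual ?n S" "even (wt v)"
      by (auto simp: E_def hermitian_dual_def)
    have "{C \<in> ?X. v \<in> C} = self_dual_over ?n (code_ext S v)"
      using code_ext_subset_iff [OF lin v(1)]
      by (auto simp: self_dual_over_def hermitian_self_dual_def)
    also have "card \<dots> = ?P"
    proof (rule Suc.IH)
      show "self_orthogonal ?n (code_ext S v)"
        by (rule self_orthogonal_code_ext [OF lin v(1) Suc.prems(1) v(3,4)])
      show "card (code_ext S v) = 4 ^ Suc k"
        using card_code_ext [OF lin v(1,2)] Suc.prems by simp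
    qed (use Suc.prems in simp)
    finally show "card {C \<in> ?X. v \<in> C} = ?P" .
  qed
  finally have "card E * ?P = card ?X * (4 ^ m - 4 ^ k)" by simp
  then have "2 * card E * ?P = 2 * (card ?X * (4 ^ m - 4 ^ k))" by (simp only: mult.assoc)
  moreover have "2 * card E = 4 ^ k * ((4 ^ Suc r - 1) * (4 ^ Suc r + 2))"
    unfolding E_def by (rule card_even_hermitian_dual [OF Suc.prems])
  moreover have "(4 :: nat) ^ m - 4 ^ k = 4 ^ k * (4 ^ Suc r - 1)"
    using Suc.prems(3) by (simp add: power_add diff_mult_distrib2 flip: Suc.prems(3))
  \<comment> \<open>The 2 cancels against the doubled count of even vectors and leaves the factor
    with index \<open>r\<close>.\<close>
  moreover have "(4 :: nat) ^ Suc r + 2 = 2 * (2 ^ (2 * r + 1) + 1)"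
    by (simp add: power_mult)
  ultimately have "4 ^ k * ((4 ^ Suc r - 1) * (2 * (2 ^ (2 * r + 1) + 1))) * ?P
      = 2 * (card ?X * (4 ^ k * (4 ^ Suc r - 1)))"
    by (simp only:)
  then have "(2 * 4 ^ k * (4 ^ Suc r - 1)) * ((2 ^ (2 * r + 1) + 1) * ?P)
      = (2 * 4 ^ k * (4 ^ Suc r - 1)) * card ?X"
    by (simp only: mult_ac)
  moreover have "2 * 4 ^ k * ((4 :: nat) ^ Suc r - 1) \<noteq> 0"
  proof -
    have "(4 :: nat) ^ Suc r > 1" by (rule one_less_power) auto
    then show ?thesis by simp
  qed
  ultimately have "card ?X = (2 ^ (2 * r + 1) + 1) * ?P" by simp
  then show ?case by (simp add: mult.commute)
qed


section \<open>Monomial and semilinear maps\<close>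

definition frob :: "bool \<Rightarrow> gf4 \<Rightarrow> gf4" where
  "frob e a = (if e then a\<^sup>2 else a)"

lemma frob_add: "frob e (a + b) = frob e a + frob e b"
  by (simp add: frob_def gf4_power2_add)

lemma frob_mult: "frob e (a * b) = frob e a * frob e b"
  by (simp add: frob_def power_mult_distrib)

lemma frob_0 [simp]: "frob e 0 = 0"
  by (simp add: frob_def)

lemma frob_1 [simp]: "frob e 1 = 1"
  by (simp add: frob_def)

lemma frob_eq_0_iff [simp]: "frob e a = 0 \<longleftrightarrow> a = 0"
  by (simp add: frob_def)

lemma frob_frob: "frob e (frob e' a) = frob (e \<noteq> e') a"
  by (simp add: frob_def)

lemma frob_idem [simp]: "frob e (frob e a) = a"
  by (simp add: frob_def)

lemma frob_False [simp]: "frob False a = a"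
  by (simp add: frob_def)

lemma frob_inj: "frob e a = frob e b \<longleftrightarrow> a = b"
  by (metis frob_idem)

lemma frob_power2: "frob e (a\<^sup>2) = (frob e a)\<^sup>2"
  by (simp add: frob_def)

lemma frob_sum: "frob e (\<Sum>i\<in>A. f i) = (\<Sum>i\<in>A. frob e (f i))"
  by (induction A rule: infinite_finite_induct) (auto simp: frob_add)

type_synonym semi = "bool \<times> (nat \<Rightarrow> nat) \<times> (nat \<Rightarrow> gf4)"

text \<open>The triple \<open>(e, p, d)\<close> stands for the monomial matrix with entry \<open>d j\<close> at position
  \<open>(p j, j)\<close>, preceded by the Frobenius map if \<open>e\<close> holds; \<open>semi_maps n False\<close> is the group of
  monomial matrices. Semilinear maps are included because supports of codewords do not distinguish
  a code from its conjugate.\<close>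

definition act :: "nat \<Rightarrow> semi \<Rightarrow> gf4 vec \<Rightarrow> gf4 vec" where
  "act n = (\<lambda>(e, p, d) v. vec n (\<lambda>j. d j * frob e (v $ p j)))"

definition semi_maps :: "nat \<Rightarrow> bool \<Rightarrow> semi set" where
  "semi_maps n b = {e. e \<longrightarrow> b} \<times> {p. p permutes {..<n}} \<times> ({..<n} \<rightarrow>\<^sub>E UNIV - {0})"

text \<open>The map \<open>h\<close> acts before \<open>g\<close>, but the permutations compose the
  other way round because \<open>act\<close> reads the source coordinate \<open>p j\<close>. The
  restriction keeps coefficient functions extensional, so that each monomial matrix has exactly one
  triple.\<close>

definition semi_comp :: "nat \<Rightarrow> semi \<Rightarrow> semi \<Rightarrow> semi" where
  "semi_comp n = (\<lambda>(e, p, d) (e', p', d').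
     (e \<noteq> e', p' \<circ> p, restrict (\<lambda>j. d j * frob e (d' (p j))) {..<n}))"

definition semi_inv :: "nat \<Rightarrow> semi \<Rightarrow> semi" where
  "semi_inv n = (\<lambda>(e, p, d). (e, inv_into UNIV p, restrict (\<lambda>j. frob e (inverse (d (inv_into UNIV p j)))) {..<n}))"

lemma semi_mapsE:
  assumes "g \<in> semi_maps n b"
  obtains e p d where "g = (e, p, d)" "e \<longrightarrow> b" "p permutes {..<n}" "d \<in> extensional {..<n}"
    "\<And>j. j < n \<Longrightarrow> p j < n" "\<And>j. j < n \<Longrightarrow> d j \<noteq> 0"
  using assms permutes_in_image
  by (cases g) (fastforce simp: semi_maps_def PiE_def Pi_def)

lemma semi_mapsD:
  assumes "(e, p, d) \<in> semi_maps n b"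
  shows "e \<longrightarrow> b" "p permutes {..<n}" "d \<in> extensional {..<n}"
    "\<And>j. j < n \<Longrightarrow> p j < n" "\<And>j. j < n \<Longrightarrow> d j \<noteq> 0"
  using assms by (auto elim!: semi_mapsE)

lemma semi_mapsI:
  "e \<longrightarrow> b \<Longrightarrow> p permutes {..<n} \<Longrightarrow> (\<And>j. j < n \<Longrightarrow> d j \<noteq> 0) \<Longrightarrow>
    (e, p, restrict d {..<n}) \<in> semi_maps n b"
  by (auto simp: semi_maps_def)

lemma card_semi_maps: "card (semi_maps n b) = (if b then 2 else 1) * (fact n * 3 ^ n)"
proof -
  have "{e. e \<longrightarrow> b} = (if b then UNIV else {False})" by auto
  then have "card {e. e \<longrightarrow> b} = (if b then 2 else 1)" by (simp add: card_UNIV_bool)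
  moreover have "card (UNIV - {0 :: gf4}) = 3" by (simp add: card_Diff_subset card_gf4)
  ultimately show ?thesis
    by (simp add: semi_maps_def card_cartesian_product card_permutations [of _ n] card_PiE)
qed

lemma finite_semi_maps: "finite (semi_maps n b)"
  unfolding semi_maps_def by (intro finite_cartesian_product finite_permutations finite_PiE) auto

lemma semi_maps_mono: "g \<in> semi_maps n False \<Longrightarrow> g \<in> semi_maps n b"
  by (auto simp: semi_maps_def)

lemma act_carrier [simp]: "act n g v \<in> carrier_vec n"
  by (auto simp: act_def split: prod.splits)

lemma act_index: "j < n \<Longrightarrow> act n (e, p, d) v $ j = d j * frob e (v $ p j)"
  by (simp add: act_def)

lemma semi_comp_in: "g \<in> semi_maps n b \<Longrightarrow> h \<in> semi_maps n b \<Longrightarrow> semi_comp n g h \<in> semi_maps n b"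
  by (elim semi_mapsE) (auto simp: semi_comp_def intro!: semi_mapsI permutes_compose)

lemma act_comp:
  assumes "g \<in> semi_maps n b"
  shows "act n (semi_comp n g h) v = act n g (act n h v)"
  using assms by (elim semi_mapsE; cases h)
    (auto simp: semi_comp_def act_def frob_mult frob_frob mult.assoc intro!: eq_vecI)

lemma semi_inv_in: "g \<in> semi_maps n b \<Longrightarrow> semi_inv n g \<in> semi_maps n b"
proof (elim semi_mapsE)
  fix e p d assume *: "g = (e, p, d)" "e \<longrightarrow> b" "p permutes {..<n}" "\<And>j. j < n \<Longrightarrow> d j \<noteq> 0"
  have "inv_into UNIV p j < n" if "j < n" for j
    using permutes_in_image [OF permutes_inv [OF *(3)], of j] that by simp
  then show ?thesis using * by (auto simp: semi_inv_def permutes_inv intro!: semi_mapsI)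
qed

lemma act_inv:
  assumes g: "g \<in> semi_maps n b" and v: "v \<in> carrier_vec n"
  shows "act n (semi_inv n g) (act n g v) = v" "act n g (act n (semi_inv n g) v) = v"
proof -
  obtain e p d where *: "g = (e, p, d)" "p permutes {..<n}" "\<And>j. j < n \<Longrightarrow> p j < n"
    "\<And>j. j < n \<Longrightarrow> d j \<noteq> 0"
    using g by (elim semi_mapsE) blast
  have inv: "inv_into UNIV p j < n" if "j < n" for j
    using permutes_in_image [OF permutes_inv [OF *(2)], of j] that by simp
  note pi = permutes_inverses [OF *(2)]
  have [simp]: "frob e (inverse a) * (frob e a * b) = b" if "a \<noteq> 0" for a b
    using that by (simp flip: frob_mult mult.assoc)
  show "act n (semi_inv n g) (act n g v) = v"
    using v inv *(4) by (intro eq_vecI) (auto simp: semi_inv_def *(1) act_index pi frob_mult)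
  show "act n g (act n (semi_inv n g) v) = v"
    using v inv *(3,4)
    by (intro eq_vecI) (auto simp: semi_inv_def *(1) act_index pi frob_mult simp flip: mult.assoc)
qed

lemma inj_on_act: "g \<in> semi_maps n b \<Longrightarrow> inj_on (act n g) (carrier_vec n)"
  by (rule inj_on_inverseI) (rule act_inv)

text \<open>Left cancellation, by which a set of maps can be carried into a stabilizer without
  loss.\<close>

lemma inj_semi_comp:
  assumes "g \<in> semi_maps n b" shows "inj_on (semi_comp n g) (semi_maps n b)"
proof (rule inj_onI)
  fix h h' assume h: "h \<in> semi_maps n b" "h' \<in> semi_maps n b" and eq: "semi_comp n g h = semi_comp n g h'"
  obtain e p d where g: "g = (e, p, d)" "p permutes {..<n}" "\<And>j. j < n \<Longrightarrow> d j \<noteq> 0"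
    using assms by (elim semi_mapsE) blast
  obtain e1 p1 d1 where h1: "h = (e1, p1, d1)" "d1 \<in> extensional {..<n}"
    using h(1) by (elim semi_mapsE) blast
  obtain e2 p2 d2 where h2: "h' = (e2, p2, d2)" "d2 \<in> extensional {..<n}"
    using h(2) by (elim semi_mapsE) blast
  have "e1 = e2" and pp: "p1 \<circ> p = p2 \<circ> p"
    using eq by (auto simp: semi_comp_def g(1) h1(1) h2(1))
  have "p1 = p2"
    using pp permutes_surj [OF g(2)] by (metis surj_fun_eq)
  have "d1 i = d2 i" if "i < n" for i
  proof -
    define j where "j = inv_into UNIV p i"
    have j: "j < n" "p j = i"
      using permutes_in_image [OF permutes_inv [OF g(2)], of i] that permutes_inverses [OF g(2)]
      by (auto simp: j_def)
    have "d j * frob e (d1 (p j)) = d j * frob e (d2 (p j))"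
      using eq j(1) by (auto simp: semi_comp_def g(1) h1(1) h2(1) restrict_def fun_eq_iff split: if_splits)
    then show ?thesis using g(3) [OF j(1)] j(2) by (simp add: frob_inj)
  qed
  then have "d1 = d2" using extensionalityI [OF h1(2) h2(2)] by auto
  then show "h = h'" using \<open>e1 = e2\<close> \<open>p1 = p2\<close> h1 h2 by simp
qed

section \<open>Stabilizers and orbits\<close>

definition stab :: "nat \<Rightarrow> bool \<Rightarrow> gf4 vec set \<Rightarrow> semi set" where
  "stab n b C = {g \<in> semi_maps n b. act n g ` C = C}"

definition orbit :: "nat \<Rightarrow> bool \<Rightarrow> gf4 vec set \<Rightarrow> gf4 vec set set" where
  "orbit n b C = (\<lambda>g. act n g ` C) ` semi_maps n b"

text \<open>Orbit-stabilizer as an inequality: multiplication by \<open>semi_inv n g\<close> carries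
  all maps that send \<open>C\<close> to the same code as \<open>g\<close> into the stabilizer, so
  every fibre has at most \<open>t\<close> elements.\<close>

lemma card_orbit:
  assumes C: "C \<subseteq> carrier_vec n" and t: "card (stab n b C) \<le> t"
  shows "card (semi_maps n b) \<le> t * card (orbit n b C)"
proof -
  let ?G = "semi_maps n b" and ?f = "\<lambda>g. act n g ` C"
  have "card {g \<in> ?G. ?f g = D} \<le> t" if D: "D \<in> orbit n b C" for D
  proof -
    obtain g where g: "g \<in> ?G" "D = act n g ` C" using D unfolding orbit_def by blast
    have "semi_comp n (semi_inv n g) h \<in> stab n b C" if h: "h \<in> ?G" "?f h = D" for h
    proof -
      have "act n (semi_comp n (semi_inv n g) h) ` C = act n (semi_inv n g) ` act n h ` C"
        by (simp add: act_comp [OF semi_inv_in [OF g(1)]] image_image)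
      also have "\<dots> = (\<lambda>v. act n (semi_inv n g) (act n g v)) ` C"
        using g(2) h(2) by (simp add: image_image)
      also have "\<dots> = id ` C"
        by (rule image_cong) (use C act_inv(1) [OF g(1)] in auto)
      finally show ?thesis
        using semi_comp_in [OF semi_inv_in [OF g(1)] h(1)] by (simp add: stab_def)
    qed
    then have "semi_comp n (semi_inv n g) ` {g \<in> ?G. ?f g = D} \<subseteq> stab n b C" by blast
    moreover have "inj_on (semi_comp n (semi_inv n g)) {g \<in> ?G. ?f g = D}"
      by (rule inj_on_subset [OF inj_semi_comp [OF semi_inv_in [OF g(1)]]]) blast
    moreover have "finite (stab n b C)"
      by (simp add: stab_def finite_semi_maps)
    ultimately have "card {g \<in> ?G. ?f g = D} \<le> card (stab n b C)"
      by (intro card_inj_on_le)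
    then show ?thesis using t by linarith
  qed
  then have "(\<Sum>D\<in>?f ` ?G. \<Sum>g\<in>{g \<in> ?G. ?f g = D}. 1) \<le> (\<Sum>D\<in>?f ` ?G. t)"
    by (intro sum_mono) (simp add: orbit_def)
  also have "(\<Sum>D\<in>?f ` ?G. \<Sum>g\<in>{g \<in> ?G. ?f g = D}. 1) = (\<Sum>g\<in>?G. 1)"
    by (rule sum.image_gen [symmetric]) (rule finite_semi_maps)
  finally show ?thesis by (simp add: orbit_def mult.commute)
qed

lemma orbit_eq:
  assumes C: "C \<subseteq> carrier_vec n" and "D \<in> orbit n b C"
  shows "orbit n b D = orbit n b C"
proof -
  have sub: "orbit n b D \<subseteq> orbit n b C" if D: "D \<in> orbit n b C" for C D
  proof -
    obtain g where g: "g \<in> semi_maps n b" "D = act n g ` C" using D unfolding orbit_def by blast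
    have "act n h ` D \<in> orbit n b C" if "h \<in> semi_maps n b" for h
    proof -
      have "act n h ` D = act n (semi_comp n h g) ` C"
        by (simp add: g(2) image_image act_comp [OF that])
      then show ?thesis using semi_comp_in [OF that g(1)] unfolding orbit_def by blast
    qed
    then show ?thesis unfolding orbit_def [of n b D] by blast
  qed
  obtain g where g: "g \<in> semi_maps n b" "D = act n g ` C" using assms(2) unfolding orbit_def by blast
  have "act n (semi_inv n g) ` D = id ` C"
    unfolding g(2) image_image by (rule image_cong) (use C act_inv(1) [OF g(1)] in auto)
  then have "C = (\<lambda>h. act n h ` D) (semi_inv n g)" by simp
  then have "C \<in> orbit n b D"
    unfolding orbit_def by (rule image_eqI) (rule semi_inv_in [OF g(1)])
  then show ?thesis using sub assms(2) by blast
qed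

section \<open>Invariance of weights and self-duality\<close>

lemma wt_act: "g \<in> semi_maps n b \<Longrightarrow> v \<in> carrier_vec n \<Longrightarrow> wt (act n g v) = wt v"
proof (elim semi_mapsE)
  fix e p d assume v: "v \<in> carrier_vec n" and *: "g = (e, p, d)" "p permutes {..<n}"
    "\<And>j. j < n \<Longrightarrow> p j < n" "\<And>j. j < n \<Longrightarrow> d j \<noteq> 0"
  have "bij_betw p {j. j < n \<and> v $ p j \<noteq> 0} {i. i < n \<and> v $ i \<noteq> 0}"
  proof (rule bij_betwI [where g = "inv_into UNIV p"])
    show "inv_into UNIV p \<in> {i. i < n \<and> v $ i \<noteq> 0} \<rightarrow> {j. j < n \<and> v $ p j \<noteq> 0}"
      using permutes_in_image [OF permutes_inv [OF *(2)]] permutes_inverses [OF *(2)] by auto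
  qed (use *(3) permutes_inverses [OF *(2)] in auto)
  moreover have "{j. j < dim_vec (act n g v) \<and> act n g v $ j \<noteq> 0} = {j. j < n \<and> v $ p j \<noteq> 0}"
    using *(4) by (auto simp: *(1) act_def)
  ultimately show ?thesis using v by (simp add: wt_def bij_betw_same_card)
qed

text \<open>Every nonzero scalar has norm 1, so arbitrary coefficients preserve the form; only the
  Frobenius map has an effect, and it merely conjugates the value.\<close>

lemma hermitian_prod_act:
  assumes "g = (e, p, d)" "g \<in> semi_maps n b" "x \<in> carrier_vec n" "y \<in> carrier_vec n"
  shows "hermitian_prod (act n g x) (act n g y) = frob e (hermitian_prod x y)"
proof -
  have p: "p permutes {..<n}" and d: "j < n \<Longrightarrow> d j \<noteq> 0" for j
    using assms(1,2) semi_mapsD(2,5) [of e p d n b] by auto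
  have "hermitian_prod (act n g x) (act n g y)
    = (\<Sum>j<n. (d j * (d j)\<^sup>2) * (frob e (x $ p j) * (frob e (y $ p j))\<^sup>2))"
    by (auto simp: hermitian_prod_def assms(1) act_def power_mult_distrib mult_ac intro!: sum.cong)
  also have "\<dots> = (\<Sum>j<n. frob e (x $ p j * (y $ p j)\<^sup>2))"
    using d by (intro sum.cong) (auto simp: gf4_mult_power2 frob_mult frob_power2)
  also have "\<dots> = (\<Sum>j<n. frob e (x $ j * (y $ j)\<^sup>2))"
    by (rule sum.permute [OF p, of "\<lambda>j. frob e (x $ j * (y $ j)\<^sup>2)", unfolded comp_def, symmetric])
  finally show ?thesis using assms(3) by (simp add: hermitian_prod_def frob_sum)
qed

lemma act_add:
  "v \<in> carrier_vec n \<Longrightarrow> w \<in> carrier_vec n \<Longrightarrow> g \<in> semi_maps n b \<Longrightarrow>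
    act n g (v + w) = act n g v + act n g w"
  by (elim semi_mapsE) (auto simp: act_def frob_add distrib_left intro!: eq_vecI)

lemma act_smult:
  "v \<in> carrier_vec n \<Longrightarrow> (e, p, d) \<in> semi_maps n b \<Longrightarrow>
    act n (e, p, d) (a \<cdot>\<^sub>v v) = frob e a \<cdot>\<^sub>v act n (e, p, d) v"
  by (elim semi_mapsE) (auto simp: act_def frob_mult intro!: eq_vecI)

lemma linear_code_act:
  assumes C: "linear_code n C" and g: "g \<in> semi_maps n b"
  shows "linear_code n (act n g ` C)"
proof -
  obtain e p d where epd: "g = (e, p, d)" by (cases g)
  have Cn: "x \<in> carrier_vec n" if "x \<in> C" for x using that linear_codeD(1) [OF C] by blast
  show ?thesis
    unfolding linear_code_iff
  proof (intro conjI ballI allI)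
    have "0\<^sub>v n = act n g (0\<^sub>v n)"
      using g by (elim semi_mapsE) (auto simp: act_def intro!: eq_vecI)
    then show "0\<^sub>v n \<in> act n g ` C" using linear_codeD(2) [OF C] by blast
    show "x + y \<in> act n g ` C" if xy: "x \<in> act n g ` C" "y \<in> act n g ` C" for x y
    proof -
      obtain x' y' where xy': "x' \<in> C" "x = act n g x'" "y' \<in> C" "y = act n g y'"
        using xy by blast
      then have "x + y = act n g (x' + y')" using act_add [OF Cn Cn g] by simp
      then show ?thesis using linear_codeD(3) [OF C] xy'(1,3) by blast
    qed
    show "a \<cdot>\<^sub>v x \<in> act n g ` C" if x: "x \<in> act n g ` C" for a x
    proof -
      obtain y where y: "y \<in> C" "x = act n g y" using x by blast
      have "a \<cdot>\<^sub>v x = act n g (frob e a \<cdot>\<^sub>v y)"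
        using act_smult [OF Cn [OF y(1)], of e p d b] g by (simp add: epd y(2))
      then show ?thesis using linear_codeD(4) [OF C y(1)] by blast
    qed
  qed auto
qed

text \<open>A self-orthogonal code of size \<open>2 ^ n\<close> has a dual of the same size and
  therefore equals it. This reduces the invariance of self-duality to that of orthogonality and
  size.\<close>

lemma hermitian_self_dual_iff_card:
  "hermitian_self_dual n C \<longleftrightarrow> self_orthogonal n C \<and> card C = 2 ^ n"
proof
  assume C: "self_orthogonal n C \<and> card C = 2 ^ n"
  then have lin: "linear_code n C" by (simp add: self_orthogonal_def)
  have "2 ^ n * card (hermitian_dual n C) = 4 ^ n" using card_hermitian_dual [OF lin] C by simp
  also have "(4 :: nat) ^ n = 2 ^ n * 2 ^ n" by (simp flip: power_mult_distrib)
  finally have card: "card (hermitian_dual n C) = 2 ^ n" by simp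
  have "finite (hermitian_dual n C)"
    by (rule finite_subset [of _ "carrier_vec n"]) (auto simp: hermitian_dual_def)
  then have "C = hermitian_dual n C"
    by (rule card_subset_eq) (use C card in \<open>auto simp: self_orthogonal_def\<close>)
  then show "hermitian_self_dual n C" using lin by (simp add: hermitian_self_dual_def)
qed (simp add: self_dual_self_orthogonal card_self_dual)

lemma hermitian_self_dual_act:
  assumes C: "hermitian_self_dual n C" and g: "g \<in> semi_maps n b"
  shows "hermitian_self_dual n (act n g ` C)"
proof -
  obtain e p d where epd: "g = (e, p, d)" by (cases g)
  have Cn: "C \<subseteq> carrier_vec n" by (rule hermitian_self_dual_subset [OF C])
  have lin: "linear_code n C" using C by (simp add: hermitian_self_dual_def)
  have "hermitian_prod x y = 0" if "x \<in> C" "y \<in> C" for x y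
    using C that by (auto simp: hermitian_self_dual_def hermitian_dual_def)
  then have "act n g ` C \<subseteq> hermitian_dual n (act n g ` C)"
    using hermitian_prod_act [OF epd g] Cn by (auto simp: hermitian_dual_def subset_iff)
  moreover have "card (act n g ` C) = card C"
    by (rule card_image [OF inj_on_subset [OF inj_on_act [OF g] Cn]])
  ultimately show ?thesis
    using linear_code_act [OF lin g] card_self_dual [OF C]
    by (simp add: hermitian_self_dual_iff_card self_orthogonal_def)
qed

section \<open>Automorphism groups\<close>

definition semi_mat :: "nat \<Rightarrow> semi \<Rightarrow> gf4 mat" where
  "semi_mat n = (\<lambda>(e, p, d). mat n n (\<lambda>(i, j). if i = p j then d j else 0))"

lemma row_vec_mult_semi_mat:
  assumes g: "g \<in> semi_maps n False" and c: "c \<in> carrier_vec n"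
  shows "row_vec_mult_mat c (semi_mat n g) = act n g c"
proof -
  obtain e p d where epd: "g = (e, p, d)" "\<not> e" "\<And>j. j < n \<Longrightarrow> p j < n"
    using g by (elim semi_mapsE) blast
  show ?thesis
  proof (rule eq_vecI)
    fix j assume "j < dim_vec (act n g c)"
    then have j: "j < n" by (simp add: epd act_def)
    have "row_vec_mult_mat c (semi_mat n g) $ j = (\<Sum>i<n. (if i = p j then d j else 0) * c $ i)"
      using c j by (simp add: row_vec_mult_mat_def semi_mat_def epd(1) scalar_prod_def atLeast0LessThan)
    also have "\<dots> = (\<Sum>i<n. if i = p j then d j * c $ i else 0)"
      by (intro sum.cong) auto
    also have "\<dots> = d j * c $ p j"
      using epd(3) [OF j] by simp
    finally show "row_vec_mult_mat c (semi_mat n g) $ j = act n g c $ j"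
      using j epd(2) by (simp add: epd(1) act_def)
  qed (simp add: row_vec_mult_mat_def semi_mat_def epd(1) act_def)
qed

lemma monomial_semi_mat:
  assumes g: "g \<in> semi_maps n False" shows "monomial_mat n (semi_mat n g)"
proof -
  obtain e p d where *: "g = (e, p, d)" "p permutes {..<n}" "\<And>j. j < n \<Longrightarrow> p j < n"
    "\<And>j. j < n \<Longrightarrow> d j \<noteq> 0"
    using g by (elim semi_mapsE) blast
  have inv: "inv_into UNIV p i < n" if "i < n" for i
    using permutes_in_image [OF permutes_inv [OF *(2)], of i] that by simp
  have "\<exists>!j. j < n \<and> semi_mat n g $$ (i, j) \<noteq> 0" if "i < n" for i
    using that inv [OF that] *(4) permutes_inverses [OF *(2)]
    by (intro ex1I [of _ "inv_into UNIV p i"]) (auto simp: semi_mat_def *(1) split: if_splits)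
  moreover have "\<exists>!i. i < n \<and> semi_mat n g $$ (i, j) \<noteq> 0" if "j < n" for j
    using that *(3,4) by (intro ex1I [of _ "p j"]) (auto simp: semi_mat_def *(1) split: if_splits)
  ultimately show ?thesis by (simp add: monomial_mat_def semi_mat_def *(1))
qed

lemma monomial_mat_imp_semi_mat:
  assumes M: "monomial_mat n M"
  obtains g where "g \<in> semi_maps n False" "M = semi_mat n g"
proof -
  define p where "p j = (if j < n then THE i. i < n \<and> M $$ (i, j) \<noteq> 0 else j)" for j
  have col: "\<exists>!i. i < n \<and> M $$ (i, j) \<noteq> 0" if "j < n" for j
    using M that by (simp add: monomial_mat_def)
  have p: "p j < n" "M $$ (p j, j) \<noteq> 0" if "j < n" for j
    using theI' [OF col [OF that]] that by (auto simp: p_def)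
  have p_eq: "i = p j" if "i < n" "j < n" "M $$ (i, j) \<noteq> 0" for i j
    using col [OF that(2)] p [OF that(2)] that by blast
  have "inj_on p {..<n}"
  proof (rule inj_onI)
    fix j j' assume "j \<in> {..<n}" "j' \<in> {..<n}" "p j = p j'"
    then show "j = j'" using M p [of j] p [of j'] unfolding monomial_mat_def by (metis lessThan_iff)
  qed
  then have perm: "p permutes {..<n}"
    by (intro inj_imp_permutes) (use p in \<open>auto simp: p_def\<close>)
  define g where "g = (False, p, restrict (\<lambda>j. M $$ (p j, j)) {..<n})"
  have "g \<in> semi_maps n False"
    unfolding g_def by (rule semi_mapsI) (use perm p in auto)
  moreover have "M = semi_mat n g"
  proof (rule eq_matI)
    fix i j assume "i < dim_row (semi_mat n g)" "j < dim_col (semi_mat n g)"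
    then have "i < n" "j < n" by (auto simp: semi_mat_def g_def)
    then show "M $$ (i, j) = semi_mat n g $$ (i, j)"
      using p_eq [of i j] by (auto simp: semi_mat_def g_def)
  qed (use M in \<open>auto simp: monomial_mat_def semi_mat_def g_def\<close>)
  ultimately show thesis by (rule that)
qed

lemma code_aut_eq:
  assumes C: "C \<subseteq> carrier_vec n"
  shows "code_aut n C = semi_mat n ` stab n False C"
proof -
  have img: "(\<lambda>c. row_vec_mult_mat c (semi_mat n g)) ` C = act n g ` C" if "g \<in> semi_maps n False" for g
    using row_vec_mult_semi_mat [OF that] C by (intro image_cong) auto
  show ?thesis
  proof (intro equalityI subsetI)
    fix M assume M: "M \<in> code_aut n C"
    then have "monomial_mat n M" by (simp add: code_aut_def)
    then obtain g where g: "g \<in> semi_maps n False" "M = semi_mat n g"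
      by (rule monomial_mat_imp_semi_mat)
    then show "M \<in> semi_mat n ` stab n False C"
      using M img [OF g(1)] by (auto simp: code_aut_def stab_def)
  next
    fix M assume "M \<in> semi_mat n ` stab n False C"
    then obtain g where g: "g \<in> semi_maps n False" "act n g ` C = C" "M = semi_mat n g"
      unfolding stab_def by blast
    then show "M \<in> code_aut n C"
      using img [OF g(1)] monomial_semi_mat [OF g(1)] by (simp add: code_aut_def)
  qed
qed

lemma inj_semi_mat: "inj_on (semi_mat n) (semi_maps n False)"
proof (rule inj_onI)
  fix g h assume g: "g \<in> semi_maps n False" and h: "h \<in> semi_maps n False" and eq: "semi_mat n g = semi_mat n h"
  obtain e p d where g': "g = (e, p, d)" "\<not> e" "p permutes {..<n}" "d \<in> extensional {..<n}"
    "\<And>j. j < n \<Longrightarrow> p j < n" "\<And>j. j < n \<Longrightarrow> d j \<noteq> 0"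
    using g by (elim semi_mapsE) blast
  obtain e' p' d' where h': "h = (e', p', d')" "\<not> e'" "p' permutes {..<n}" "d' \<in> extensional {..<n}"
    "\<And>j. j < n \<Longrightarrow> p' j < n" "\<And>j. j < n \<Longrightarrow> d' j \<noteq> 0"
    using h by (elim semi_mapsE) blast
  have *: "p j = p' j \<and> d j = d' j" if "j < n" for j
    using arg_cong [OF eq, of "\<lambda>M. M $$ (p j, j)"] that g'(5,6) [OF that]
    by (auto simp: semi_mat_def g'(1) h'(1) split: if_splits)
  have "p = p'"
  proof
    fix j show "p j = p' j"
      using * permutes_not_in [OF g'(3), of j] permutes_not_in [OF h'(3), of j] by (cases "j < n") auto
  qed
  moreover have "d = d'" by (rule extensionalityI [OF g'(4) h'(4)]) (use * in auto)
  ultimately show "g = h" using g' h' by simp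
qed

lemma trivial_code_autD:
  assumes "trivial_code_aut n C" and C: "C \<subseteq> carrier_vec n"
  shows "card (stab n False C) \<le> 3"
    and "\<And>p d j. (False, p, d) \<in> stab n False C \<Longrightarrow> j < n \<Longrightarrow> p j = j"
proof -
  have aut: "semi_mat n ` stab n False C = {1\<^sub>m n, omega \<cdot>\<^sub>m 1\<^sub>m n, omega_bar \<cdot>\<^sub>m 1\<^sub>m n}"
    using assms code_aut_eq [OF C] by (simp add: trivial_code_aut_def)
  have "card (stab n False C) = card (semi_mat n ` stab n False C)"
    by (rule card_image [symmetric]) (auto intro: inj_on_subset [OF inj_semi_mat] simp: stab_def)
  also have "\<dots> \<le> 3"
    unfolding aut by (simp add: card_insert_if)
  finally show "card (stab n False C) \<le> 3" .
  fix p d j assume pd: "(False, p, d) \<in> stab n False C" and j: "j < n"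
  have "semi_mat n (False, p, d) \<in> {1\<^sub>m n, omega \<cdot>\<^sub>m 1\<^sub>m n, omega_bar \<cdot>\<^sub>m 1\<^sub>m n}"
    using aut pd by blast
  then have "semi_mat n (False, p, d) $$ (i, j) = 0" if "i < n" "i \<noteq> j" for i
    using that j by auto
  moreover have "p j < n" "d j \<noteq> 0" using pd j semi_mapsD(4,5) [of False p d n False] by (auto simp: stab_def)
  ultimately show "p j = j" using j by (force simp: semi_mat_def)
qed

lemma trivial_code_autI:
  assumes C: "linear_code n C" and "0 < n"
    and stab: "\<And>p d. (False, p, d) \<in> stab n False C \<Longrightarrow> p = id \<and> (\<forall>j<n. d j = d 0)"
  shows "trivial_code_aut n C"
proof -
  have Cn: "C \<subseteq> carrier_vec n" by (rule linear_codeD(1) [OF C])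
  have one: "(1 :: gf4) \<cdot>\<^sub>m 1\<^sub>m n = 1\<^sub>m n" by (rule eq_matI) auto
  have "M \<in> {1\<^sub>m n, omega \<cdot>\<^sub>m 1\<^sub>m n, omega_bar \<cdot>\<^sub>m 1\<^sub>m n}" if M: "M \<in> code_aut n C" for M
  proof -
    obtain g where g: "g \<in> stab n False C" "M = semi_mat n g" using M code_aut_eq [OF Cn] by auto
    obtain e p d where epd: "g = (e, p, d)" by (cases g)
    with g(1) have *: "(e, p, d) \<in> semi_maps n False" unfolding stab_def by blast
    then have pd: "g = (False, p, d)" "d 0 \<noteq> 0"
      using semi_mapsD(1,5) [OF *] \<open>0 < n\<close> epd by auto
    have "M = d 0 \<cdot>\<^sub>m 1\<^sub>m n"
    proof (rule eq_matI)
      fix i j assume "i < dim_row (d 0 \<cdot>\<^sub>m 1\<^sub>m n)" "j < dim_col (d 0 \<cdot>\<^sub>m 1\<^sub>m n)"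
      then have ij: "i < n" "j < n" by simp_all
      have "(False, p, d) \<in> stab n False C" using g(1) unfolding pd(1) .
      from stab [OF this] ij(2) have "p = id" "d j = d 0" by blast+
      then show "M $$ (i, j) = (d 0 \<cdot>\<^sub>m 1\<^sub>m n) $$ (i, j)"
        using ij unfolding g(2) pd(1) semi_mat_def by simp
    qed (unfold g(2) pd(1) semi_mat_def, simp_all)
    then show ?thesis
      using pd(2) one by (cases "d 0") (auto simp: gf4_def_simps)
  qed
  moreover have "1\<^sub>m n \<in> code_aut n C"
    using scalar_in_code_aut [OF C, of 1] by (simp add: one)
  moreover have "omega \<cdot>\<^sub>m 1\<^sub>m n \<in> code_aut n C" "omega_bar \<cdot>\<^sub>m 1\<^sub>m n \<in> code_aut n C"
    using scalar_in_code_aut [OF C] by (auto simp: zero_gf4_def)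
  ultimately show ?thesis by (auto simp: trivial_code_aut_def)
qed


section \<open>Codewords of weight four\<close>

lemma self_dual_prod: "hermitian_self_dual n C \<Longrightarrow> x \<in> C \<Longrightarrow> y \<in> C \<Longrightarrow> hermitian_prod x y = 0"
  by (auto simp: hermitian_self_dual_def hermitian_dual_def)

lemma stabI:
  assumes g: "g \<in> semi_maps n b" and C: "C \<subseteq> carrier_vec n" and sub: "act n g ` C \<subseteq> C"
  shows "g \<in> stab n b C"
proof -
  have "finite C" by (rule finite_subset [OF C]) simp
  then have "act n g ` C = C"
    by (rule endo_inj_surj [OF _ sub inj_on_subset [OF inj_on_act [OF g] C]])
  then show ?thesis using g by (simp add: stab_def)
qed

text \<open>Rescaling the word to \<open>(1, 1, 1, 1, 0, \<dots>)\<close>, a codeword \<open>y\<close> satisfies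
  \<open>y\<^sub>1 + y\<^sub>2 + y\<^sub>3 + y\<^sub>4 = 0\<close>, so that swapping both \<open>y\<^sub>1, y\<^sub>2\<close> and \<open>y\<^sub>3, y\<^sub>4\<close> adds
  \<open>y\<^sub>1 + y\<^sub>2\<close> times the word to \<open>y\<close>.\<close>

lemma weight_4_automorphism:
  assumes C: "hermitian_self_dual n C" and x: "x \<in> C" "wt x = 4"
  obtains p d j where "(False, p, d) \<in> stab n False C" "j < n" "p j \<noteq> j"
proof -
  have Cn: "C \<subseteq> carrier_vec n" by (rule hermitian_self_dual_subset [OF C])
  have lin: "linear_code n C" using C by (simp add: hermitian_self_dual_def)
  have xn: "x \<in> carrier_vec n" using x Cn by blast
  define S where "S = {i. i < n \<and> x $ i \<noteq> 0}"
  have "card S = 4" using x(2) xn by (simp add: wt_def S_def)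
  then obtain i1 i2 i3 i4 where S: "S = {i1, i2, i3, i4}" and dist: "distinct [i1, i2, i3, i4]"
    by (auto simp: eval_nat_numeral card_Suc_eq)
  have lt: "i1 < n" "i2 < n" "i3 < n" "i4 < n" and nz: "x $ i1 \<noteq> 0" "x $ i2 \<noteq> 0" "x $ i3 \<noteq> 0" "x $ i4 \<noteq> 0"
    using S by (auto simp: S_def)
  define p where "p = transpose i1 i2 \<circ> transpose i3 i4"
  have p: "p i1 = i2" "p i2 = i1" "p i3 = i4" "p i4 = i3" "\<And>i. i \<notin> S \<Longrightarrow> p i = i"
    using dist by (auto simp: p_def S transpose_def)
  have perm: "p permutes {..<n}"
    unfolding p_def using lt by (intro permutes_compose permutes_swap_id) auto
  \<comment> \<open>In the rescaled coordinates \<open>z i\<close> introduced below, the map with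
    these coefficients is the bare double transposition.\<close>
  define d where "d j = (if j \<in> S then x $ j * inverse (x $ p j) else 1)" for j
  define g where "g = (False, p, restrict d {..<n})"
  have g: "g \<in> semi_maps n False"
    unfolding g_def by (rule semi_mapsI) (use perm nz p in \<open>auto simp: d_def S\<close>)
  have "act n g y \<in> C" if y: "y \<in> C" for y
  proof -
    have yn: "y \<in> carrier_vec n" using y Cn by blast
    define z where "z i = y $ i * inverse (x $ i)" for i
    have yz: "y $ i = z i * x $ i" if "x $ i \<noteq> 0" for i
      using that by (simp add: z_def)
    have "0 = hermitian_prod y x" using self_dual_prod [OF C y x(1)] by simp
    \<comment> \<open>On the support the square of \<open>x $ i\<close> is its inverse, so
      orthogonality to \<open>x\<close> becomes a sum condition on the rescaled coordinates.\<close>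
    also have "\<dots> = (\<Sum>i\<in>S. z i)"
      unfolding hermitian_prod_def z_def gf4_inverse
      by (rule sum.mono_neutral_cong_right) (use yn in \<open>auto simp: S_def\<close>)
    also have "\<dots> = z i1 + z i2 + (z i3 + z i4)"
      using dist by (simp add: S add.assoc)
    finally have z: "z i1 + z i2 = z i3 + z i4"
      using gf4_add_eq_0_iff by metis
    have "act n g y = y + (z i1 + z i2) \<cdot>\<^sub>v x"
    proof (rule eq_vecI)
      fix j assume "j < dim_vec (y + (z i1 + z i2) \<cdot>\<^sub>v x)"
      then have j: "j < n" using xn by simp
      have ac: "act n g y $ j = d j * y $ p j" using j by (simp add: g_def act_index)
      have r1: "a + (a + b) = b" for a b :: gf4
        by (simp add: add.assoc [symmetric])
      have r2: "b + (a + b) = a" for a b :: gf4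
        using r1 [of b a] by (simp only: add.commute)
      have "d j * y $ p j = y $ j + (z i1 + z i2) * x $ j"
      proof (cases "j \<in> S")
        case False
        then show ?thesis using p(5) j by (simp add: d_def S_def)
      next
        case True
        have eq: "d j * y $ p j = z (p j) * x $ j" using True by (simp add: d_def z_def)
        have "x $ j \<noteq> 0" using True by (simp add: S_def)
        then have "y $ j + (z i1 + z i2) * x $ j = (z j + (z i1 + z i2)) * x $ j"
          using yz by (simp add: distrib_right)
        moreover have "z j + (z i1 + z i2) = z (p j)"
        proof -
          from True consider "j = i1" | "j = i2" | "j = i3" | "j = i4" by (auto simp: S)
          then show ?thesis
          proof cases
            case 1 then show ?thesis by (simp only: p r1)
          next
            case 2 then show ?thesis by (simp only: p r2)
          next
            case 3 then show ?thesis by (simp only: p z r1)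
          next
            case 4 then show ?thesis by (simp only: p z r2)
          qed
        qed
        ultimately show ?thesis using eq by simp
      qed
      then show "act n g y $ j = (y + (z i1 + z i2) \<cdot>\<^sub>v x) $ j"
        using ac j xn yn by simp
    qed (use xn in \<open>simp add: act_def g_def\<close>)
    then show ?thesis using linear_codeD(3,4) [OF lin] x(1) y by simp
  qed
  then have "g \<in> stab n False C" by (intro stabI [OF g Cn]) blast
  moreover have "p i1 \<noteq> i1" using p(1) dist by auto
  ultimately show thesis using that lt(1) unfolding g_def by blast
qed

section \<open>Codes without words of weight four\<close>

text \<open>The right-hand side is the value at \<open>wt x\<close> of a Krawtchouk polynomial for
  four letters. It results from comparing coefficients in the transform with the polynomial variable
  \<open>[:0, 1:]\<close>.\<close>

lemma sum_chi_fixed_weight: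
  assumes x: "x \<in> carrier_vec n"
  shows "(\<Sum>y | y \<in> carrier_vec n \<and> wt y = k. chi (hermitian_prod y x))
    = coeff ([:1, - 1:] ^ wt x * [:1, 3:] ^ (n - wt x)) k"
proof -
  let ?X = "[:0, 1:] :: int poly"
  have "[:1, - 1:] ^ wt x * [:1, 3:] ^ (n - wt x) = (1 - ?X) ^ wt x * (1 + 3 * ?X) ^ (n - wt x)"
    by (simp add: one_pCons numeral_poly)
  also have "\<dots> = (\<Sum>y\<in>carrier_vec n. of_int (chi (hermitian_prod y x)) * ?X ^ wt y)"
    by (rule sum_chi_weight [OF x, symmetric])
  also have "coeff \<dots> k = (\<Sum>y\<in>carrier_vec n. if wt y = k then chi (hermitian_prod y x) else 0)"
    by (simp add: coeff_sum of_int_poly flip: monom_altdef)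
  finally show ?thesis by (simp add: sum.inter_filter)
qed

lemma card_fixed_weight:
  "int (card {y :: gf4 vec. y \<in> carrier_vec n \<and> wt y = k}) = coeff ([:1, 3:] ^ n) k"
  using sum_chi_fixed_weight [of "0\<^sub>v n" n k] wt_eq_0_iff [of "0\<^sub>v n" n]
  by (simp add: hermitian_prod_zero_right)

text \<open>Summing \<open>chi (c * h)\<close> over all four scalars \<open>c\<close> gives 4 if
  \<open>h = 0\<close> and 0 otherwise. The scalar 0 counts the whole sphere; the other three give
  equal sums, because scaling permutes the sphere.\<close>

lemma card_fixed_weight_orthogonal:
  assumes x: "x \<in> carrier_vec n"
  shows "4 * int (card {y \<in> carrier_vec n. wt y = k \<and> hermitian_prod y x = 0})
    = coeff ([:1, 3:] ^ n) k + 3 * coeff ([:1, - 1:] ^ wt x * [:1, 3:] ^ (n - wt x)) k"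
proof -
  let ?F = "{y. y \<in> carrier_vec n \<and> wt y = k}"
  let ?h = "\<lambda>y. hermitian_prod y x"
  let ?K = "\<Sum>y\<in>?F. chi (?h y)"
  have fin: "finite ?F" by simp
  have K: "(\<Sum>y\<in>?F. chi (c * ?h y)) = ?K" if "c \<noteq> 0" for c
  proof -
    have "bij_betw (\<lambda>y. c \<cdot>\<^sub>v y) ?F ?F"
      by (rule bij_betwI [where g = "\<lambda>y. inverse c \<cdot>\<^sub>v y"])
         (use that in \<open>auto simp: wt_smult smult_smult_assoc\<close>)
    then have "?K = (\<Sum>y\<in>?F. chi (?h (c \<cdot>\<^sub>v y)))" by (rule sum.reindex_bij_betw [symmetric])
    then show ?thesis by (simp add: hermitian_prod_smult_left)
  qed
  have "4 * int (card {y \<in> carrier_vec n. wt y = k \<and> ?h y = 0}) = (\<Sum>y\<in>?F. if ?h y = 0 then 4 else 0)"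
    using fin by (simp add: conj_assoc flip: sum.inter_filter)
  also have "\<dots> = (\<Sum>y\<in>?F. \<Sum>c\<in>UNIV. chi (c * ?h y))"
  proof (rule sum.cong [OF refl])
    fix y show "(if ?h y = 0 then 4 else 0) = (\<Sum>c\<in>UNIV. chi (c * ?h y))"
      by (cases "?h y") (simp_all add: sum_UNIV_gf4 chi_def gf4_def_simps card_gf4)
  qed
  also have "\<dots> = (\<Sum>c\<in>UNIV. \<Sum>y\<in>?F. chi (c * ?h y))" by (rule sum.swap)
  also have "\<dots> = int (card ?F) + 3 * ?K"
  proof -
    have "omega \<noteq> 0" "omega_bar \<noteq> 0" by (simp_all add: zero_gf4_def)
    then show ?thesis unfolding sum_UNIV_gf4 by (simp add: K)
  qed
  finally show ?thesis
    by (simp add: card_fixed_weight sum_chi_fixed_weight [OF x])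
qed

section \<open>Self-dual codes through given words\<close>

definition self_dual_codes :: "nat \<Rightarrow> gf4 vec set set" where
  "self_dual_codes n = {C. hermitian_self_dual n C}"

lemma linear_code_zero: "linear_code n {0\<^sub>v n}"
  by (auto simp: linear_code_iff)

lemma self_orthogonal_zero: "self_orthogonal n {0\<^sub>v n}"
  using linear_code_zero by (auto simp: self_orthogonal_def hermitian_dual_def hermitian_prod_zero_right)

lemma self_dual_codes_over: "self_dual_codes n = self_dual_over n {0\<^sub>v n}"
  using linear_codeD(2) by (auto simp: self_dual_codes_def self_dual_over_def hermitian_self_dual_def)

lemma finite_self_dual_codes: "finite (self_dual_codes n)"
  by (simp add: self_dual_codes_over finite_self_dual_over)

lemma card_self_dual_codes: "card (self_dual_codes (2 * m)) = (\<Prod>i<m. 2 ^ (2 * i + 1) + 1)"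
  unfolding self_dual_codes_over by (rule card_self_dual_over [of _ _ 0]) (auto simp: self_orthogonal_zero)

lemma card_self_dual_codes_containing:
  assumes x: "x \<in> carrier_vec (2 * Suc m)" "x \<noteq> 0\<^sub>v (2 * Suc m)" "even (wt x)"
  shows "card {C \<in> self_dual_codes (2 * Suc m). x \<in> C} = (\<Prod>i<m. 2 ^ (2 * i + 1) + 1)"
proof -
  let ?n = "2 * Suc m"
  note ext = code_ext_subset_iff [OF linear_code_zero x(1)]
  have "{C \<in> self_dual_codes ?n. x \<in> C} = self_dual_over ?n (code_ext {0\<^sub>v ?n} x)"
    using ext by (auto simp: self_dual_codes_over self_dual_over_def hermitian_self_dual_def)
  also have "card \<dots> = (\<Prod>i<m. 2 ^ (2 * i + 1) + 1)"
  proof (rule card_self_dual_over [where k = 1])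
    show "self_orthogonal ?n (code_ext {0\<^sub>v ?n} x)"
      by (rule self_orthogonal_code_ext [OF linear_code_zero x(1) self_orthogonal_zero])
         (use x in \<open>auto simp: hermitian_dual_def hermitian_prod_zero_right\<close>)
    show "card (code_ext {0\<^sub>v ?n} x) = 4 ^ 1"
      using card_code_ext [OF linear_code_zero x(1)] x(2) by simp
  qed simp
  finally show ?thesis .
qed

text \<open>The mass formula over the plane spanned by \<open>x\<close> and \<open>y\<close>; the
  assumption \<open>ind\<close> makes the size of this plane 16.\<close>

lemma card_self_dual_codes_containing2:
  assumes x: "x \<in> carrier_vec (2 * Suc (Suc m))" "x \<noteq> 0\<^sub>v (2 * Suc (Suc m))" "even (wt x)"
    and y: "y \<in> carrier_vec (2 * Suc (Suc m))" "even (wt y)" "hermitian_prod y x = 0"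
    and ind: "\<And>a. y \<noteq> a \<cdot>\<^sub>v x"
  shows "card {C \<in> self_dual_codes (2 * Suc (Suc m)). x \<in> C \<and> y \<in> C} = (\<Prod>i<m. 2 ^ (2 * i + 1) + 1)"
proof -
  let ?n = "2 * Suc (Suc m)"
  let ?S = "code_ext {0\<^sub>v ?n} x"
  have lin: "linear_code ?n ?S" by (rule linear_code_ext [OF linear_code_zero x(1)])
  have so: "self_orthogonal ?n ?S"
    by (rule self_orthogonal_code_ext [OF linear_code_zero x(1) self_orthogonal_zero])
       (use x in \<open>auto simp: hermitian_dual_def hermitian_prod_zero_right\<close>)
  have S: "z \<in> ?S \<longleftrightarrow> (\<exists>a. z = a \<cdot>\<^sub>v x)" for z
    using x(1) by (auto simp: code_ext_def image_iff)
  have yS: "y \<notin> ?S" using ind S by blast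
  have yd: "y \<in> hermitian_dual ?n ?S"
    using y hermitian_prod_smult_right [OF x(1) y(1)] unfolding hermitian_dual_def
    by (auto simp: S simp del: mult_Suc_right)
  note ext = code_ext_subset_iff [OF linear_code_zero x(1)] code_ext_subset_iff [OF lin y(1)]
  have "{C \<in> self_dual_codes ?n. x \<in> C \<and> y \<in> C} = self_dual_over ?n (code_ext ?S y)"
    using ext by (auto simp: self_dual_codes_over self_dual_over_def hermitian_self_dual_def)
  also have "card \<dots> = (\<Prod>i<m. 2 ^ (2 * i + 1) + 1)"
  proof (rule card_self_dual_over [where k = 2])
    show "self_orthogonal ?n (code_ext ?S y)"
      by (rule self_orthogonal_code_ext [OF lin y(1) so yd y(2)])
    show "card (code_ext ?S y) = 4 ^ 2"
      using card_code_ext [OF lin y(1) yS] card_code_ext [OF linear_code_zero x(1)] x(2) by simp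
  qed simp
  finally show ?thesis .
qed

lemma card_nonzero_multiples:
  assumes x: "x \<in> carrier_vec n" "x \<noteq> 0\<^sub>v n"
  shows "card ((\<lambda>a :: gf4. a \<cdot>\<^sub>v x) ` (UNIV - {0})) = 3"
proof -
  obtain i where i: "i < n" "x $ i \<noteq> 0" using x by (auto simp: vec_eq_iff)
  have "inj_on (\<lambda>a. a \<cdot>\<^sub>v x) (UNIV - {0})"
  proof (rule inj_onI)
    fix a b assume "a \<cdot>\<^sub>v x = b \<cdot>\<^sub>v x"
    then have "(a \<cdot>\<^sub>v x) $ i = (b \<cdot>\<^sub>v x) $ i" by simp
    then show "a = b" using i x(1) by auto
  qed
  then show ?thesis by (simp add: card_image card_Diff_subset card_gf4)
qed

text \<open>The three nonzero scalars act freely on nonzero words. At multiples of 3 the quadratic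
  used below is never negative, whereas it is at 4 and 5.\<close>

lemma three_dvd_card_weight:
  assumes C: "linear_code n C" and "0 < k"
  shows "3 dvd card {x \<in> C. wt x = k}"
proof -
  let ?A = "{x \<in> C. wt x = k}"
  have Cn: "x \<in> carrier_vec n" if "x \<in> C" for x using that linear_codeD(1) [OF C] by blast
  define cl where "cl x = {a \<cdot>\<^sub>v x |a. a \<noteq> (0 :: gf4)}" for x
  have self: "x \<in> cl x" for x
    unfolding cl_def using one_smult_vec by (metis (mono_tags, lifting) mem_Collect_eq one_neq_zero)
  have eq: "cl y = cl x" if y: "y \<in> cl x" for x y
  proof -
    obtain a where a: "y = a \<cdot>\<^sub>v x" "a \<noteq> 0" using y unfolding cl_def by blast
    have "b \<cdot>\<^sub>v x = (b * inverse a) \<cdot>\<^sub>v y" for b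
      using a by (simp add: smult_smult_assoc mult.assoc)
    moreover have "b \<cdot>\<^sub>v y = (b * a) \<cdot>\<^sub>v x" for b
      using a by (simp add: smult_smult_assoc)
    moreover have "b * a \<noteq> 0 \<and> b * inverse a \<noteq> 0" if "b \<noteq> 0" for b
      using that a(2) by simp
    ultimately show ?thesis unfolding cl_def by blast
  qed
  have card: "card (cl x) = 3" if x: "x \<in> ?A" for x
  proof -
    have xC: "x \<in> carrier_vec n" using x Cn by blast
    have "x \<noteq> 0\<^sub>v n" using x \<open>0 < k\<close> wt_eq_0_iff [OF xC] by auto
    then have "card ((\<lambda>a. a \<cdot>\<^sub>v x) ` (UNIV - {0})) = 3" by (rule card_nonzero_multiples [OF xC])
    moreover have "cl x = (\<lambda>a. a \<cdot>\<^sub>v x) ` (UNIV - {0})" unfolding cl_def by blast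
    ultimately show ?thesis by (simp only:)
  qed
  have fin: "finite ?A" using finite_linear_code [OF C] by simp
  have sub: "cl x \<subseteq> ?A" if "x \<in> ?A" for x
    using that linear_codeD(4) [OF C] by (auto simp: cl_def wt_smult)
  have "3 * card (cl ` ?A) = card (\<Union> (cl ` ?A))"
  proof (rule card_partition)
    show "finite (cl ` ?A)" using fin by simp
    show "finite (\<Union> (cl ` ?A))" using fin sub by (intro finite_subset [OF _ fin]) blast
    show "\<And>c. c \<in> cl ` ?A \<Longrightarrow> card c = 3" using card by blast
    fix c c' assume c: "c \<in> cl ` ?A" "c' \<in> cl ` ?A" and "c \<noteq> c'"
    show "c \<inter> c' = {}"
    proof (rule ccontr)
      assume "c \<inter> c' \<noteq> {}"
      then obtain z where "z \<in> c" "z \<in> c'" by blast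
      then have "cl z = c" "cl z = c'" using c eq by blast+
      then show False using \<open>c \<noteq> c'\<close> by simp
    qed
  qed
  moreover have "\<Union> (cl ` ?A) = ?A" using self sub by blast
  ultimately have "card ?A = 3 * card (cl ` ?A)" by simp
  then show ?thesis by (rule dvdI)
qed

section \<open>A second moment bound on codes without words of weight four\<close>

definition no_weight_4 :: "nat \<Rightarrow> gf4 vec set set" where
  "no_weight_4 n = {C \<in> self_dual_codes n. \<forall>x\<in>C. wt x \<noteq> 4}"

text \<open>If \<open>w = 3 u\<close> is the number of words of weight four of a code, then
  \<open>18 - 9 w + w\<^sup>2 = 9 (u - 1) (u - 2)\<close> is nonnegative, and it is \<open>18\<close> for \<open>w = 0\<close>.\<close>

lemma card_no_weight_4_bound:
  fixes m :: nat
  defines "n \<equiv> 2 * Suc (Suc m)"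
  defines "F \<equiv> {x :: gf4 vec. x \<in> carrier_vec n \<and> wt x = 4}"
  defines "P \<equiv> \<lambda>k. \<Prod>i<k. 2 ^ (2 * i + 1) + 1 :: nat"
  assumes N: "\<And>x. x \<in> F \<Longrightarrow> card {y \<in> F. hermitian_prod y x = 0} = q + 3"
  shows "18 * int (card (no_weight_4 n))
    \<le> 18 * int (P (Suc (Suc m))) - 9 * int (card F * P (Suc m)) + int (card F * (3 * P (Suc m) + q * P m))"
proof -
  let ?X = "self_dual_codes n"
  define w where "w C = card {x \<in> C. wt x = 4}" for C :: "gf4 vec set"
  have finX: "finite ?X" by (rule finite_self_dual_codes)
  have finF: "finite F" by (simp add: F_def)
  have XF: "{x \<in> C. wt x = 4} = {x \<in> F. x \<in> C}" if "C \<in> ?X" for C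
    using that hermitian_self_dual_subset by (auto simp: F_def self_dual_codes_def)
  have F0: "x \<noteq> 0\<^sub>v n" if "x \<in> F" for x
    using that wt_eq_0_iff [of x n] by (auto simp: F_def)
  have one: "card {C \<in> ?X. x \<in> C} = P (Suc m)" if "x \<in> F" for x
    unfolding n_def P_def
    by (rule card_self_dual_codes_containing) (use that F0 [OF that] in \<open>auto simp: F_def n_def\<close>)
  have "(\<Sum>C\<in>?X. w C) = (\<Sum>C\<in>?X. card {x \<in> F. x \<in> C})"
    by (intro sum.cong refl) (simp add: w_def XF)
  also have "\<dots> = (\<Sum>x\<in>F. card {C \<in> ?X. x \<in> C})"
    by (rule sum_multicount_gen [OF finF finX, symmetric]) auto
  also have "\<dots> = card F * P (Suc m)" using one by simp
  finally have W1: "(\<Sum>C\<in>?X. w C) = card F * P (Suc m)" .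
  \<comment> \<open>Words that are not orthogonal to \<open>x\<close> share no self-dual code with
    it. Among the orthogonal ones the three multiples of \<open>x\<close> add no condition, and the
    other \<open>q\<close> are independent of \<open>x\<close>, so that the count drops to
    \<open>P m\<close>.\<close>
  have two: "(\<Sum>y\<in>F. card {C \<in> ?X. x \<in> C \<and> y \<in> C}) \<le> 3 * P (Suc m) + q * P m" if x: "x \<in> F" for x
  proof -
    have xn: "x \<in> carrier_vec n" using x by (simp add: F_def)
    define L where "L = (\<lambda>a. a \<cdot>\<^sub>v x) ` (UNIV - {0 :: gf4})"
    let ?O = "{y \<in> F. hermitian_prod y x = 0}"
    have LO: "L \<subseteq> ?O"
      using x by (auto simp: L_def F_def wt_smult hermitian_prod_smult_left hermitian_prod_self_eq_0_iff)
    have cL: "card L = 3"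
      unfolding L_def by (rule card_nonzero_multiples [OF xn F0 [OF x]])
    have "(\<Sum>y\<in>F. card {C \<in> ?X. x \<in> C \<and> y \<in> C}) = (\<Sum>y\<in>?O. card {C \<in> ?X. x \<in> C \<and> y \<in> C})"
    proof (rule sum.mono_neutral_right [OF finF])
      show "\<forall>y\<in>F - ?O. card {C \<in> ?X. x \<in> C \<and> y \<in> C} = 0"
      proof
        fix y assume "y \<in> F - ?O"
        then have "{C \<in> ?X. x \<in> C \<and> y \<in> C} = {}"
          using self_dual_prod by (auto simp: self_dual_codes_def)
        then show "card {C \<in> ?X. x \<in> C \<and> y \<in> C} = 0" by (simp only: card.empty)
      qed
    qed auto
    moreover have "\<dots> = (\<Sum>y\<in>L. card {C \<in> ?X. x \<in> C \<and> y \<in> C})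
        + (\<Sum>y\<in>?O - L. card {C \<in> ?X. x \<in> C \<and> y \<in> C})"
      using sum.subset_diff [OF LO] finF by (simp add: add.commute)
    moreover have "(\<Sum>y\<in>L. card {C \<in> ?X. x \<in> C \<and> y \<in> C}) \<le> (\<Sum>y\<in>L. P (Suc m))"
    proof (rule sum_mono)
      fix y
      have "card {C \<in> ?X. x \<in> C \<and> y \<in> C} \<le> card {C \<in> ?X. x \<in> C}"
        using finX by (intro card_mono) auto
      then show "card {C \<in> ?X. x \<in> C \<and> y \<in> C} \<le> P (Suc m)" using one [OF x] by simp
    qed
    moreover have "(\<Sum>y\<in>?O - L. card {C \<in> ?X. x \<in> C \<and> y \<in> C}) = (\<Sum>y\<in>?O - L. P m)"
    proof (rule sum.cong [OF refl])
      fix y assume y: "y \<in> ?O - L"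
      have "y \<noteq> a \<cdot>\<^sub>v x" for a
      proof
        assume a: "y = a \<cdot>\<^sub>v x"
        have "0 \<cdot>\<^sub>v x = 0\<^sub>v n" using xn by (intro eq_vecI) auto
        then have "a \<noteq> 0" using y a F0 [of y] by auto
        then show False using a y by (auto simp: L_def)
      qed
      then show "card {C \<in> ?X. x \<in> C \<and> y \<in> C} = P m"
        unfolding n_def P_def
        by (intro card_self_dual_codes_containing2)
           (use x y F0 [OF x] in \<open>auto simp: F_def n_def simp del: mult_Suc_right\<close>)
    qed
    moreover have "card (?O - L) = q"
      using LO N [OF x] cL finF by (simp add: card_Diff_subset finite_subset [OF LO])
    ultimately show ?thesis using cL by simp
  qed
  \<comment> \<open>The second moment counts ordered pairs of words of weight 4 that lie in a common
    code.\<close>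
  have "(\<Sum>C\<in>?X. w C ^ 2) = (\<Sum>C\<in>?X. card {z \<in> F \<times> F. fst z \<in> C \<and> snd z \<in> C})"
  proof (rule sum.cong [OF refl])
    fix C assume "C \<in> ?X"
    have "{z \<in> F \<times> F. fst z \<in> C \<and> snd z \<in> C} = {x \<in> F. x \<in> C} \<times> {x \<in> F. x \<in> C}" by auto
    then show "w C ^ 2 = card {z \<in> F \<times> F. fst z \<in> C \<and> snd z \<in> C}"
      by (simp add: w_def XF [OF \<open>C \<in> ?X\<close>] card_cartesian_product power2_eq_square)
  qed
  also have "\<dots> = (\<Sum>z\<in>F \<times> F. card {C \<in> ?X. fst z \<in> C \<and> snd z \<in> C})"
    by (rule sum_multicount_gen [OF _ finX, symmetric]) (use finF in auto)
  also have "\<dots> = (\<Sum>x\<in>F. \<Sum>y\<in>F. card {C \<in> ?X. x \<in> C \<and> y \<in> C})"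
    by (simp add: sum.cartesian_product case_prod_unfold)
  also have "\<dots> \<le> (\<Sum>x\<in>F. 3 * P (Suc m) + q * P m)" by (rule sum_mono [OF two])
  finally have W2: "(\<Sum>C\<in>?X. w C ^ 2) \<le> card F * (3 * P (Suc m) + q * P m)" by simp
  have "(if C \<in> no_weight_4 n then 18 else 0) \<le> 18 - 9 * int (w C) + int (w C ^ 2)" if C: "C \<in> ?X" for C
  proof -
    have lin: "linear_code n C" using C by (simp add: self_dual_codes_def hermitian_self_dual_def)
    obtain u where u: "w C = 3 * u"
      using three_dvd_card_weight [OF lin, of 4] by (auto simp: w_def)
    have "(18 :: int) - 9 * int (w C) + int (w C ^ 2) = 9 * ((int u - 1) * (int u - 2))"
      by (simp add: u algebra_simps power2_eq_square)
    moreover have "(int u - 1) * (int u - 2) \<ge> 0"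
      by (cases "u \<le> 1") (auto intro: mult_nonneg_nonneg mult_nonpos_nonpos)
    moreover have "w C = 0" if "C \<in> no_weight_4 n"
    proof -
      have "{x \<in> C. wt x = 4} = {}" using that by (auto simp: no_weight_4_def)
      then show ?thesis unfolding w_def by (simp only: card.empty)
    qed
    ultimately show ?thesis by auto
  qed
  then have "(\<Sum>C\<in>?X. if C \<in> no_weight_4 n then 18 else 0) \<le> (\<Sum>C\<in>?X. 18 - 9 * int (w C) + int (w C ^ 2))"
    by (rule sum_mono)
  also have "(\<Sum>C\<in>?X. if C \<in> no_weight_4 n then 18 else 0) = 18 * int (card (no_weight_4 n))"
    using finX by (simp add: no_weight_4_def flip: sum.inter_filter)
  also have "(\<Sum>C\<in>?X. 18 - 9 * int (w C) + int (w C ^ 2))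
      = 18 * int (card ?X) - 9 * int (\<Sum>C\<in>?X. w C) + int (\<Sum>C\<in>?X. w C ^ 2)"
    by (simp add: sum.distrib sum_subtractf sum_distrib_left)
  also have "\<dots> \<le> 18 * int (P (Suc (Suc m))) - 9 * int (card F * P (Suc m))
      + int (card F * (3 * P (Suc m) + q * P m))"
  proof -
    have "card ?X = P (Suc (Suc m))" unfolding n_def P_def by (rule card_self_dual_codes)
    then show ?thesis using W1 W2 by (metis add_left_mono of_nat_mono)
  qed
  finally show ?thesis .
qed

lemma poly_1_3_powers:
  "[:1, 3 :: int:] ^ 14 = [:1, 3:] ^ 8 * ([:1, 3:] ^ 4 * [:1, 3:] ^ 2)"
  "[:1, 3 :: int:] ^ 18 = [:1, 3:] ^ 14 * [:1, 3:] ^ 4"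
  "[:1, 3 :: int:] ^ 8 = [:1, 24, 252, 1512, 5670, 13608, 20412, 17496, 6561:]"
  "[:1, 3 :: int:] ^ 4 = [:1, 12, 54, 108, 81:]"
  "[:1, 3 :: int:] ^ 2 = [:1, 6, 9:]"
  "[:1, - 1 :: int:] ^ 4 = [:1, - 4, 6, - 4, 1:]"
  by (simp_all only: power_add [symmetric] power_mult [symmetric] flip: power_Suc)
     (simp_all add: eval_nat_numeral)

lemma card_no_weight_4_18: "18 * int (card (no_weight_4 18)) \<le> 52050910388789696272967034"
proof -
  let ?F = "{x :: gf4 vec. x \<in> carrier_vec 18 \<and> wt x = 4}"
  \<comment> \<open>There are 3060 supports of size 4 in 18 positions, each with 81 choices of
    nonzero values.\<close>
  have F: "card ?F = 247860"
  proof -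
    have "int (card ?F) = coeff ([:1, 3:] ^ 18) 4" by (rule card_fixed_weight)
    also have "\<dots> = 247860" by (simp add: poly_1_3_powers coeff_pCons)
    finally show ?thesis by linarith
  qed
  \<comment> \<open>The Krawtchouk value is 46516, so the number is
    \<open>(247860 + 3 * 46516) / 4 = 96852\<close>; three of these words are the multiples of
    \<open>x\<close>.\<close>
  have "card {y \<in> ?F. hermitian_prod y x = 0} = 96849 + 3" if x: "x \<in> ?F" for x
  proof -
    have eq: "{y \<in> ?F. hermitian_prod y x = 0} = {y \<in> carrier_vec 18. wt y = 4 \<and> hermitian_prod y x = 0}"
      by auto
    have "4 * int (card {y \<in> carrier_vec 18. wt y = 4 \<and> hermitian_prod y x = 0})
      = coeff ([:1, 3:] ^ 18) 4 + 3 * coeff ([:1, - 1:] ^ 4 * [:1, 3:] ^ 14) 4"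
      using card_fixed_weight_orthogonal [of x 18 4] x by simp
    moreover have "coeff ([:1, 3 :: int:] ^ 18) 4 = 247860"
      by (simp add: poly_1_3_powers coeff_pCons)
    moreover have "coeff ([:1, - 1 :: int:] ^ 4 * [:1, 3:] ^ 14) 4 = 46516"
      by (simp add: poly_1_3_powers coeff_pCons)
    ultimately show ?thesis unfolding eq by linarith
  qed
  then have "18 * int (card (no_weight_4 18)) \<le> 18 * int (\<Prod>i<9. 2 ^ (2 * i + 1) + 1)
      - 9 * int (247860 * (\<Prod>i<8. 2 ^ (2 * i + 1) + 1))
      + int (247860 * (3 * (\<Prod>i<8. 2 ^ (2 * i + 1) + 1) + 96849 * (\<Prod>i<7. 2 ^ (2 * i + 1) + 1)))"
    using card_no_weight_4_bound [of 7 96849] F by simp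
  also have "\<dots> = 52050910388789696272967034"
    by (simp add: lessThan_nat_numeral lessThan_Suc)
  finally show ?thesis .
qed


section \<open>Supports of words of small weight\<close>

definition supp_list :: "nat \<Rightarrow> gf4 vec \<Rightarrow> bool list" where
  "supp_list n x = map (\<lambda>i. x $ i \<noteq> 0) [0..<n]"

text \<open>A monomial map acts on supports through its permutation alone, so passing from words to
  supports leaves a search over coordinate permutations. The bound 6 is the minimum weight of the
  codes that are checked below.\<close>

definition low_supports :: "nat \<Rightarrow> gf4 vec set \<Rightarrow> bool list set" where
  "low_supports n C = supp_list n ` {x \<in> C. x \<noteq> 0\<^sub>v n \<and> wt x \<le> 6}"

definition permute_list_by :: "nat \<Rightarrow> (nat \<Rightarrow> nat) \<Rightarrow> bool list \<Rightarrow> bool list" where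
  "permute_list_by n p s = map (\<lambda>j. s ! p j) [0..<n]"

text \<open>For a finite set of lists of length \<open>n\<close> the inclusion is an equality,
  because a permutation acts injectively.\<close>

definition support_perms :: "nat \<Rightarrow> bool list set \<Rightarrow> (nat \<Rightarrow> nat) set" where
  "support_perms n X = {p. p permutes {..<n} \<and> permute_list_by n p ` X \<subseteq> X}"

definition pair_degree :: "bool list set \<Rightarrow> nat \<Rightarrow> nat \<Rightarrow> nat" where
  "pair_degree X i j = card {s \<in> X. s ! i \<and> s ! j}"

text \<open>The value of this invariant tells the twelve codes used below apart.\<close>

definition degree_2_pairs :: "nat \<Rightarrow> bool list set \<Rightarrow> nat" where
  "degree_2_pairs n X = (\<Sum>i<n. \<Sum>j<n. if pair_degree X i j = 2 then 1 else 0)"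

lemma length_supp_list [simp]: "length (supp_list n x) = n"
  by (simp add: supp_list_def)

lemma length_low_supports: "s \<in> low_supports n C \<Longrightarrow> length s = n"
  by (auto simp: low_supports_def)

lemma supp_list_act:
  assumes "(e, p, d) \<in> semi_maps n b"
  shows "supp_list n (act n (e, p, d) v) = permute_list_by n p (supp_list n v)"
  using semi_mapsD(4,5) [OF assms]
  by (auto simp: supp_list_def permute_list_by_def act_index intro!: nth_equalityI)

lemma low_supports_act:
  assumes C: "C \<subseteq> carrier_vec n" and g: "(e, p, d) \<in> semi_maps n b"
  shows "low_supports n (act n (e, p, d) ` C) = permute_list_by n p ` low_supports n C"
proof -
  let ?a = "act n (e, p, d)"
  define P where "P x \<longleftrightarrow> x \<noteq> 0\<^sub>v n \<and> wt x \<le> 6" for x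
  have P: "P (?a v) \<longleftrightarrow> P v" if "v \<in> C" for v
  proof -
    have v: "v \<in> carrier_vec n" using that C by blast
    show ?thesis
      unfolding P_def
      by (simp only: wt_eq_0_iff [OF v, symmetric] wt_eq_0_iff [OF act_carrier, symmetric] wt_act [OF g v])
  qed
  have "{x \<in> ?a ` C. P x} = ?a ` {x \<in> C. P (?a x)}" by blast
  also have "{x \<in> C. P (?a x)} = {x \<in> C. P x}" using P by (intro Collect_cong conj_cong refl)
  finally show ?thesis
    unfolding low_supports_def P_def
    by (simp only: image_image supp_list_act [OF g])
qed

lemma inj_on_permute_list_by:
  assumes p: "p permutes {..<n}"
  shows "inj_on (permute_list_by n p) {s. length s = n}"
proof (rule inj_onI)
  fix s t :: "bool list" assume *: "s \<in> {s. length s = n}" "t \<in> {s. length s = n}"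
    "permute_list_by n p s = permute_list_by n p t"
  show "s = t"
  proof (rule nth_equalityI)
    fix i assume "i < length s"
    then have i: "i < n" using * by simp
    define j where "j = inv_into UNIV p i"
    have j: "j < n" "p j = i"
      using permutes_in_image [OF permutes_inv [OF p], of i] i permutes_inverses [OF p]
      by (auto simp: j_def)
    then show "s ! i = t ! i"
      using arg_cong [OF *(3), of "\<lambda>l. l ! j"] by (simp add: permute_list_by_def)
  qed (use * in simp)
qed

lemma pair_degree_permute:
  assumes p: "p permutes {..<n}" and X: "\<And>s. s \<in> X \<Longrightarrow> length s = n" and ij: "i < n" "j < n"
  shows "pair_degree (permute_list_by n p ` X) i j = pair_degree X (p i) (p j)"
proof -
  have "{s \<in> permute_list_by n p ` X. s ! i \<and> s ! j} = permute_list_by n p ` {s \<in> X. s ! p i \<and> s ! p j}"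
    using ij by (auto simp: permute_list_by_def)
  moreover have "inj_on (permute_list_by n p) {s \<in> X. s ! p i \<and> s ! p j}"
    by (rule inj_on_subset [OF inj_on_permute_list_by [OF p]]) (use X in auto)
  ultimately show ?thesis by (simp add: pair_degree_def card_image)
qed

text \<open>A relabelling of coordinates permutes the ordered pairs, over all of which the sum runs.
  Coefficients and conjugation are invisible in supports, so the semilinear case is
  included.\<close>

lemma degree_2_pairs_orbit:
  assumes C: "C \<subseteq> carrier_vec n" and D: "D \<in> orbit n b C"
  shows "degree_2_pairs n (low_supports n D) = degree_2_pairs n (low_supports n C)"
proof -
  obtain g where g: "g \<in> semi_maps n b" "D = act n g ` C" using D unfolding orbit_def by blast
  obtain e p d where epd: "g = (e, p, d)" by (cases g)
  have p: "p permutes {..<n}" using semi_mapsD(2) [of e p d n b] g epd by simp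
  let ?f = "\<lambda>i j. if pair_degree (low_supports n C) i j = 2 then 1 else 0 :: nat"
  have "degree_2_pairs n (low_supports n D) = (\<Sum>i<n. \<Sum>j<n. ?f (p i) (p j))"
    using low_supports_act [OF C, of e p d b] g
    by (simp add: degree_2_pairs_def epd pair_degree_permute [OF p length_low_supports])
  also have "\<dots> = (\<Sum>i<n. \<Sum>j<n. ?f (p i) j)"
    using sum.permute [OF p, of "?f (p i)" for i] by (simp add: comp_def)
  also have "\<dots> = (\<Sum>i<n. \<Sum>j<n. ?f i j)"
    using sum.permute [OF p, of "\<lambda>i. \<Sum>j<n. ?f i j"] by (simp add: comp_def)
  finally show ?thesis by (simp add: degree_2_pairs_def)
qed

section \<open>Bounding the stabilizer by permutations of supports\<close>

lemma finite_support_perms: "finite (support_perms n X)"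
  by (rule finite_subset [of _ "{p. p permutes {..<n}}"]) (auto simp: support_perms_def finite_permutations)

lemma stab_support_perms:
  assumes C: "C \<subseteq> carrier_vec n" and g: "(e, p, d) \<in> stab n b C"
  shows "p \<in> support_perms n (low_supports n C)"
proof -
  have *: "(e, p, d) \<in> semi_maps n b" "act n (e, p, d) ` C = C" using g by (auto simp: stab_def)
  have "permute_list_by n p ` low_supports n C = low_supports n C"
    using low_supports_act [OF C *(1)] *(2) by simp
  then show ?thesis using semi_mapsD(2) [OF *(1)] by (auto simp: support_perms_def)
qed

lemma support_perms_pair_degree:
  assumes p: "p \<in> support_perms n X" and X: "finite X" "\<And>s. s \<in> X \<Longrightarrow> length s = n"
    and ij: "i < n" "j < n"
  shows "pair_degree X (p i) (p j) = pair_degree X i j"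
proof -
  have perm: "p permutes {..<n}" and sub: "permute_list_by n p ` X \<subseteq> X"
    using p by (auto simp: support_perms_def)
  have "inj_on (permute_list_by n p) X"
    by (rule inj_on_subset [OF inj_on_permute_list_by [OF perm]]) (use X in auto)
  then have "permute_list_by n p ` X = X" by (rule endo_inj_surj [OF X(1) sub])
  then show ?thesis using pair_degree_permute [where X = X, OF perm _ ij] X(2) by simp
qed

text \<open>The kernel of the projection from the stabilizer to permutations consists of scalars.
  Supports cannot detect this kernel, which might also contain other diagonal maps, with or without
  conjugation.\<close>

definition rigid :: "nat \<Rightarrow> gf4 vec set \<Rightarrow> bool" where
  "rigid n C \<longleftrightarrow> (\<forall>e d. (e, id, d) \<in> stab n True C \<longrightarrow> \<not> e \<and> (\<forall>j<n. d j = d 0))"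

lemma stab_subset: "stab n b C \<subseteq> semi_maps n b"
  unfolding stab_def by (rule Collect_subset)

lemma stab_inv_comp:
  assumes C: "C \<subseteq> carrier_vec n" and g: "g \<in> stab n b C" and h: "h \<in> stab n b C"
  shows "semi_comp n (semi_inv n g) h \<in> stab n b C"
proof -
  have *: "g \<in> semi_maps n b" "h \<in> semi_maps n b" "act n g ` C = C" "act n h ` C = C"
    using g h by (auto simp: stab_def)
  have "act n (semi_comp n (semi_inv n g) h) ` C = act n (semi_inv n g) ` act n g ` C"
    by (simp add: act_comp [OF semi_inv_in [OF *(1)]] *(3,4) flip: image_image)
  also have "\<dots> = id ` C"
    unfolding image_image by (rule image_cong) (use C act_inv(1) [OF *(1)] in auto)
  finally show ?thesis
    using semi_comp_in [OF semi_inv_in [OF *(1)] *(2)] by (simp add: stab_def)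
qed

text \<open>Two elements of the stabilizer with the same permutation differ by one with the identity
  permutation, which rigidity makes one of three scalars. So the projection to permutations is at
  most three to one.\<close>

lemma card_stab_le:
  assumes C: "C \<subseteq> carrier_vec n" and rigid: "rigid n C" and "0 < n"
  shows "card (stab n True C) \<le> 3 * card (support_perms n (low_supports n C))"
proof -
  let ?S = "stab n True C" and ?f = "\<lambda>g :: semi. fst (snd g)"
  have finS: "finite ?S" by (simp add: stab_def finite_semi_maps)
  have fib: "card {g \<in> ?S. ?f g = p} \<le> 3" for p
  proof (cases "{g \<in> ?S. ?f g = p} = {}")
    case True then show ?thesis by (simp only: card.empty)
  next
    case False
    then obtain g where g: "g \<in> ?S" "?f g = p" by blast
    have gm: "g \<in> semi_maps n True" using g(1) by (simp add: stab_def)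
    let ?Z = "(\<lambda>a. (False, id :: nat \<Rightarrow> nat, restrict (\<lambda>_. a) {..<n})) ` (UNIV - {0 :: gf4})"
    have "semi_comp n (semi_inv n g) h \<in> ?Z" if h: "h \<in> ?S" "?f h = p" for h
    proof -
      let ?k = "semi_comp n (semi_inv n g) h"
      obtain e p' d where k: "?k = (e, p', d)" by (cases ?k)
      obtain e1 d1 where g1: "g = (e1, p, d1)" using g(2) by (cases g) auto
      obtain e2 d2 where h1: "h = (e2, p, d2)" using h(2) by (cases h) auto
      have perm: "p permutes {..<n}" using semi_mapsD(2) [of e1 p d1 n True] gm g1 by simp
      have "p' = id"
        using k permutes_inv_o(1) [OF perm] by (simp add: semi_comp_def semi_inv_def g1 h1)
      then have kS: "(e, id, d) \<in> ?S" using stab_inv_comp [OF C g(1) h(1)] k by simp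
      then have ed: "\<not> e" "\<forall>j<n. d j = d 0" using rigid unfolding rigid_def by blast+
      have dm: "(e, id, d) \<in> semi_maps n True" using kS by (simp add: stab_def)
      have "d = restrict (\<lambda>_. d 0) {..<n}"
      proof (rule extensionalityI [OF semi_mapsD(3) [OF dm]])
        fix j assume j: "j \<in> {..<n}"
        then have "d j = d 0" using ed(2) by blast
        then show "d j = restrict (\<lambda>_. d 0) {..<n} j" using j by simp
      qed simp
      then have "?k = (False, id, restrict (\<lambda>_. d 0) {..<n})"
        unfolding k prod.inject using \<open>p' = id\<close> ed(1) by blast
      moreover have "d 0 \<in> UNIV - {0}" using semi_mapsD(5) [OF dm \<open>0 < n\<close>] by simp
      ultimately show ?thesis by (rule image_eqI)
    qed
    then have sub: "semi_comp n (semi_inv n g) ` {h \<in> ?S. ?f h = p} \<subseteq> ?Z" by blast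
    have "inj_on (semi_comp n (semi_inv n g)) {h \<in> ?S. ?f h = p}"
      by (rule inj_on_subset [OF inj_semi_comp [OF semi_inv_in [OF gm]]
            subset_trans [OF Collect_subset stab_subset]])
    then have "card {h \<in> ?S. ?f h = p} \<le> card ?Z"
      by (rule card_inj_on_le [OF _ sub]) simp
    also have "\<dots> \<le> card (UNIV - {0 :: gf4})" by (rule card_image_le) simp
    finally show ?thesis by (simp add: card_Diff_subset card_gf4)
  qed
  have "card ?S = (\<Sum>p\<in>?f ` ?S. \<Sum>g\<in>{g \<in> ?S. ?f g = p}. 1)"
    using sum.image_gen [OF finS, of "\<lambda>_. 1 :: nat" ?f] by simp
  also have "\<dots> \<le> (\<Sum>p\<in>?f ` ?S. 3)"
    by (rule sum_mono) (simp add: fib)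
  also have "\<dots> = 3 * card (?f ` ?S)" by simp
  also have "card (?f ` ?S) \<le> card (support_perms n (low_supports n C))"
  proof (rule card_mono [OF finite_support_perms], clarify)
    fix e p d assume "(e, p, d) \<in> ?S"
    then show "fst (snd (e, p, d)) \<in> support_perms n (low_supports n C)"
      using stab_support_perms [OF C] by simp
  qed
  finally show ?thesis by simp
qed


section \<open>Codes given by a generator matrix\<close>

text \<open>A matrix \<open>A\<close> with \<open>m\<close> rows stands for the code with generator matrix \<open>(I | A)\<close>.\<close>

definition gen_code :: "gf4 list list \<Rightarrow> gf4 vec set" where
  "gen_code A = {x \<in> carrier_vec (2 * length A).
     \<forall>j<length A. x $ (length A + j) = (\<Sum>i<length A. x $ i * A ! i ! j)}"

definition square :: "gf4 list list \<Rightarrow> bool" where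
  "square A \<longleftrightarrow> list_all (\<lambda>r. length r = length A) A"

fun herm :: "gf4 list \<Rightarrow> gf4 list \<Rightarrow> gf4" where
  "herm (x # xs) (y # ys) = x * y\<^sup>2 + herm xs ys"
| "herm _ _ = 0"

fun orthonormal :: "gf4 list list \<Rightarrow> bool" where
  "orthonormal [] = True"
| "orthonormal (r # rs) = (herm r r = 1 \<and> list_all (\<lambda>r'. herm r r' = 0) rs \<and> orthonormal rs)"

fun cons_all :: "'a list \<Rightarrow> 'a list list \<Rightarrow> 'a list list" where
  "cons_all (x # xs) (y # ys) = (x # y) # cons_all xs ys"
| "cons_all _ _ = []"

definition transpose_lists :: "nat \<Rightarrow> 'a list list \<Rightarrow> 'a list list" where
  "transpose_lists n L = foldr cons_all L (replicate n [])"

definition conj_transp :: "gf4 list list \<Rightarrow> gf4 list list" where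
  "conj_transp A = transpose_lists (length A) (map (map (\<lambda>a. a\<^sup>2)) A)"

text \<open>Testing columns as well as rows provides both inverse laws by computation.\<close>

definition unitary :: "gf4 list list \<Rightarrow> bool" where
  "unitary A \<longleftrightarrow> square A \<and> orthonormal A \<and> orthonormal (conj_transp A)"

lemma herm_sum: "length xs = m \<Longrightarrow> length ys = m \<Longrightarrow> herm xs ys = (\<Sum>i<m. xs ! i * (ys ! i)\<^sup>2)"
proof (induction xs ys arbitrary: m rule: herm.induct)
  case (1 x xs y ys)
  then obtain k where "m = Suc k" by (cases m) auto
  then show ?case using 1 by (simp add: sum.lessThan_Suc_shift del: sum.lessThan_Suc)
qed auto

lemma herm_commute: "length xs = length ys \<Longrightarrow> herm ys xs = (herm xs ys)\<^sup>2"
  by (simp add: herm_sum [of _ "length ys"] gf4_power2_sum power_mult_distrib mult.commute)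

lemma orthonormal_nth:
  assumes "orthonormal A" "\<And>r. r \<in> set A \<Longrightarrow> length r = l" "i < length A" "k < length A"
  shows "herm (A ! i) (A ! k) = (if i = k then 1 else 0)"
  using assms
proof (induction A arbitrary: i k)
  case (Cons r A)
  have off: "herm r (A ! j) = 0 \<and> herm (A ! j) r = 0" if "j < length A" for j
  proof -
    have "herm r (A ! j) = 0" using Cons.prems(1) that by (auto simp: list_all_length)
    moreover have "length (A ! j) = length r" using Cons.prems(2) that by auto
    ultimately show ?thesis using herm_commute [of r "A ! j"] by simp
  qed
  show ?case
    using Cons.IH [of "i - 1" "k - 1"] Cons.prems off [of "i - 1"] off [of "k - 1"]
    by (cases i; cases k) auto
qed simp

lemma length_cons_all [simp]: "length (cons_all xs ys) = min (length xs) (length ys)"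
  by (induction xs ys rule: cons_all.induct) auto

lemma nth_cons_all: "i < length xs \<Longrightarrow> i < length ys \<Longrightarrow> cons_all xs ys ! i = xs ! i # ys ! i"
proof (induction xs ys arbitrary: i rule: cons_all.induct)
  case (1 x xs y ys)
  then show ?case by (cases i) auto
qed auto

lemma transpose_lists:
  assumes "\<And>r. r \<in> set L \<Longrightarrow> length r = n"
  shows "length (transpose_lists n L) = n" "j < n \<Longrightarrow> transpose_lists n L ! j = map (\<lambda>r. r ! j) L"
proof -
  have "length (transpose_lists n L) = n \<and> (\<forall>j<n. transpose_lists n L ! j = map (\<lambda>r. r ! j) L)"
    using assms by (induction L) (auto simp: transpose_lists_def nth_cons_all)
  then show "length (transpose_lists n L) = n" "j < n \<Longrightarrow> transpose_lists n L ! j = map (\<lambda>r. r ! j) L" by auto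
qed

lemma conj_transp:
  assumes "square A"
  shows "length (conj_transp A) = length A" "square (conj_transp A)"
    "i < length A \<Longrightarrow> j < length A \<Longrightarrow> conj_transp A ! j ! i = (A ! i ! j)\<^sup>2"
proof -
  let ?L = "map (map (\<lambda>a. a\<^sup>2)) A"
  have L: "length r = length A" if "r \<in> set ?L" for r
    using assms that by (auto simp: square_def list_all_iff)
  show len: "length (conj_transp A) = length A"
    unfolding conj_transp_def by (rule transpose_lists(1)) (rule L)
  have nth: "conj_transp A ! j = map (\<lambda>r. r ! j) ?L" if "j < length A" for j
    unfolding conj_transp_def by (rule transpose_lists(2) [OF L that])
  show "square (conj_transp A)"
    using nth by (auto simp: square_def list_all_length len)
  show "conj_transp A ! j ! i = (A ! i ! j)\<^sup>2" if "i < length A" "j < length A"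
    using assms that by (simp add: nth square_def list_all_length)
qed

section \<open>Self-dual codes from unitary matrices\<close>

locale unitary_matrix =
  fixes A :: "gf4 list list" and m :: nat and n :: nat and B :: "gf4 list list"
  assumes unitary: "unitary A"
  defines "m \<equiv> length A" and "n \<equiv> 2 * m" and "B \<equiv> conj_transp A"
begin

lemma square: "square A" and row_length: "i < m \<Longrightarrow> length (A ! i) = m"
  using unitary by (auto simp: unitary_def square_def list_all_length m_def)

lemma B: "length B = m" "square B" "i < m \<Longrightarrow> j < m \<Longrightarrow> B ! j ! i = (A ! i ! j)\<^sup>2"
  using conj_transp [OF square] by (auto simp: B_def m_def)

lemma rows_orthonormal:
  assumes "i < m" "k < m"
  shows "(\<Sum>j<m. A ! i ! j * (A ! k ! j)\<^sup>2) = (if i = k then 1 else 0)"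
proof -
  have "herm (A ! i) (A ! k) = (if i = k then 1 else 0)"
    by (rule orthonormal_nth [of A m])
       (use unitary assms in \<open>auto simp: unitary_def square_def list_all_iff m_def\<close>)
  then show ?thesis using herm_sum [of "A ! i" m "A ! k"] row_length assms by simp
qed

lemma columns_orthonormal:
  assumes "j < m" "k < m"
  shows "(\<Sum>i<m. (A ! i ! j)\<^sup>2 * A ! i ! k) = (if j = k then 1 else 0)"
proof -
  have "herm (B ! j) (B ! k) = (if j = k then 1 else 0)"
    by (rule orthonormal_nth [of B m])
       (use unitary assms B(1,2) in \<open>auto simp: unitary_def square_def list_all_iff B_def\<close>)
  moreover have "length (B ! j) = m" "length (B ! k) = m"
    using B(1,2) assms by (auto simp: square_def list_all_length)
  ultimately show ?thesis
    using herm_sum [of "B ! j" m "B ! k"] B(3) assms by simp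
qed

lemma gen_code_iff:
  "x \<in> gen_code A \<longleftrightarrow> x \<in> carrier_vec n \<and> (\<forall>j<m. x $ (m + j) = (\<Sum>i<m. x $ i * A ! i ! j))"
  by (simp add: gen_code_def m_def n_def)

lemma gen_code_subset: "gen_code A \<subseteq> carrier_vec n"
  by (auto simp: gen_code_iff)

text \<open>The conjugate transpose inverts \<open>A\<close>, so the right half of a word determines
  its left half.\<close>

lemma gen_code_left:
  assumes x: "x \<in> gen_code A" and i: "i < m"
  shows "x $ i = (\<Sum>j<m. x $ (m + j) * B ! j ! i)"
proof -
  have "(\<Sum>j<m. x $ (m + j) * B ! j ! i) = (\<Sum>j<m. (\<Sum>k<m. x $ k * A ! k ! j) * (A ! i ! j)\<^sup>2)"
    using x i B(3) by (simp add: gen_code_iff)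
  also have "\<dots> = (\<Sum>k<m. x $ k * (\<Sum>j<m. A ! k ! j * (A ! i ! j)\<^sup>2))"
    unfolding sum_distrib_left sum_distrib_right by (subst sum.swap) (simp add: mult_ac)
  also have "\<dots> = (\<Sum>k<m. if k = i then x $ k else 0)"
    using i by (intro sum.cong) (auto simp: rows_orthonormal)
  finally show ?thesis using i by simp
qed

lemma gen_code_row:
  assumes "i < m"
  defines "w \<equiv> vec n (\<lambda>q. if q < m then (if q = i then 1 else 0) else A ! i ! (q - m))"
  shows "w \<in> gen_code A"
proof -
  have "(\<Sum>k<m. (if k = i then 1 else 0) * A ! k ! j) = A ! i ! j" for j
    using assms(1) by (simp add: if_distrib [of "\<lambda>c. c * _"] cong: if_cong)
  moreover have "k < m \<Longrightarrow> k < n" for k by (simp add: n_def)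
  ultimately show ?thesis
    by (simp add: gen_code_iff w_def n_def cong: sum.cong_simp)
qed

text \<open>These are the rows of a second generator matrix, with the conjugate transpose on the
  left and the identity on the right. Orthogonality to them gives back the defining equations of the
  code.\<close>

lemma gen_code_column:
  assumes "j < m"
  defines "w \<equiv> vec n (\<lambda>q. if q < m then (A ! q ! j)\<^sup>2 else (if q - m = j then 1 else 0))"
  shows "w \<in> gen_code A"
proof -
  have "k < m \<Longrightarrow> k < n" for k by (simp add: n_def)
  then show ?thesis
    using columns_orthonormal [OF assms(1)]
    by (auto simp: gen_code_iff w_def n_def cong: sum.cong_simp)
qed

lemma hermitian_prod_split:
  assumes "x \<in> carrier_vec n"
  shows "hermitian_prod x y = (\<Sum>i<m. x $ i * (y $ i)\<^sup>2) + (\<Sum>j<m. x $ (m + j) * (y $ (m + j))\<^sup>2)"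
proof -
  have "{..<n} = {..<m} \<union> (\<lambda>j. m + j) ` {..<m}"
  proof (intro equalityI subsetI)
    fix i assume "i \<in> {..<n}"
    then show "i \<in> {..<m} \<union> (\<lambda>j. m + j) ` {..<m}"
      by (cases "i < m") (auto simp: n_def image_iff intro!: bexI [of _ "i - m"])
  qed (auto simp: n_def)
  moreover have "{..<m} \<inter> (\<lambda>j. m + j) ` {..<m} = {}" by auto
  ultimately show ?thesis
    using assms by (simp add: hermitian_prod_def sum.union_disjoint sum.reindex)
qed

lemma linear_gen_code: "linear_code n (gen_code A)"
  unfolding linear_code_iff
proof (intro conjI ballI allI)
  have lt: "k < m \<Longrightarrow> k < n" "k < m \<Longrightarrow> m + k < n" for k by (auto simp: n_def)
  show "gen_code A \<subseteq> carrier_vec n" by (rule gen_code_subset)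
  show "0\<^sub>v n \<in> gen_code A" by (simp add: gen_code_iff lt cong: sum.cong_simp)
  show "x + y \<in> gen_code A" if "x \<in> gen_code A" "y \<in> gen_code A" for x y
  proof -
    have "(x + y) $ k = x $ k + y $ k" if "k < n" for k
      using carrier_vecD [OF subsetD [OF gen_code_subset \<open>y \<in> gen_code A\<close>]] that by simp
    then show ?thesis
      using that lt by (simp add: gen_code_iff distrib_right sum.distrib cong: sum.cong_simp)
  qed
  show "a \<cdot>\<^sub>v x \<in> gen_code A" if "x \<in> gen_code A" for a x
  proof -
    have "(a \<cdot>\<^sub>v x) $ k = a * x $ k" if "k < n" for k
      using carrier_vecD [OF subsetD [OF gen_code_subset \<open>x \<in> gen_code A\<close>]] that by simp
    then show ?thesis
      using that lt by (simp add: gen_code_iff sum_distrib_left mult.assoc cong: sum.cong_simp)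
  qed
qed

text \<open>Since \<open>A\<close> preserves the form, the two halves contribute equally to a
  product of codewords and cancel in characteristic 2. The converse inclusion comes from the words
  of \<open>gen_code_column\<close>.\<close>

theorem self_dual_gen_code: "hermitian_self_dual n (gen_code A)"
proof -
  have "gen_code A \<subseteq> hermitian_dual n (gen_code A)"
  proof
    fix x assume x: "x \<in> gen_code A"
    have "hermitian_prod x y = 0" if y: "y \<in> gen_code A" for y
    proof -
      have "(\<Sum>j<m. x $ (m + j) * (y $ (m + j))\<^sup>2)
          = (\<Sum>j<m. x $ (m + j) * (\<Sum>i<m. (y $ i)\<^sup>2 * B ! j ! i))"
        using y B(3) by (simp add: gen_code_iff gf4_power2_sum power_mult_distrib)
      also have "\<dots> = (\<Sum>i<m. (\<Sum>j<m. x $ (m + j) * B ! j ! i) * (y $ i)\<^sup>2)"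
        unfolding sum_distrib_left sum_distrib_right by (subst sum.swap) (simp add: mult_ac)
      also have "\<dots> = (\<Sum>i<m. x $ i * (y $ i)\<^sup>2)"
        using gen_code_left [OF x] by simp
      finally show ?thesis using hermitian_prod_split [of x y] x by (simp add: gen_code_iff)
    qed
    then show "x \<in> hermitian_dual n (gen_code A)"
      using x by (auto simp: hermitian_dual_def gen_code_iff)
  qed
  moreover have "hermitian_dual n (gen_code A) \<subseteq> gen_code A"
  proof
    fix x assume x: "x \<in> hermitian_dual n (gen_code A)"
    then have xn: "x \<in> carrier_vec n" by (simp add: hermitian_dual_def)
    have "x $ (m + j) = (\<Sum>i<m. x $ i * A ! i ! j)" if j: "j < m" for j
    proof -
      define w where "w = vec n (\<lambda>q. if q < m then (A ! q ! j)\<^sup>2 else (if q - m = j then 1 else 0 :: gf4))"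
      have "hermitian_prod x w = 0"
        using x gen_code_column [OF j] by (auto simp: hermitian_dual_def w_def)
      moreover have "(\<Sum>i<m. x $ i * (w $ i)\<^sup>2) = (\<Sum>i<m. x $ i * A ! i ! j)"
        by (intro sum.cong) (auto simp: w_def n_def)
      moreover have "(\<Sum>k<m. x $ (m + k) * (w $ (m + k))\<^sup>2) = (\<Sum>k<m. if k = j then x $ (m + j) else 0)"
        by (intro sum.cong) (auto simp: w_def n_def)
      ultimately show ?thesis
        using hermitian_prod_split [OF xn, of w] j by (simp add: gf4_add_eq_0_iff)
    qed
    then show "x \<in> gen_code A" using xn by (simp add: gen_code_iff)
  qed
  ultimately show ?thesis using linear_gen_code by (auto simp: hermitian_self_dual_def)
qed

end

section \<open>Rigidity\<close>

text \<open>The square of a nonzero scalar is its inverse, so the nonzero entries are the columnwise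
  ratios of the first two rows.\<close>

definition cross_ratios :: "gf4 list list \<Rightarrow> gf4 list" where
  "cross_ratios A = map2 (\<lambda>a b. a * b\<^sup>2) (A ! 0) (A ! 1)"

definition rigid_rows :: "gf4 list list \<Rightarrow> bool" where
  "rigid_rows A \<longleftrightarrow> 2 \<le> length A \<and> list_all2 (\<lambda>a b. a \<noteq> 0 \<or> b \<noteq> 0) (A ! 0) (A ! 1)
     \<and> list_ex (\<lambda>a. list_ex (\<lambda>b. a \<noteq> 0 \<and> b \<noteq> 0 \<and> a \<noteq> b) (cross_ratios A)) (cross_ratios A)"

context unitary_matrix
begin

text \<open>One constant \<open>c\<close> satisfies \<open>frob e r = c * r\<close> for all nonzero
  ratios \<open>r\<close>. Under conjugation each of them would equal \<open>c\<close>, so two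
  distinct ratios exclude it, and then \<open>c = 1\<close>. Equality of coefficients spreads from
  the first two rows to all columns, and from there to all rows, none of which vanishes.\<close>

theorem rigid_gen_code:
  assumes rr: "rigid_rows A" shows "rigid n (gen_code A)"
  unfolding rigid_def
proof (intro allI impI)
  fix e d assume ed: "(e, id, d) \<in> stab n True (gen_code A)"
  have m2: "0 < m" "1 < m" using rr by (auto simp: rigid_rows_def m_def)
  have dm: "(e, id, d) \<in> semi_maps n True" "act n (e, id, d) ` gen_code A = gen_code A"
    using ed by (auto simp: stab_def)
  have dnz: "d j \<noteq> 0" if "j < n" for j by (rule semi_mapsD(5) [OF dm(1) that])
  \<comment> \<open>The left half of the image of generator row \<open>i\<close> is
    \<open>d i\<close> times a unit vector, so the image is \<open>d i\<close> times that
    row.\<close>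
  have key: "d (m + j) * frob e (A ! i ! j) = d i * A ! i ! j" if i: "i < m" and j: "j < m" for i j
  proof -
    let ?w = "vec n (\<lambda>q. if q < m then (if q = i then 1 else 0) else A ! i ! (q - m))"
    have "act n (e, id, d) ?w \<in> gen_code A" using gen_code_row [OF i] dm(2) by blast
    then have "act n (e, id, d) ?w $ (m + j) = (\<Sum>k<m. act n (e, id, d) ?w $ k * A ! k ! j)"
      using j by (simp add: gen_code_iff)
    also have "\<dots> = (\<Sum>k<m. if k = i then d i * A ! i ! j else 0)"
      by (intro sum.cong) (auto simp: act_index n_def)
    finally show ?thesis using i j by (simp add: act_index n_def)
  qed
  let ?c = "d 0 * inverse (d 1)"
  have d01: "d 0 \<noteq> 0" "d 1 \<noteq> 0" using dnz [of 0] dnz [of 1] m2 by (auto simp: n_def)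
  let ?R = "cross_ratios A"
  have R: "length ?R = m" "j < m \<Longrightarrow> ?R ! j = A ! 0 ! j * (A ! 1 ! j)\<^sup>2" for j
    using row_length [OF m2(1)] row_length [OF m2(2)] by (auto simp: cross_ratios_def)
  have ratio: "frob e r = ?c * r" if r: "r \<in> set ?R" "r \<noteq> 0" for r
  proof -
    obtain j where j: "j < m" "r = A ! 0 ! j * (A ! 1 ! j)\<^sup>2"
      using r(1) R unfolding in_set_conv_nth by metis
    have "d (m + j) \<noteq> 0" using dnz [of "m + j"] j(1) by (simp add: n_def)
    have "frob e (A ! 0 ! j) = inverse (d (m + j)) * (d 0 * A ! 0 ! j)"
      using key [OF m2(1) j(1)] \<open>d (m + j) \<noteq> 0\<close> by (simp add: field_simps)
    moreover have "frob e (A ! 1 ! j) = inverse (d (m + j)) * (d 1 * A ! 1 ! j)"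
      using key [OF m2(2) j(1)] \<open>d (m + j) \<noteq> 0\<close> by (simp add: field_simps)
    ultimately have "frob e r = inverse (d (m + j)) * (inverse (d (m + j)))\<^sup>2 * (d 0 * (d 1)\<^sup>2) * r"
      by (simp add: j(2) frob_mult frob_power2 power_mult_distrib mult_ac)
    moreover have "(d (m + j))\<^sup>2 * d (m + j) = 1"
      using gf4_mult_power2 [of "d (m + j)"] \<open>d (m + j) \<noteq> 0\<close> by (simp add: mult.commute)
    ultimately show ?thesis by (simp add: gf4_inverse)
  qed
  obtain a b where ab: "a \<in> set ?R" "b \<in> set ?R" "a \<noteq> 0" "b \<noteq> 0" "a \<noteq> b"
    using rr by (auto simp: rigid_rows_def list_ex_iff)
  have ne: "\<not> e"
  proof
    assume e
    then have "a\<^sup>2 = ?c * a" "b\<^sup>2 = ?c * b" using ratio ab by (auto simp: frob_def)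
    then have "a = ?c" "b = ?c" using ab(3,4) by (simp_all add: power2_eq_square)
    then show False using ab(5) by simp
  qed
  then have "?c * a = a" using ratio [OF ab(1,3)] by simp
  then have "?c = 1" using ab(3) by simp
  then have "d 1 = d 0" using d01 by (simp add: field_simps)
  have right: "d (m + j) = d 0" if j: "j < m" for j
  proof -
    have "A ! 0 ! j \<noteq> 0 \<or> A ! 1 ! j \<noteq> 0"
      using rr j row_length [OF m2(1)] by (auto simp: rigid_rows_def list_all2_conv_all_nth)
    then show ?thesis using key [OF m2(1) j] key [OF m2(2) j] ne \<open>d 1 = d 0\<close> by auto
  qed
  have left: "d i = d 0" if i: "i < m" for i
  proof -
    have "\<exists>j<m. A ! i ! j \<noteq> 0"
    proof (rule ccontr)
      assume "\<not> (\<exists>j<m. A ! i ! j \<noteq> 0)"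
      then have "(\<Sum>j<m. A ! i ! j * (A ! i ! j)\<^sup>2) = 0" by (intro sum.neutral) auto
      then show False using rows_orthonormal [OF i i] by simp
    qed
    then obtain j where j: "j < m" "A ! i ! j \<noteq> 0" by blast
    have "d (m + j) = d i" using key [OF i j(1)] ne j(2) by simp
    then show ?thesis using right [OF j(1)] by simp
  qed
  have "d j = d 0" if j: "j < n" for j
  proof (cases "j < m")
    case True then show ?thesis by (rule left)
  next
    case False
    then show ?thesis using right [of "j - m"] j by (simp add: n_def)
  qed
  then show "\<not> e \<and> (\<forall>j<n. d j = d 0)" using ne by blast
qed

end


section \<open>Enumerating the supports of words of small weight\<close>

fun add_list :: "gf4 list \<Rightarrow> gf4 list \<Rightarrow> gf4 list" where
  "add_list (x # xs) (y # ys) = (x + y) # add_list xs ys"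
| "add_list _ _ = []"

definition scale_list :: "gf4 \<Rightarrow> gf4 list \<Rightarrow> gf4 list" where
  "scale_list a xs = map ((*) a) xs"

definition nonzeros :: "gf4 list \<Rightarrow> bool list" where
  "nonzeros xs = map (\<lambda>x. x \<noteq> GF4_0) xs"

fun count_True :: "bool list \<Rightarrow> nat" where
  "count_True [] = 0"
| "count_True (b # bs) = (if b then Suc (count_True bs) else count_True bs)"

text \<open>\<open>span_supports rs k v ps\<close> lists the supports of weight at most 6 that are formed by \<open>rev ps\<close>,
  a coefficient list of weight at most \<open>k\<close> and \<open>v\<close> plus the linear combination of \<open>rs\<close>
  with these coefficients; \<open>code_supports\<close> takes nonzero coefficient lists with first nonzero
  entry 1.\<close>

fun span_supports :: "gf4 list list \<Rightarrow> nat \<Rightarrow> gf4 list \<Rightarrow> bool list \<Rightarrow> bool list list" where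
  "span_supports [] k v ps = (let s = rev ps @ nonzeros v in if count_True s \<le> 6 then [s] else [])"
| "span_supports (r # rs) 0 v ps = span_supports rs 0 v (False # ps)"
| "span_supports (r # rs) (Suc k) v ps = span_supports rs (Suc k) v (False # ps)
     @ (let ps' = True # ps in span_supports rs k (add_list v r) ps'
          @ span_supports rs k (add_list v (scale_list omega r)) ps'
          @ span_supports rs k (add_list v (scale_list omega_bar r)) ps')"

fun code_supports :: "gf4 list list \<Rightarrow> nat \<Rightarrow> bool list \<Rightarrow> bool list list" where
  "code_supports [] k ps = []"
| "code_supports (r # rs) k ps = span_supports rs k r (True # ps) @ code_supports rs k (False # ps)"

fun combine :: "gf4 list \<Rightarrow> gf4 list list \<Rightarrow> gf4 list \<Rightarrow> gf4 list" where
  "combine (a # us) (r # rs) v = combine us rs (add_list v (scale_list a r))"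
| "combine _ _ v = v"

lemma length_add_list [simp]: "length (add_list xs ys) = min (length xs) (length ys)"
  by (induction xs ys rule: add_list.induct) auto

lemma nth_add_list: "i < length xs \<Longrightarrow> i < length ys \<Longrightarrow> add_list xs ys ! i = xs ! i + ys ! i"
proof (induction xs ys arbitrary: i rule: add_list.induct)
  case (1 x xs y ys)
  then show ?case by (cases i) auto
qed auto

lemma length_scale_list [simp]: "length (scale_list a xs) = length xs"
  by (simp add: scale_list_def)

lemma scale_list_1 [simp]: "scale_list 1 xs = xs"
  by (simp add: scale_list_def map_idI)

lemma scale_scale_list: "scale_list a (scale_list b xs) = scale_list (a * b) xs"
  by (simp add: scale_list_def mult.assoc)

lemma scale_add_list: "scale_list a (add_list xs ys) = add_list (scale_list a xs) (scale_list a ys)"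
  by (induction xs ys rule: add_list.induct) (auto simp: scale_list_def distrib_left)

lemma add_scale_list_0: "length xs = length ys \<Longrightarrow> add_list xs (scale_list 0 ys) = xs"
  by (intro nth_equalityI) (auto simp: nth_add_list scale_list_def)

lemma nonzeros_scale_list: "a \<noteq> 0 \<Longrightarrow> nonzeros (scale_list a xs) = nonzeros xs"
  by (simp add: nonzeros_def scale_list_def flip: zero_gf4_def)

lemma length_nonzeros [simp]: "length (nonzeros xs) = length xs"
  by (simp add: nonzeros_def)

lemma nonzeros_Cons [simp]: "nonzeros (x # xs) = (x \<noteq> 0) # nonzeros xs" "nonzeros [] = []"
  by (simp_all add: nonzeros_def zero_gf4_def)

lemma combine_scale_list:
  "combine (scale_list b us) rs (scale_list b v) = scale_list b (combine us rs v)"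
proof (induction us rs v rule: combine.induct)
  case (1 a us r rs v)
  then show ?case by (simp add: scale_list_def [of b "_ # _"] scale_add_list scale_scale_list)
      (simp add: scale_list_def)
qed (auto simp: scale_list_def)

lemma combine_nth:
  assumes "length us = length rs" "\<And>r. r \<in> set rs \<Longrightarrow> length r = l" "length v = l"
  shows "length (combine us rs v) = l
    \<and> (\<forall>j<l. combine us rs v ! j = v ! j + (\<Sum>i<length rs. us ! i * rs ! i ! j))"
  using assms
proof (induction us rs v rule: combine.induct)
  case (1 a us r rs v)
  then show ?case
    by (simp add: sum.lessThan_Suc_shift nth_add_list scale_list_def add.assoc del: sum.lessThan_Suc)
qed auto

text \<open>The declarative meaning of \<open>span_supports\<close>, before the restriction to
  weight at most 6.\<close>

definition spans :: "gf4 list list \<Rightarrow> nat \<Rightarrow> gf4 list \<Rightarrow> bool list \<Rightarrow> bool list set" where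
  "spans rs k v ps = {rev ps @ nonzeros us @ nonzeros (combine us rs v) |us.
     length us = length rs \<and> count_True (nonzeros us) \<le> k}"

lemma spansI:
  "length us = length rs \<Longrightarrow> count_True (nonzeros us) \<le> k \<Longrightarrow>
    s = rev ps @ nonzeros us @ nonzeros (combine us rs v) \<Longrightarrow> s \<in> spans rs k v ps"
  unfolding spans_def by blast

lemma spans_Cons:
  assumes "length r = length v"
  shows "s \<in> spans (r # rs) k v ps \<longleftrightarrow> s \<in> spans rs k v (False # ps)
    \<or> (\<exists>a k'. a \<noteq> 0 \<and> k = Suc k' \<and> s \<in> spans rs k' (add_list v (scale_list a r)) (True # ps))"
    (is "_ \<longleftrightarrow> ?L \<or> ?R")
proof
  assume "s \<in> spans (r # rs) k v ps"
  then obtain us where us: "length us = length (r # rs)" "count_True (nonzeros us) \<le> k"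
    "s = rev ps @ nonzeros us @ nonzeros (combine us (r # rs) v)"
    unfolding spans_def by blast
  obtain a us' where a: "us = a # us'" using us(1) by (cases us) auto
  show "?L \<or> ?R"
  proof (cases "a = 0")
    case True
    then have "?L" using us assms by (intro spansI [of us']) (auto simp: a add_scale_list_0)
    then show ?thesis ..
  next
    case False
    then obtain k' where k': "k = Suc k'" using us(2) by (cases k) (auto simp: a)
    have "s \<in> spans rs k' (add_list v (scale_list a r)) (True # ps)"
      using us False by (intro spansI [of us']) (auto simp: a k')
    then show ?thesis using False k' by blast
  qed
next
  assume "?L \<or> ?R"
  then show "s \<in> spans (r # rs) k v ps"
  proof
    assume ?L
    then obtain us where us: "length us = length rs" "count_True (nonzeros us) \<le> k"
      "s = rev (False # ps) @ nonzeros us @ nonzeros (combine us rs v)"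
      unfolding spans_def by blast
    then show ?thesis using assms by (intro spansI [of "0 # us"]) (auto simp: add_scale_list_0)
  next
    assume ?R
    then obtain a k' us where us: "a \<noteq> 0" "k = Suc k'" "length us = length rs"
      "count_True (nonzeros us) \<le> k'"
      "s = rev (True # ps) @ nonzeros us @ nonzeros (combine us rs (add_list v (scale_list a r)))"
      unfolding spans_def by blast
    then show ?thesis by (intro spansI [of "a # us"]) auto
  qed
qed

lemma ex_nonzero_gf4: "(\<exists>a :: gf4. a \<noteq> 0 \<and> P a) \<longleftrightarrow> P 1 \<or> P omega \<or> P omega_bar"
proof
  assume "\<exists>a. a \<noteq> 0 \<and> P a"
  then obtain a where "a \<noteq> 0" "P a" by blast
  then show "P 1 \<or> P omega \<or> P omega_bar" by (cases a) (auto simp: gf4_def_simps)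
next
  assume "P 1 \<or> P omega \<or> P omega_bar"
  moreover have "(1 :: gf4) \<noteq> 0" "omega \<noteq> 0" "omega_bar \<noteq> 0" by (simp_all add: gf4_def_simps)
  ultimately show "\<exists>a. a \<noteq> 0 \<and> P a" by blast
qed

lemma span_supports:
  assumes "\<And>r. r \<in> set rs \<Longrightarrow> length r = length v"
  shows "s \<in> set (span_supports rs k v ps) \<longleftrightarrow> count_True s \<le> 6 \<and> s \<in> spans rs k v ps"
  using assms
proof (induction rs k v ps rule: span_supports.induct)
  case (1 k v ps)
  then show ?case by (auto simp: spans_def Let_def nonzeros_def)
next
  case (2 r rs v ps)
  then show ?case by (simp add: spans_Cons)
next
  case (3 r rs k v ps)
  have len: "length r = length v" using 3 by auto
  have R: "(\<exists>a k'. a \<noteq> 0 \<and> Suc k = Suc k' \<and> s \<in> spans rs k' (add_list v (scale_list a r)) (True # ps))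
    \<longleftrightarrow> s \<in> spans rs k (add_list v r) (True # ps)
      \<or> s \<in> spans rs k (add_list v (scale_list omega r)) (True # ps)
      \<or> s \<in> spans rs k (add_list v (scale_list omega_bar r)) (True # ps)"
    using ex_nonzero_gf4 [of "\<lambda>a. s \<in> spans rs k (add_list v (scale_list a r)) (True # ps)"] by simp
  show ?case
    unfolding spans_Cons [OF len] R using 3 by (auto simp: Let_def)
qed

text \<open>Division by the first nonzero coefficient changes no support, so this coefficient may be
  taken as 1. It is not counted by \<open>k\<close>, hence \<open>Suc k\<close>.\<close>

lemma code_supports:
  assumes "\<And>r. r \<in> set rs \<Longrightarrow> length r = l"
  shows "s \<in> set (code_supports rs k ps) \<longleftrightarrow> count_True s \<le> 6 \<and> (\<exists>us. length us = length rs
    \<and> count_True (nonzeros us) \<noteq> 0 \<and> count_True (nonzeros us) \<le> Suc k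
    \<and> s = rev ps @ nonzeros us @ nonzeros (combine us rs (replicate l 0)))"
  using assms
proof (induction rs k ps rule: code_supports.induct)
  case (1 k ps)
  then show ?case by (auto simp: nonzeros_def)
next
  case (2 r rs k ps)
  let ?z = "replicate l (0 :: gf4)"
  let ?P = "\<lambda>us. count_True (nonzeros us) \<noteq> 0 \<and> count_True (nonzeros us) \<le> Suc k"
  have len: "length r = l" "\<And>r'. r' \<in> set rs \<Longrightarrow> length r' = length r" using 2(2) by auto
  have z: "add_list ?z (scale_list 0 r) = ?z" using len by (intro add_scale_list_0) simp
  have za: "add_list ?z (scale_list a r) = scale_list a r" for a
    using len by (intro nth_equalityI) (auto simp: nth_add_list)
  have "(\<exists>us. length us = length (r # rs) \<and> ?P us
      \<and> s = rev ps @ nonzeros us @ nonzeros (combine us (r # rs) ?z))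
    \<longleftrightarrow> s \<in> spans rs k r (True # ps)
      \<or> (\<exists>us. length us = length rs \<and> ?P us
          \<and> s = rev (False # ps) @ nonzeros us @ nonzeros (combine us rs ?z))" (is "?A \<longleftrightarrow> ?B \<or> ?C")
  proof
    assume ?A
    then obtain us where us: "length us = length (r # rs)" "?P us"
      "s = rev ps @ nonzeros us @ nonzeros (combine us (r # rs) ?z)" by blast
    obtain a us' where a: "us = a # us'" using us(1) by (cases us) auto
    show "?B \<or> ?C"
    proof (cases "a = 0")
      case True
      then have ?C using us by (intro exI [of _ us']) (auto simp: a z)
      then show ?thesis ..
    next
      case False
      define vs where "vs = scale_list (inverse a) us'"
      have us': "us' = scale_list a vs" using False by (simp add: vs_def scale_scale_list)
      have "combine us' rs (scale_list a r) = scale_list a (combine vs rs r)"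
        unfolding us' by (rule combine_scale_list)
      then have ?B
        using us False by (intro spansI [of vs]) (auto simp: a us' za nonzeros_scale_list)
      then show ?thesis ..
    qed
  next
    assume "?B \<or> ?C"
    then show ?A
    proof
      assume ?B
      then obtain us where "length us = length rs" "count_True (nonzeros us) \<le> k"
        "s = rev (True # ps) @ nonzeros us @ nonzeros (combine us rs r)"
        unfolding spans_def by blast
      then show ?A using za [of 1] by (intro exI [of _ "1 # us"]) auto
    next
      assume ?C
      then obtain us where "length us = length rs" "?P us"
        "s = rev (False # ps) @ nonzeros us @ nonzeros (combine us rs ?z)" by blast
      then show ?A by (intro exI [of _ "0 # us"]) (auto simp: z)
    qed
  qed
  then show ?case
    using 2 span_supports [where s = s and k = k and ps = "True # ps", OF len(2)] by auto
qed

definition rotate_half :: "nat \<Rightarrow> bool list \<Rightarrow> bool list" where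
  "rotate_half m s = drop m s @ take m s"

text \<open>A word of weight at most 6 has weight at most 3 on the left half or at most 2 on the right
  half, and for unitary \<open>A\<close> both halves are information sets.\<close>

definition low_list :: "gf4 list list \<Rightarrow> bool list list" where
  "low_list A = code_supports A 2 []
     @ map (rotate_half (length A)) (code_supports (conj_transp A) 1 [])"

lemma count_True_append: "count_True (xs @ ys) = count_True xs + count_True ys"
  by (induction xs) auto

lemma count_True_card: "count_True xs = card {i. i < length xs \<and> xs ! i}"
proof -
  have "count_True xs = length (filter id xs)" by (induction xs) auto
  then show ?thesis by (simp add: length_filter_conv_card)
qed

lemma wt_supp_list: "x \<in> carrier_vec n \<Longrightarrow> wt x = count_True (supp_list n x)"
  unfolding wt_def count_True_card
  by (rule arg_cong [of _ _ card]) (auto simp: supp_list_def)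

section \<open>Exactness of the list of supports\<close>

context unitary_matrix
begin

lemma supp_gen_code:
  "{s. count_True s \<le> 6 \<and> (\<exists>us. length us = m \<and> count_True (nonzeros us) \<noteq> 0
      \<and> count_True (nonzeros us) \<le> k \<and> s = nonzeros us @ nonzeros (combine us A (replicate m 0)))}
   = supp_list n ` {x \<in> gen_code A. wt x \<le> 6 \<and> count_True (take m (supp_list n x)) \<noteq> 0
      \<and> count_True (take m (supp_list n x)) \<le> k}" (is "?L = ?R")
proof -
  define f where "f us = vec_of_list (us @ combine us A (replicate m 0))" for us
  have len: "length (combine us A (replicate m 0)) = m"
    and nth: "j < m \<Longrightarrow> combine us A (replicate m 0) ! j = (\<Sum>i<m. us ! i * A ! i ! j)"
    if "length us = m" for us j
    using combine_nth [of us A m "replicate m 0"] that unitary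
    by (auto simp: m_def unitary_def square_def list_all_iff)
  have f: "f us \<in> gen_code A" "supp_list n (f us) = nonzeros us @ nonzeros (combine us A (replicate m 0))"
    if "length us = m" for us
  proof -
    have idx: "f us $ i = us ! i" "f us $ (m + i) = combine us A (replicate m 0) ! i" if "i < m" for i
      using that \<open>length us = m\<close> by (simp_all add: f_def vec_of_list_index nth_append)
    have "f us \<in> carrier_vec n"
      using len [OF that] that by (simp add: f_def n_def carrier_vecI)
    then show "f us \<in> gen_code A" by (simp add: gen_code_iff idx nth [OF that])
    show "supp_list n (f us) = nonzeros us @ nonzeros (combine us A (replicate m 0))"
      using len [OF that] that
      by (intro nth_equalityI)
         (auto simp: supp_list_def f_def vec_of_list_index nonzeros_def nth_append n_def zero_gf4_def)
  qed
  have surj: "\<exists>us. length us = m \<and> x = f us" if x: "x \<in> gen_code A" for x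
  proof (intro exI conjI)
    let ?us = "map (\<lambda>i. x $ i) [0..<m]"
    show lus: "length ?us = m" by simp
    show "x = f ?us"
    proof (rule eq_vecI)
      fix i assume "i < dim_vec (f ?us)"
      then have i: "i < n" using len [OF lus] by (simp add: f_def n_def)
      show "x $ i = f ?us $ i"
      proof (cases "i < m")
        case True
        then show ?thesis by (simp add: f_def vec_of_list_index nth_append)
      next
        case False
        then obtain j where j: "i = m + j" "j < m" using i by (metis le_Suc_ex not_le n_def mult_2 nat_add_left_cancel_less)
        then show ?thesis
          using x nth [OF lus j(2)] by (simp add: f_def vec_of_list_index nth_append gen_code_iff)
      qed
    next
      show "dim_vec x = dim_vec (f ?us)"
        using carrier_vecD [OF subsetD [OF gen_code_subset x]] len [OF lus] by (simp add: f_def n_def)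
    qed
  qed
  have wt: "wt (f us) = count_True (nonzeros us @ nonzeros (combine us A (replicate m 0)))"
    and left: "take m (supp_list n (f us)) = nonzeros us" if "length us = m" for us
    using wt_supp_list [of "f us" n] f [OF that] that by (auto simp: gen_code_iff)
  show ?thesis
  proof (intro equalityI subsetI)
    fix s assume "s \<in> ?L"
    then obtain us where us: "length us = m" "count_True (nonzeros us) \<noteq> 0" "count_True (nonzeros us) \<le> k"
      "s = nonzeros us @ nonzeros (combine us A (replicate m 0))" "count_True s \<le> 6" by blast
    show "s \<in> ?R"
      by (rule image_eqI [of _ _ "f us"]) (use us f [OF us(1)] wt [OF us(1)] left [OF us(1)] in auto)
  next
    fix s assume "s \<in> ?R"
    then obtain x where x: "s = supp_list n x" "x \<in> gen_code A" "wt x \<le> 6"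
      "count_True (take m (supp_list n x)) \<noteq> 0" "count_True (take m (supp_list n x)) \<le> k" by blast
    obtain us where us: "length us = m" "x = f us" using surj [OF x(2)] by blast
    have "count_True s \<le> 6" "count_True (nonzeros us) \<noteq> 0" "count_True (nonzeros us) \<le> k"
      "s = nonzeros us @ nonzeros (combine us A (replicate m 0))"
      using x f(2) [OF us(1)] wt [OF us(1)] left [OF us(1)] us(2) by auto
    then show "s \<in> ?L" using us(1) by blast
  qed
qed


lemma conj_transp_B: "conj_transp B = A"
proof (rule nth_equalityI)
  show "length (conj_transp B) = length A" using conj_transp(1) [OF B(2)] B(1) by (simp add: m_def)
  fix i assume "i < length (conj_transp B)"
  then have i: "i < m" using conj_transp(1) [OF B(2)] B(1) by simp
  show "conj_transp B ! i = A ! i"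
  proof (rule nth_equalityI)
    have "length (conj_transp B ! i) = m"
      using conj_transp(1,2) [OF B(2)] B(1) i by (auto simp: square_def list_all_length)
    then show "length (conj_transp B ! i) = length (A ! i)" using row_length [OF i] by simp
    fix j assume "j < length (conj_transp B ! i)"
    then have j: "j < m" using \<open>length (conj_transp B ! i) = m\<close> by simp
    show "conj_transp B ! i ! j = A ! i ! j"
      using conj_transp(3) [OF B(2), of j i] B(1) B(3) [OF i j] i j by simp
  qed
qed

lemma unitary_B: "unitary B"
  using unitary B(2) by (simp add: unitary_def conj_transp_B B_def [symmetric])

definition swap :: "gf4 vec \<Rightarrow> gf4 vec" where
  "swap x = vec n (\<lambda>q. if q < m then x $ (m + q) else x $ (q - m))"

lemma swap_index: "i < m \<Longrightarrow> swap x $ i = x $ (m + i)" "i < m \<Longrightarrow> swap x $ (m + i) = x $ i"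
  by (simp_all add: swap_def n_def)

lemma swap_swap: "x \<in> carrier_vec n \<Longrightarrow> swap (swap x) = x"
  by (rule eq_vecI) (auto simp: swap_def n_def)

lemma supp_list_swap: "x \<in> carrier_vec n \<Longrightarrow> supp_list n (swap x) = rotate_half m (supp_list n x)"
  by (rule nth_equalityI) (auto simp: supp_list_def rotate_half_def swap_def nth_append n_def)

lemma wt_swap: "x \<in> carrier_vec n \<Longrightarrow> wt (swap x) = wt x"
proof -
  assume x: "x \<in> carrier_vec n"
  have "swap x \<in> carrier_vec n" by (simp add: swap_def)
  then have "wt (swap x) = count_True (drop m (supp_list n x) @ take m (supp_list n x))"
    using wt_supp_list [of "swap x" n] supp_list_swap [OF x] by (simp add: rotate_half_def)
  also have "\<dots> = count_True (take m (supp_list n x) @ drop m (supp_list n x))"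
    unfolding count_True_append by simp
  also have "\<dots> = wt x" using wt_supp_list [OF x] by simp
  finally show ?thesis .
qed

lemma swap_gen_code:
  assumes x: "x \<in> gen_code A"
  shows "swap x \<in> gen_code B"
proof -
  have "(\<Sum>i<m. swap x $ i * B ! i ! j) = x $ j" if "j < m" for j
    using gen_code_left [OF x that] by (simp add: swap_index)
  then show ?thesis
    by (simp add: gen_code_def B(1) swap_index) (simp add: swap_def n_def)
qed

lemma count_True_eq_0_iff: "count_True s = 0 \<longleftrightarrow> (\<forall>i<length s. \<not> s ! i)"
  unfolding count_True_card by auto

text \<open>A nonzero word is nonzero on both halves, as each half determines it. If the left half
  has weight above 3, the right half has weight at most 2, and swapping the halves gives a word of
  \<open>gen_code B\<close>, where the same enumeration applies. The arguments 2 and 1 of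
  \<open>code_supports\<close> stand for 3 and 2 nonzero coefficients. Equality matters because pair
  degrees are counted from the list.\<close>

theorem set_low_list: "set (low_list A) = low_supports n (gen_code A)"
proof -
  interpret B: unitary_matrix B "length B" "2 * length B" "conj_transp B"
    by unfold_locales (rule unitary_B)
  let ?l = "\<lambda>x. count_True (take m (supp_list n x))" and ?r = "\<lambda>x. count_True (drop m (supp_list n x))"
  have rows: "length r = m" if "r \<in> set A" for r
    using square that by (auto simp: square_def list_all_iff m_def)
  have rowsB: "length r = m" if "r \<in> set B" for r
    using B(1,2) that by (auto simp: square_def list_all_iff)
  have "set (code_supports A 2 []) = {s. count_True s \<le> 6 \<and> (\<exists>us. length us = m
      \<and> count_True (nonzeros us) \<noteq> 0 \<and> count_True (nonzeros us) \<le> 3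
      \<and> s = nonzeros us @ nonzeros (combine us A (replicate m 0)))}"
    using code_supports [where rs = A and l = m and k = 2 and ps = "[]", OF rows] by (auto simp: m_def)
  also have "\<dots> = supp_list n ` {x \<in> gen_code A. wt x \<le> 6 \<and> ?l x \<noteq> 0 \<and> ?l x \<le> 3}"
    by (rule supp_gen_code)
  finally have setA: "set (code_supports A 2 [])
    = supp_list n ` {x \<in> gen_code A. wt x \<le> 6 \<and> ?l x \<noteq> 0 \<and> ?l x \<le> 3}" .
  have "set (code_supports B 1 []) = {s. count_True s \<le> 6 \<and> (\<exists>us. length us = m
      \<and> count_True (nonzeros us) \<noteq> 0 \<and> count_True (nonzeros us) \<le> 2
      \<and> s = nonzeros us @ nonzeros (combine us B (replicate m 0)))}"
    using code_supports [where rs = B and l = m and k = 1 and ps = "[]", OF rowsB] B(1)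
    by (auto simp: numeral_2_eq_2)
  also have "\<dots> = supp_list n ` {x \<in> gen_code B. wt x \<le> 6 \<and> ?l x \<noteq> 0 \<and> ?l x \<le> 2}"
    using B.supp_gen_code [of 2] B(1) by (simp add: n_def)
  finally have setB: "set (code_supports B 1 [])
    = supp_list n ` {x \<in> gen_code B. wt x \<le> 6 \<and> ?l x \<noteq> 0 \<and> ?l x \<le> 2}" .
  have nB: "2 * length B = n" using B(1) by (simp add: n_def)
  have wt_lr: "wt x = ?l x + ?r x" if "x \<in> gen_code A" for x
    using wt_supp_list [OF subsetD [OF gen_code_subset that]]
    by (simp flip: count_True_append)
  have l0: "x = 0\<^sub>v n" if x: "x \<in> gen_code A" and "?l x = 0" for x
  proof -
    have z: "x $ i = 0" if "i < m" for i
      using \<open>?l x = 0\<close> that by (auto simp: count_True_eq_0_iff supp_list_def n_def)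
    have "x $ (m + j) = 0" if "j < m" for j
      using x that z by (simp add: gen_code_iff)
    then have "x $ i = 0" if "i < n" for i
      using z [of i] that by (cases "i < m") (auto simp: n_def not_less le_iff_add)
    then show ?thesis using carrier_vecD [OF subsetD [OF gen_code_subset x]] by (intro eq_vecI) auto
  qed
  have r0: "x = 0\<^sub>v n" if x: "x \<in> gen_code A" and "?r x = 0" for x
  proof (rule l0 [OF x])
    have "x $ (m + j) = 0" if "j < m" for j
      using \<open>?r x = 0\<close> that by (auto simp: count_True_eq_0_iff supp_list_def n_def)
    then have "x $ i = 0" if "i < m" for i
      using gen_code_left [OF x that] by simp
    then show "?l x = 0" by (auto simp: count_True_eq_0_iff supp_list_def n_def)
  qed
  have l_swap: "?l (swap x) = ?r x" if "x \<in> carrier_vec n" for x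
    using supp_list_swap [OF that] by (simp add: rotate_half_def n_def)
  show ?thesis
  proof (intro equalityI subsetI)
    fix s assume "s \<in> set (low_list A)"
    then consider "s \<in> set (code_supports A 2 [])" | t where "s = rotate_half m t" "t \<in> set (code_supports B 1 [])"
      by (auto simp: low_list_def m_def B_def)
    then show "s \<in> low_supports n (gen_code A)"
    proof cases
      case 1
      then obtain x where x: "s = supp_list n x" "x \<in> gen_code A" "wt x \<le> 6" "?l x \<noteq> 0"
        unfolding setA by blast
      have "x \<noteq> 0\<^sub>v n"
        using wt_lr [OF x(2)] x(4) wt_eq_0_iff [OF subsetD [OF gen_code_subset x(2)]] by auto
      then show ?thesis unfolding low_supports_def using x by blast
    next
      case (2 t)
      then obtain y where y: "t = supp_list n y" "y \<in> gen_code B" "wt y \<le> 6" "?l y \<noteq> 0"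
        unfolding setB by blast
      have yn: "y \<in> carrier_vec n" using B.gen_code_subset y(2) nB by auto
      have sy: "swap y \<in> gen_code A"
        using B.swap_gen_code [OF y(2)]
        unfolding B.swap_def swap_def n_def B(1) conj_transp_B .
      have "y \<noteq> 0\<^sub>v n"
        using y(4) by (auto simp: count_True_eq_0_iff supp_list_def n_def)
      then have "swap y \<noteq> 0\<^sub>v n"
        using wt_swap [OF yn] wt_eq_0_iff [OF yn] wt_eq_0_iff [OF subsetD [OF gen_code_subset sy]] by simp
      moreover have "s = supp_list n (swap y)" using 2(1) y(1) supp_list_swap [OF yn] by simp
      moreover have "wt (swap y) \<le> 6" using y(3) wt_swap [OF yn] by simp
      ultimately show ?thesis unfolding low_supports_def using sy by blast
    qed
  next
    fix s assume "s \<in> low_supports n (gen_code A)"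
    then obtain x where x: "s = supp_list n x" "x \<in> gen_code A" "x \<noteq> 0\<^sub>v n" "wt x \<le> 6"
      unfolding low_supports_def by blast
    have xn: "x \<in> carrier_vec n" by (rule subsetD [OF gen_code_subset x(2)])
    have nz: "?l x \<noteq> 0" "?r x \<noteq> 0" using l0 [OF x(2)] r0 [OF x(2)] x(3) by auto
    show "s \<in> set (low_list A)"
    proof (cases "?l x \<le> 3")
      case True
      then have "s \<in> set (code_supports A 2 [])" unfolding setA using x nz by blast
      then show ?thesis by (simp add: low_list_def)
    next
      case False
      then have "?l (swap x) \<le> 2" using wt_lr [OF x(2)] x(4) l_swap [OF xn] by simp
      then have "supp_list n (swap x) \<in> set (code_supports B 1 [])"
        unfolding setB using swap_gen_code [OF x(2)] x(4) wt_swap [OF xn] l_swap [OF xn] nz by auto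
      moreover have "s = rotate_half m (supp_list n (swap x))"
        using supp_list_swap [of "swap x"] swap_swap [OF xn] x(1) by (simp add: swap_def)
      ultimately show ?thesis by (auto simp: low_list_def m_def B_def)
    qed
  qed
qed

lemma no_weight_4_gen_code:
  assumes "list_all (\<lambda>s. count_True s = 6) (low_list A)"
  shows "gen_code A \<in> no_weight_4 n"
proof -
  have "wt x \<noteq> 4" if x: "x \<in> gen_code A" for x
  proof
    assume wt: "wt x = 4"
    have xn: "x \<in> carrier_vec n" by (rule subsetD [OF gen_code_subset x])
    have "x \<noteq> 0\<^sub>v n" using wt wt_eq_0_iff [OF xn] by auto
    then have "supp_list n x \<in> set (low_list A)"
      unfolding set_low_list low_supports_def using x wt by auto
    then have "count_True (supp_list n x) = 6" using assms by (auto simp: list_all_iff)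
    then show False using wt wt_supp_list [OF xn] by simp
  qed
  then show ?thesis using self_dual_gen_code by (simp add: no_weight_4_def self_dual_codes_def)
qed

end


section \<open>Bounding the automorphism group by a search\<close>

fun count_both :: "bool list \<Rightarrow> bool list \<Rightarrow> nat" where
  "count_both (x # xs) (y # ys) =
     (if x then if y then Suc (count_both xs ys) else count_both xs ys else count_both xs ys)"
| "count_both _ _ = 0"

definition pair_matrix :: "bool list list \<Rightarrow> nat list list" where
  "pair_matrix cs = map (\<lambda>c. map (count_both c) cs) cs"

text \<open>The required entries run from the latest point backwards, since \<open>search\<close>
  builds its states by prepending.\<close>

fun lower_rows :: "nat \<Rightarrow> nat list list \<Rightarrow> nat list list" where
  "lower_rows k [] = []"
| "lower_rows k (r # rs) = rev (take k r) # lower_rows (Suc k) rs"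

fun eq_list :: "nat list \<Rightarrow> nat list \<Rightarrow> bool" where
  "eq_list (x # xs) (y # ys) = (if x = y then eq_list xs ys else False)"
| "eq_list [] [] = True"
| "eq_list _ _ = False"

text \<open>\<open>search ts N st qs\<close> extends the images \<open>rev qs\<close> of the first points in all ways that respect
  a symmetric matrix. \<open>N\<close> pairs each point with its row, \<open>st\<close> holds for each point \<open>c\<close> the entries
  of row \<open>c\<close> at the images \<open>qs\<close>, and \<open>ts\<close> holds the entries required of the images of the
  remaining points.\<close>

function search :: "nat list list \<Rightarrow> (nat \<times> nat list) list \<Rightarrow> nat list list \<Rightarrow> nat list \<Rightarrow> nat list list"
  and try_points :: "(nat \<times> nat list) list \<Rightarrow> nat list list \<Rightarrow> nat list \<Rightarrow> nat list list
    \<Rightarrow> (nat \<times> nat list) list \<Rightarrow> nat list list \<Rightarrow> nat list \<Rightarrow> nat list list" where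
  "search [] N st qs = [rev qs]"
| "search (t # ts) N st qs = try_points N st t ts N st qs"
| "try_points [] ss t ts N st qs = []"
| "try_points (x # xs) [] t ts N st qs = []"
| "try_points (x # xs) (s # ss) t ts N st qs =
     (if eq_list s t then search ts N (cons_all (snd x) st) (fst x # qs) else [])
     @ try_points xs ss t ts N st qs"
  by pat_completeness auto
termination
  by (relation "measures [\<lambda>x. case x of Inl (ts, _) \<Rightarrow> 2 * length ts | Inr (xs, ss, t, ts, _) \<Rightarrow> 2 * length ts + 1,
        \<lambda>x. case x of Inl _ \<Rightarrow> 0 | Inr (xs, _) \<Rightarrow> length xs]") auto

fun eq_bools :: "bool list \<Rightarrow> bool list \<Rightarrow> bool" where
  "eq_bools (x # xs) (y # ys) = (if x then if y then eq_bools xs ys else False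
     else if y then False else eq_bools xs ys)"
| "eq_bools [] [] = True"
| "eq_bools _ _ = False"

fun elem :: "bool list \<Rightarrow> bool list list \<Rightarrow> bool" where
  "elem s [] = False"
| "elem s (t # ts) = (if eq_bools s t then True else elem s ts)"

fun no_repeats :: "bool list list \<Rightarrow> bool" where
  "no_repeats [] = True"
| "no_repeats (s # ss) = (if elem s ss then False else no_repeats ss)"

fun preserves :: "nat list \<Rightarrow> bool list list \<Rightarrow> bool list list \<Rightarrow> bool" where
  "preserves q L [] = True"
| "preserves q L (s # ss) = (if elem (map (nth s) q) L then preserves q L ss else False)"

fun filter_preserving :: "bool list list \<Rightarrow> nat list list \<Rightarrow> nat list list" where
  "filter_preserving L [] = []"
| "filter_preserving L (q # qs) =
     (if preserves q L L then q # filter_preserving L qs else filter_preserving L qs)"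

definition search_perms :: "nat \<Rightarrow> nat list list \<Rightarrow> nat list list" where
  "search_perms n M = search (lower_rows 0 M) (zip [0..<n] M) (replicate n []) []"

definition count_twos :: "nat list list \<Rightarrow> nat" where
  "count_twos M = sum_list (map (\<lambda>r. length (filter (\<lambda>x. x = 2) r)) M)"

definition check_matrix :: "nat \<Rightarrow> nat \<Rightarrow> nat \<Rightarrow> bool list list \<Rightarrow> nat list list \<Rightarrow> bool" where
  "check_matrix n t h L M \<longleftrightarrow> count_twos M = h \<and> length (filter_preserving L (search_perms n M)) \<le> t"

text \<open>If all supports have size 6, no word is found from both halves, and words with the same
  support are proportional, because otherwise a combination would have smaller weight. Absence of
  repeats makes counts in the list agree with cardinalities.\<close>

definition check_supports :: "nat \<Rightarrow> nat \<Rightarrow> nat \<Rightarrow> bool list list \<Rightarrow> bool" where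
  "check_supports n t h L \<longleftrightarrow> list_all (\<lambda>s. count_True s = 6) L \<and> no_repeats L
     \<and> check_matrix n t h L (pair_matrix (transpose_lists n L))"

definition check_code :: "gf4 list list \<Rightarrow> nat \<Rightarrow> nat \<Rightarrow> bool" where
  "check_code A t h \<longleftrightarrow> unitary A \<and> rigid_rows A \<and> check_supports (2 * length A) t h (low_list A)"

section \<open>Correctness of the executable checks\<close>

lemma eq_list [simp]: "eq_list xs ys \<longleftrightarrow> xs = ys"
  by (induction xs ys rule: eq_list.induct) auto

lemma eq_bools [simp]: "eq_bools xs ys \<longleftrightarrow> xs = ys"
  by (induction xs ys rule: eq_bools.induct) auto

lemma elem [simp]: "elem s L \<longleftrightarrow> s \<in> set L"
  by (induction L) auto

lemma no_repeats [simp]: "no_repeats L \<longleftrightarrow> distinct L"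
  by (induction L) auto

lemma preserves: "preserves q L ss \<longleftrightarrow> (\<forall>s\<in>set ss. map (nth s) q \<in> set L)"
  by (induction ss) auto

lemma set_filter_preserving:
  "q \<in> set (filter_preserving L qs) \<longleftrightarrow> q \<in> set qs \<and> (\<forall>s\<in>set L. map (nth s) q \<in> set L)"
  by (induction qs) (auto simp: preserves)

lemma count_both_map: "count_both (map f L) (map g L) = length (filter (\<lambda>s. f s \<and> g s) L)"
  by (induction L) auto

lemma pair_matrix:
  assumes "distinct L" "\<And>s. s \<in> set L \<Longrightarrow> length s = n"
  shows "pair_matrix (transpose_lists n L) = map (\<lambda>i. map (\<lambda>j. pair_degree (set L) i j) [0..<n]) [0..<n]"
proof -
  have tr: "transpose_lists n L = map (\<lambda>j. map (\<lambda>s. s ! j) L) [0..<n]"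
    using transpose_lists [where L = L and n = n, OF assms(2)] by (intro nth_equalityI) auto
  have "length (filter (\<lambda>s. s ! i \<and> s ! j) L) = pair_degree (set L) i j" for i j
    using assms(1) by (simp add: pair_degree_def distinct_length_filter Int_def conj_commute)
  then show ?thesis by (simp add: tr pair_matrix_def comp_def count_both_map)
qed

lemma lower_rows: "lower_rows k M = map (\<lambda>i. rev (take (k + i) (M ! i))) [0..<length M]"
proof (induction M arbitrary: k)
  case (Cons r M)
  show ?case
    unfolding lower_rows.simps Cons.IH
    by (subst upt_conv_Cons) (simp_all add: map_Suc_upt [symmetric] comp_def del: upt_Suc)
qed simp

lemma try_pointsI:
  "(x, s) \<in> set (zip xs ss) \<Longrightarrow> s = t \<Longrightarrow> q \<in> set (search ts N (cons_all (snd x) st) (fst x # qs)) \<Longrightarrow>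
    q \<in> set (try_points xs ss t ts N st qs)"
proof (induction xs arbitrary: ss)
  case (Cons y xs)
  then show ?case by (cases ss) auto
qed simp

text \<open>An upper bound on the number of permutations requires that none be missed. After the
  correct prefix of length \<open>k\<close>, the stored entries of the point \<open>p k\<close> are
  \<open>M (p k) (p i) = M k i\<close>, so its branch is followed. The induction runs downwards from
  the complete prefix.\<close>

lemma search_complete:
  fixes M :: "nat \<Rightarrow> nat \<Rightarrow> nat"
  assumes p: "\<And>i. i < n \<Longrightarrow> p i < n"
    and sym: "\<And>i j. M i j = M j i"
    and inv: "\<And>i j. i < n \<Longrightarrow> j < n \<Longrightarrow> M (p i) (p j) = M i j"
  defines "N \<equiv> zip [0..<n] (map (\<lambda>i. map (M i) [0..<n]) [0..<n])"
  assumes "k \<le> n"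
  shows "map p [0..<n] \<in> set (search (map (\<lambda>k. map (M k) (rev [0..<k])) [k..<n]) N
    (map (\<lambda>c. map (\<lambda>i. M c (p i)) (rev [0..<k])) [0..<n]) (map p (rev [0..<k])))"
  using \<open>k \<le> n\<close>
proof (induction k rule: inc_induct)
  case base
  then show ?case by (simp add: rev_map)
next
  case (step k)
  let ?st = "\<lambda>k. map (\<lambda>c. map (\<lambda>i. M c (p i)) (rev [0..<k])) [0..<n]"
  have up: "[k..<n] = k # [Suc k..<n]" using step.hyps by (simp add: upt_conv_Cons)
  \<comment> \<open>By symmetry of \<open>M\<close>, row \<open>p k\<close> supplies the new entry
    for the state of every point at once.\<close>
  have st: "cons_all (map (M (p k)) [0..<n]) (?st k) = ?st (Suc k)"
    by (rule nth_equalityI) (auto simp: nth_cons_all sym [of "p k"])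
  have "length N = n" by (simp add: N_def)
  have "(N ! p k, ?st k ! p k) \<in> set (zip N (?st k))"
    using p [OF step.hyps(2)] \<open>length N = n\<close> by (auto simp: in_set_zip)
  moreover have "N ! p k = (p k, map (M (p k)) [0..<n])"
    using p [OF step.hyps(2)] by (simp add: N_def)
  moreover have "?st k ! p k = map (M k) (rev [0..<k])"
    using p [OF step.hyps(2)] inv step.hyps(2) by auto
  ultimately show ?case
    unfolding up using step.IH st by (auto intro!: try_pointsI simp del: upt_Suc simp: upt_Suc_append)
qed

text \<open>Pair degrees are invariant under permutations that preserve the supports, so they may
  prune the search; the filter then tests the supports themselves.\<close>

theorem card_support_perms_le:
  assumes L: "distinct L" "\<And>s. s \<in> set L \<Longrightarrow> length s = n"
  shows "card (support_perms n (set L))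
    \<le> length (filter_preserving L (search_perms n (pair_matrix (transpose_lists n L))))"
proof -
  let ?M = "pair_degree (set L)"
  let ?r = "filter_preserving L (search_perms n (pair_matrix (transpose_lists n L)))"
  have "map p [0..<n] \<in> set ?r" if p: "p \<in> support_perms n (set L)" for p
  proof -
    have perm: "p permutes {..<n}" and sub: "permute_list_by n p ` set L \<subseteq> set L"
      using p by (auto simp: support_perms_def)
    have lt: "p i < n" if "i < n" for i using permutes_in_image [OF perm, of i] that by simp
    have sym: "?M i j = ?M j i" for i j by (simp add: pair_degree_def conj_commute)
    have inv: "?M (p i) (p j) = ?M i j" if "i < n" "j < n" for i j
      by (rule support_perms_pair_degree [OF p _ L(2) that]) auto
    have "lower_rows 0 (map (\<lambda>i. map (?M i) [0..<n]) [0..<n]) = map (\<lambda>k. map (?M k) (rev [0..<k])) [0..<n]"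
      by (auto simp: lower_rows take_map rev_map)
    then have "map p [0..<n] \<in> set (search_perms n (pair_matrix (transpose_lists n L)))"
      using search_complete [of n p ?M 0, OF lt sym inv] L
      by (simp add: search_perms_def pair_matrix map_replicate_const)
    moreover have "map (nth s) (map p [0..<n]) \<in> set L" if "s \<in> set L" for s
      using sub that by (auto simp: permute_list_by_def comp_def)
    ultimately show ?thesis by (simp add: set_filter_preserving)
  qed
  then have "(\<lambda>p. map p [0..<n]) ` support_perms n (set L) \<subseteq> set ?r" by blast
  moreover have "inj_on (\<lambda>p. map p [0..<n]) (support_perms n (set L))"
  proof (rule inj_onI)
    fix p q assume pq: "p \<in> support_perms n (set L)" "q \<in> support_perms n (set L)"
      and eq: "map p [0..<n] = map q [0..<n]"
    show "p = q"
    proof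
      fix i show "p i = q i"
        using pq eq permutes_not_in [of p "{..<n}" i] permutes_not_in [of q "{..<n}" i]
        by (cases "i < n") (auto simp: support_perms_def)
    qed
  qed
  ultimately have "card (support_perms n (set L)) \<le> card (set ?r)"
    by (intro card_inj_on_le) auto
  also have "\<dots> \<le> length ?r" by (rule card_length)
  finally show ?thesis .
qed

lemma degree_2_pairs_count:
  assumes "distinct L" "\<And>s. s \<in> set L \<Longrightarrow> length s = n"
  shows "degree_2_pairs n (set L) = count_twos (pair_matrix (transpose_lists n L))"
proof -
  have "(\<Sum>j<n. if P j then 1 else 0) = length (filter P [0..<n])" for P
  proof -
    have "length (filter P [0..<n]) = card {j. j < n \<and> P j}"
      by (simp add: distinct_length_filter Int_def conj_commute)
    moreover have "(\<Sum>j<n. if P j then 1 else 0) = card {j. j < n \<and> P j}"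
      by (simp add: sum.If_cases Int_def)
    ultimately show ?thesis by simp
  qed
  moreover have "pair_matrix (transpose_lists n L) = map (\<lambda>i. map (\<lambda>j. pair_degree (set L) i j) [0..<n]) [0..<n]"
    using assms by (rule pair_matrix)
  ultimately show ?thesis
    unfolding count_twos_def degree_2_pairs_def
    by (simp add: filter_map comp_def interv_sum_list_conv_sum_set_nat atLeast0LessThan)
qed

theorem check_code:
  assumes "check_code A t h"
  defines "n \<equiv> 2 * length A" and "C \<equiv> gen_code A"
  shows "C \<in> no_weight_4 n" "rigid n C" "card (support_perms n (low_supports n C)) \<le> t"
    "degree_2_pairs n (low_supports n C) = h" "card (stab n True C) \<le> 3 * t" "0 < n"
proof -
  interpret U: unitary_matrix A "length A" "2 * length A" "conj_transp A"
    by unfold_locales (use assms(1) in \<open>simp add: check_code_def\<close>)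
  have *: "rigid_rows A" "list_all (\<lambda>s. count_True s = 6) (low_list A)" "distinct (low_list A)"
    "count_twos (pair_matrix (transpose_lists n (low_list A))) = h"
    "length (filter_preserving (low_list A) (search_perms n (pair_matrix (transpose_lists n (low_list A))))) \<le> t"
    using assms(1) by (simp_all add: check_code_def check_supports_def check_matrix_def n_def)
  have low: "low_supports n C = set (low_list A)" by (simp add: n_def C_def U.set_low_list)
  have len: "length s = n" if "s \<in> set (low_list A)" for s
    using that length_low_supports [of s n C] by (simp add: low)
  show "C \<in> no_weight_4 n" unfolding C_def n_def by (rule U.no_weight_4_gen_code [OF *(2)])
  show r: "rigid n C" unfolding C_def n_def by (rule U.rigid_gen_code [OF *(1)])
  show c: "card (support_perms n (low_supports n C)) \<le> t"
    unfolding low using card_support_perms_le [OF *(3) len] *(5) by linarith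
  show "degree_2_pairs n (low_supports n C) = h"
    unfolding low using degree_2_pairs_count [OF *(3) len] *(4) by simp
  show n0: "0 < n" using *(1) by (auto simp: rigid_rows_def n_def)
  have "card (stab n True C) \<le> 3 * card (support_perms n (low_supports n C))"
    by (rule card_stab_le [OF _ r n0]) (simp add: C_def n_def U.gen_code_subset)
  then show "card (stab n True C) \<le> 3 * t" using c by simp
qed

section \<open>Verifying automorphisms\<close>

definition gen_row :: "gf4 list list \<Rightarrow> nat \<Rightarrow> gf4 list" where
  "gen_row A i = (replicate (length A) 0)[i := 1] @ A ! i"

text \<open>The lists hold source coordinates and coefficients, in the convention of
  \<open>act\<close>. The last test is membership of the image of each generator row; the identity
  permutation is excluded because scalars are always automorphisms.\<close>

definition check_aut :: "gf4 list list \<Rightarrow> nat list \<Rightarrow> gf4 list \<Rightarrow> bool" where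
  "check_aut A p d \<longleftrightarrow> length p = 2 * length A \<and> length d = 2 * length A \<and> distinct p
     \<and> list_all (\<lambda>i. i < 2 * length A) p \<and> list_all (\<lambda>a. a \<noteq> 0) d \<and> p \<noteq> [0..<2 * length A]
     \<and> list_all (\<lambda>i. let y = map2 (\<lambda>k a. a * gen_row A i ! k) p d in
          drop (length A) y = combine (take (length A) y) A (replicate (length A) 0)) [0..<length A]"

text \<open>A codeword is the combination of generator rows with its left half as coefficients, so
  by linearity the test on rows suffices.\<close>

theorem (in unitary_matrix) check_aut:
  assumes ch: "check_aut A p d"
  obtains P D j where "(False, P, D) \<in> stab n False (gen_code A)" "j < n" "P j \<noteq> j"
proof -
  have p: "length p = n" "length d = n" "distinct p" "\<And>i. i < n \<Longrightarrow> p ! i < n"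
    "\<And>i. i < n \<Longrightarrow> d ! i \<noteq> 0" "p \<noteq> [0..<n]"
    using ch by (auto simp: check_aut_def n_def m_def list_all_length)
  define P where "P i = (if i < n then p ! i else i)" for i
  define D where "D = restrict (nth d) {..<n}"
  have perm: "P permutes {..<n}"
    by (intro inj_imp_permutes inj_onI)
       (use p in \<open>auto simp: P_def nth_eq_iff_index_eq\<close>)
  have g: "(False, P, D) \<in> semi_maps n False"
    unfolding D_def by (rule semi_mapsI) (use perm p in auto)
  define G where "G l q = gen_row A l ! q" for l q
  define y where "y l k = d ! k * G l (p ! k)" for l k
  have y: "y l (m + j) = (\<Sum>i<m. y l i * A ! i ! j)" if l: "l < m" and j: "j < m" for l j
  proof -
    let ?y = "map2 (\<lambda>k a. a * gen_row A l ! k) p d"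
    have yl: "length ?y = n" "\<And>k. k < n \<Longrightarrow> ?y ! k = y l k"
      using p by (simp_all add: y_def G_def)
    have "drop m ?y = combine (take m ?y) A (replicate m 0)"
      using ch l by (auto simp: check_aut_def m_def list_all_length Let_def)
    then have "?y ! (m + j) = combine (take m ?y) A (replicate m 0) ! j"
      using j yl(1) by (metis nth_drop n_def le_add1 mult_2)
    also have "\<dots> = (\<Sum>i<m. ?y ! i * A ! i ! j)"
      using combine_nth [of "take m ?y" A m "replicate m 0"] yl(1) j square
      by (simp add: m_def n_def square_def list_all_iff)
    finally show ?thesis using yl(2) j by (simp add: n_def)
  qed
  have xG: "x $ q = (\<Sum>l<m. x $ l * G l q)" if x: "x \<in> gen_code A" and q: "q < n" for x q
  proof (cases "q < m")
    case True
    have "(\<Sum>l<m. x $ l * G l q) = (\<Sum>l<m. if l = q then x $ q else 0)"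
      using True by (intro sum.cong) (auto simp: G_def gen_row_def nth_append m_def nth_list_update)
    then show ?thesis using True by simp
  next
    case False
    then obtain j where j: "q = m + j" "j < m"
      using q by (metis le_Suc_ex not_le n_def mult_2 nat_add_left_cancel_less)
    then show ?thesis using x by (simp add: gen_code_iff G_def gen_row_def nth_append m_def)
  qed
  have "act n (False, P, D) x \<in> gen_code A" if x: "x \<in> gen_code A" for x
  proof -
    have a: "act n (False, P, D) x $ k = (\<Sum>l<m. x $ l * y l k)" if k: "k < n" for k
    proof -
      have "act n (False, P, D) x $ k = d ! k * x $ (p ! k)"
        using k by (simp add: act_index P_def D_def)
      also have "\<dots> = (\<Sum>l<m. x $ l * y l k)"
        unfolding xG [OF x p(4) [OF k]] y_def by (simp add: sum_distrib_left mult_ac)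
      finally show ?thesis .
    qed
    have "act n (False, P, D) x $ (m + j) = (\<Sum>i<m. act n (False, P, D) x $ i * A ! i ! j)" if j: "j < m" for j
    proof -
      have "act n (False, P, D) x $ (m + j) = (\<Sum>l<m. x $ l * y l (m + j))"
        using a [of "m + j"] j by (simp add: n_def)
      also have "\<dots> = (\<Sum>l<m. \<Sum>i<m. x $ l * y l i * A ! i ! j)"
        using y j by (simp add: sum_distrib_left mult.assoc)
      also have "\<dots> = (\<Sum>i<m. (\<Sum>l<m. x $ l * y l i) * A ! i ! j)"
        by (subst sum.swap) (simp add: sum_distrib_right)
      also have "\<dots> = (\<Sum>i<m. act n (False, P, D) x $ i * A ! i ! j)"
        using a by (simp add: n_def)
      finally show ?thesis .
    qed
    then show ?thesis by (simp add: gen_code_iff)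
  qed
  then have "(False, P, D) \<in> stab n False (gen_code A)"
    by (intro stabI [OF g gen_code_subset]) blast
  moreover obtain j where "j < n" "p ! j \<noteq> j"
  proof -
    have "\<exists>j<n. p ! j \<noteq> j"
    proof (rule ccontr)
      assume "\<not> (\<exists>j<n. p ! j \<noteq> j)"
      then have "p = [0..<n]" by (intro nth_equalityI) (use p(1) in auto)
      then show False using p(6) by simp
    qed
    then show thesis using that by blast
  qed
  then have "j < n" "P j \<noteq> j" by (simp_all add: P_def)
  ultimately show thesis by (rule that)
qed


section \<open>Codes of length at most 18\<close>

text \<open>A monomial automorphism that moves a coordinate is not scalar. The property is constant
  on semilinear orbits and separates the certified codes from a code with trivial group.\<close>

definition movable :: "nat \<Rightarrow> gf4 vec set \<Rightarrow> bool" where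
  "movable n C \<longleftrightarrow> (\<exists>p d j. (False, p, d) \<in> stab n False C \<and> j < n \<and> p j \<noteq> j)"

text \<open>Conjugation by \<open>g\<close>: the Frobenius parts of \<open>g\<close> and its inverse
  cancel, so the conjugate is again monomial, and it moves the coordinate
  \<open>inv_into UNIV q j\<close>.\<close>

lemma movable_act:
  assumes C: "C \<subseteq> carrier_vec n" and g: "g \<in> semi_maps n b" and mv: "movable n C"
  shows "movable n (act n g ` C)"
proof -
  obtain p d j where s: "(False, p, d) \<in> stab n False C" "j < n" "p j \<noteq> j"
    using mv unfolding movable_def by blast
  have sm: "(False, p, d) \<in> semi_maps n b" "act n (False, p, d) ` C = C"
    using s(1) semi_maps_mono by (auto simp: stab_def)
  obtain e q f where g': "g = (e, q, f)" by (cases g)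
  have q: "q permutes {..<n}" using semi_mapsD(2) [of e q f n b] g g' by simp
  let ?i = "inv_into UNIV q"
  define k where "k = semi_comp n g (semi_comp n (False, p, d) (semi_inv n g))"
  have kb: "k \<in> semi_maps n b"
    unfolding k_def by (intro semi_comp_in g sm(1) semi_inv_in)
  have "act n k ` act n g ` C = act n g ` act n (False, p, d) ` act n (semi_inv n g) ` act n g ` C"
    by (simp add: k_def act_comp [OF g] act_comp [OF sm(1)] image_image)
  also have "act n (semi_inv n g) ` act n g ` C = id ` C"
    unfolding image_image by (rule image_cong) (use C act_inv(1) [OF g] in auto)
  finally have fix_img: "act n k ` act n g ` C = act n g ` C" using sm(2) by simp
  obtain d' where k: "k = (False, ?i \<circ> p \<circ> q, d')"
    by (auto simp: k_def semi_comp_def semi_inv_def g' comp_assoc)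
  have "k \<in> semi_maps n False" using kb by (simp add: k semi_maps_def)
  then have "(False, ?i \<circ> p \<circ> q, d') \<in> stab n False (act n g ` C)"
    using fix_img by (simp add: stab_def k)
  moreover have "?i j < n" using permutes_in_image [OF permutes_inv [OF q], of j] s(2) by simp
  moreover have "(?i \<circ> p \<circ> q) (?i j) \<noteq> ?i j"
    using s(3) permutes_inverses [OF q] by (metis comp_apply)
  ultimately show ?thesis unfolding movable_def by blast
qed

lemma no_weight_4_act:
  assumes C: "C \<in> no_weight_4 n" and g: "g \<in> semi_maps n b"
  shows "act n g ` C \<in> no_weight_4 n"
proof -
  have sd: "hermitian_self_dual n C" using C by (simp add: no_weight_4_def self_dual_codes_def)
  have "x \<in> carrier_vec n" if "x \<in> C" for x using hermitian_self_dual_subset [OF sd] that by blast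
  then show ?thesis
    using C wt_act [OF g] hermitian_self_dual_act [OF sd g]
    by (auto simp: no_weight_4_def self_dual_codes_def)
qed

lemma no_weight_4_subset: "C \<in> no_weight_4 n \<Longrightarrow> C \<subseteq> carrier_vec n"
  using hermitian_self_dual_subset by (simp add: no_weight_4_def self_dual_codes_def)

lemma finite_no_weight_4: "finite (no_weight_4 n)"
  unfolding no_weight_4_def using finite_self_dual_codes by simp

text \<open>The twelve codes below have minimum weight 6 and were found by random sampling. The first
  parameter \<open>t\<close> bounds the number of coordinate permutations that preserve the supports of the
  words of weight 6, so that a code is responsible for a share \<open>2 / t\<close> of the orbit size
  \<open>fact 18 * 3 ^ 17\<close> of a code with trivial automorphism group. The shares add up to \<open>2.527\<close>, and
  \<open>card_no_weight_4_18\<close> leaves room for less than \<open>3.498\<close>. The second parameter is the invariant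
  \<open>degree_2_pairs\<close>.\<close>

definition certified :: "nat \<Rightarrow> nat \<Rightarrow> bool" where
  "certified t h \<longleftrightarrow> (\<exists>A p d. length A = 9 \<and> check_code A t h \<and> check_aut A p d)"

lemma certifiedI: "length A = 9 \<Longrightarrow> check_code A t h \<Longrightarrow> check_aut A p d \<Longrightarrow> certified t h"
  unfolding certified_def by blast

text \<open>The whole semilinear orbit of the certified code lies in the set on the right; the group
  has \<open>2 * (fact 18 * 3 ^ 18)\<close> elements and the stabilizer at most
  \<open>3 * t\<close>.\<close>

lemma certified_many:
  assumes "certified t h"
  shows "2 * (fact 18 * 3 ^ 18) \<le> 3 * t * card {D \<in> no_weight_4 18. movable 18 D
    \<and> degree_2_pairs 18 (low_supports 18 D) = h}" (is "_ \<le> 3 * t * card ?X")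
proof -
  obtain A p d where A: "length A = 9" "check_code A t h" "check_aut A p d"
    using assms unfolding certified_def by blast
  let ?C = "gen_code A"
  have n: "2 * length A = 18" using A(1) by simp
  note ch = check_code [OF A(2), unfolded n]
  have Cn: "?C \<subseteq> carrier_vec 18" by (rule no_weight_4_subset [OF ch(1)])
  interpret U: unitary_matrix A "length A" "2 * length A" "conj_transp A"
    by unfold_locales (use A(2) in \<open>simp add: check_code_def\<close>)
  have mv: "movable 18 ?C"
  proof -
    obtain P D j where "(False, P, D) \<in> stab 18 False ?C" "j < 18" "P j \<noteq> j"
      using U.check_aut [OF A(3)] unfolding n .
    then show ?thesis unfolding movable_def by blast
  qed
  have "orbit 18 True ?C \<subseteq> ?X"
  proof
    fix D assume D: "D \<in> orbit 18 True ?C"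
    then obtain g where g: "g \<in> semi_maps 18 True" "D = act 18 g ` ?C" unfolding orbit_def by blast
    show "D \<in> ?X"
      using no_weight_4_act [OF ch(1) g(1)] movable_act [OF Cn g(1) mv]
        degree_2_pairs_orbit [OF Cn D] ch(4) by (simp add: g(2))
  qed
  then have le: "card (orbit 18 True ?C) \<le> card ?X"
    by (rule card_mono [rotated]) (simp add: finite_no_weight_4)
  have "2 * (fact 18 * 3 ^ 18) = card (semi_maps 18 True)"
    by (simp only: card_semi_maps if_True)
  also have "\<dots> \<le> 3 * t * card (orbit 18 True ?C)"
    by (rule card_orbit [OF Cn ch(5)])
  also have "\<dots> \<le> 3 * t * card ?X"
    by (rule mult_le_mono2 [OF le])
  finally show ?thesis .
qed

section \<open>The twelve codes of length 18\<close>

lemma certified_52: "certified 4 52"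
  by (rule certifiedI [where A =
    "[[GF4_1, GF4_1, GF4_w, GF4_w, GF4_0, GF4_1, GF4_0, GF4_wb, GF4_1],
     [GF4_0, GF4_1, GF4_wb, GF4_1, GF4_wb, GF4_0, GF4_1, GF4_w, GF4_wb],
     [GF4_1, GF4_1, GF4_1, GF4_0, GF4_w, GF4_0, GF4_1, GF4_wb, GF4_w],
     [GF4_0, GF4_1, GF4_1, GF4_0, GF4_wb, GF4_1, GF4_wb, GF4_1, GF4_1],
     [GF4_wb, GF4_wb, GF4_wb, GF4_w, GF4_wb, GF4_wb, GF4_1, GF4_0, GF4_0],
     [GF4_w, GF4_w, GF4_w, GF4_0, GF4_0, GF4_1, GF4_1, GF4_1, GF4_w],
     [GF4_1, GF4_wb, GF4_1, GF4_wb, GF4_w, GF4_1, GF4_w, GF4_w, GF4_1],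
     [GF4_w, GF4_wb, GF4_1, GF4_wb, GF4_1, GF4_w, GF4_wb, GF4_w, GF4_1],
     [GF4_1, GF4_1, GF4_1, GF4_0, GF4_w, GF4_wb, GF4_0, GF4_0, GF4_0]]"
    and p = "[7, 6, 5, 17, 10, 2, 1, 0, 13, 15, 4, 12, 11, 8, 14, 9, 16, 3]"
    and d = "[GF4_1, GF4_w, GF4_1, GF4_1, GF4_wb, GF4_1, GF4_wb, GF4_1, GF4_1,
     GF4_w, GF4_w, GF4_1, GF4_1, GF4_1, GF4_1, GF4_wb, GF4_1, GF4_1]"];
    code_simp)

lemma certified_32: "certified 8 32"
  by (rule certifiedI [where A =
    "[[GF4_wb, GF4_1, GF4_w, GF4_1, GF4_w, GF4_wb, GF4_1, GF4_wb, GF4_1],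
     [GF4_wb, GF4_wb, GF4_0, GF4_w, GF4_w, GF4_wb, GF4_1, GF4_wb, GF4_0],
     [GF4_1, GF4_1, GF4_0, GF4_w, GF4_w, GF4_wb, GF4_w, GF4_w, GF4_0],
     [GF4_0, GF4_wb, GF4_wb, GF4_wb, GF4_w, GF4_wb, GF4_0, GF4_w, GF4_1],
     [GF4_wb, GF4_wb, GF4_w, GF4_1, GF4_w, GF4_w, GF4_wb, GF4_1, GF4_1],
     [GF4_0, GF4_wb, GF4_1, GF4_w, GF4_wb, GF4_wb, GF4_0, GF4_w, GF4_w],
     [GF4_wb, GF4_w, GF4_wb, GF4_0, GF4_wb, GF4_wb, GF4_0, GF4_wb, GF4_wb],
     [GF4_w, GF4_0, GF4_wb, GF4_w, GF4_w, GF4_wb, GF4_0, GF4_1, GF4_1],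
     [GF4_wb, GF4_0, GF4_w, GF4_0, GF4_wb, GF4_w, GF4_w, GF4_1, GF4_1]]"
    and p = "[2, 1, 0, 5, 4, 3, 9, 7, 8, 6, 13, 16, 12, 10, 17, 15, 11, 14]"
    and d = "[GF4_wb, GF4_w, GF4_1, GF4_1, GF4_w, GF4_wb, GF4_wb, GF4_w, GF4_w,
     GF4_1, GF4_1, GF4_w, GF4_w, GF4_wb, GF4_w, GF4_w, GF4_w, GF4_w]"];
    code_simp)

lemma certified_48: "certified 8 48"
  by (rule certifiedI [where A =
    "[[GF4_1, GF4_wb, GF4_1, GF4_w, GF4_0, GF4_wb, GF4_wb, GF4_wb, GF4_0],
     [GF4_wb, GF4_w, GF4_0, GF4_0, GF4_w, GF4_wb, GF4_1, GF4_w, GF4_1],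
     [GF4_wb, GF4_1, GF4_1, GF4_wb, GF4_w, GF4_1, GF4_1, GF4_1, GF4_wb],
     [GF4_0, GF4_w, GF4_w, GF4_1, GF4_wb, GF4_wb, GF4_0, GF4_w, GF4_wb],
     [GF4_wb, GF4_1, GF4_0, GF4_0, GF4_0, GF4_w, GF4_0, GF4_1, GF4_w],
     [GF4_0, GF4_wb, GF4_wb, GF4_wb, GF4_wb, GF4_wb, GF4_wb, GF4_0, GF4_w],
     [GF4_1, GF4_1, GF4_w, GF4_wb, GF4_w, GF4_w, GF4_wb, GF4_wb, GF4_w],
     [GF4_1, GF4_w, GF4_wb, GF4_1, GF4_1, GF4_wb, GF4_1, GF4_wb, GF4_w],
     [GF4_1, GF4_wb, GF4_w, GF4_1, GF4_wb, GF4_w, GF4_1, GF4_0, GF4_0]]"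
    and p = "[1, 0, 4, 3, 2, 10, 6, 7, 8, 9, 5, 15, 14, 17, 12, 11, 16, 13]"
    and d = "[GF4_w, GF4_1, GF4_wb, GF4_wb, GF4_wb, GF4_1, GF4_wb, GF4_wb, GF4_wb,
     GF4_wb, GF4_w, GF4_wb, GF4_wb, GF4_1, GF4_wb, GF4_wb, GF4_wb, GF4_w]"];
    code_simp)

lemma certified_60: "certified 8 60"
  by (rule certifiedI [where A =
    "[[GF4_0, GF4_w, GF4_1, GF4_w, GF4_wb, GF4_0, GF4_wb, GF4_wb, GF4_1],
     [GF4_1, GF4_wb, GF4_1, GF4_w, GF4_wb, GF4_wb, GF4_w, GF4_w, GF4_wb],
     [GF4_w, GF4_0, GF4_wb, GF4_wb, GF4_0, GF4_wb, GF4_wb, GF4_w, GF4_wb],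
     [GF4_w, GF4_w, GF4_0, GF4_wb, GF4_1, GF4_w, GF4_1, GF4_w, GF4_0],
     [GF4_w, GF4_wb, GF4_0, GF4_w, GF4_wb, GF4_0, GF4_1, GF4_wb, GF4_1],
     [GF4_0, GF4_0, GF4_wb, GF4_wb, GF4_0, GF4_w, GF4_1, GF4_w, GF4_0],
     [GF4_1, GF4_wb, GF4_wb, GF4_0, GF4_0, GF4_wb, GF4_1, GF4_wb, GF4_w],
     [GF4_w, GF4_wb, GF4_0, GF4_0, GF4_wb, GF4_w, GF4_wb, GF4_wb, GF4_wb],
     [GF4_1, GF4_1, GF4_0, GF4_wb, GF4_0, GF4_w, GF4_wb, GF4_1, GF4_w]]"
    and p = "[1, 0, 3, 2, 5, 4, 17, 10, 12, 11, 7, 9, 8, 16, 14, 15, 13, 6]"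
    and d = "[GF4_1, GF4_1, GF4_1, GF4_1, GF4_w, GF4_wb, GF4_w, GF4_1, GF4_w,
     GF4_wb, GF4_1, GF4_w, GF4_wb, GF4_wb, GF4_1, GF4_1, GF4_w, GF4_wb]"];
    code_simp)

lemma certified_72: "certified 8 72"
  by (rule certifiedI [where A =
    "[[GF4_1, GF4_1, GF4_w, GF4_0, GF4_1, GF4_0, GF4_wb, GF4_1, GF4_1],
     [GF4_wb, GF4_wb, GF4_0, GF4_wb, GF4_w, GF4_1, GF4_wb, GF4_wb, GF4_0],
     [GF4_w, GF4_0, GF4_w, GF4_wb, GF4_wb, GF4_1, GF4_wb, GF4_0, GF4_1],
     [GF4_w, GF4_w, GF4_1, GF4_wb, GF4_0, GF4_w, GF4_0, GF4_w, GF4_1],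
     [GF4_1, GF4_0, GF4_1, GF4_w, GF4_0, GF4_1, GF4_0, GF4_0, GF4_w],
     [GF4_w, GF4_1, GF4_1, GF4_wb, GF4_0, GF4_1, GF4_1, GF4_w, GF4_0],
     [GF4_wb, GF4_1, GF4_1, GF4_wb, GF4_0, GF4_1, GF4_w, GF4_0, GF4_w],
     [GF4_0, GF4_w, GF4_w, GF4_1, GF4_w, GF4_0, GF4_1, GF4_1, GF4_w],
     [GF4_0, GF4_1, GF4_0, GF4_0, GF4_wb, GF4_wb, GF4_w, GF4_0, GF4_1]]"
    and p = "[1, 0, 3, 2, 5, 4, 9, 11, 14, 6, 17, 7, 16, 13, 8, 15, 12, 10]"
    and d = "[GF4_w, GF4_1, GF4_wb, GF4_wb, GF4_1, GF4_w, GF4_1, GF4_w, GF4_1,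
     GF4_w, GF4_wb, GF4_1, GF4_wb, GF4_wb, GF4_w, GF4_wb, GF4_wb, GF4_wb]"];
    code_simp)

lemma certified_94: "certified 8 94"
  by (rule certifiedI [where A =
    "[[GF4_wb, GF4_1, GF4_0, GF4_1, GF4_w, GF4_w, GF4_0, GF4_wb, GF4_1],
     [GF4_1, GF4_w, GF4_w, GF4_w, GF4_0, GF4_w, GF4_w, GF4_0, GF4_wb],
     [GF4_0, GF4_1, GF4_wb, GF4_w, GF4_wb, GF4_1, GF4_1, GF4_1, GF4_0],
     [GF4_wb, GF4_1, GF4_w, GF4_wb, GF4_wb, GF4_w, GF4_1, GF4_w, GF4_wb],
     [GF4_wb, GF4_1, GF4_0, GF4_1, GF4_w, GF4_0, GF4_1, GF4_0, GF4_0],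
     [GF4_wb, GF4_0, GF4_0, GF4_wb, GF4_wb, GF4_wb, GF4_0, GF4_0, GF4_w],
     [GF4_1, GF4_0, GF4_wb, GF4_1, GF4_wb, GF4_0, GF4_1, GF4_w, GF4_w],
     [GF4_w, GF4_0, GF4_wb, GF4_1, GF4_1, GF4_1, GF4_1, GF4_0, GF4_w],
     [GF4_0, GF4_0, GF4_0, GF4_wb, GF4_0, GF4_w, GF4_wb, GF4_wb, GF4_wb]]"
    and p = "[4, 2, 1, 3, 0, 11, 13, 9, 12, 7, 10, 5, 8, 6, 14, 15, 16, 17]"
    and d = "[GF4_1, GF4_wb, GF4_w, GF4_1, GF4_1, GF4_wb, GF4_wb, GF4_w, GF4_w,
     GF4_wb, GF4_1, GF4_w, GF4_wb, GF4_w, GF4_1, GF4_1, GF4_1, GF4_1]"];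
    code_simp)

lemma certified_40: "certified 12 40"
  by (rule certifiedI [where A =
    "[[GF4_1, GF4_wb, GF4_w, GF4_1, GF4_wb, GF4_0, GF4_wb, GF4_wb, GF4_0],
     [GF4_0, GF4_wb, GF4_1, GF4_1, GF4_1, GF4_1, GF4_wb, GF4_0, GF4_w],
     [GF4_wb, GF4_w, GF4_1, GF4_wb, GF4_0, GF4_wb, GF4_1, GF4_1, GF4_0],
     [GF4_wb, GF4_1, GF4_wb, GF4_wb, GF4_0, GF4_0, GF4_w, GF4_w, GF4_w],
     [GF4_w, GF4_w, GF4_0, GF4_0, GF4_w, GF4_w, GF4_wb, GF4_w, GF4_wb],
     [GF4_0, GF4_1, GF4_wb, GF4_wb, GF4_1, GF4_1, GF4_wb, GF4_0, GF4_1],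
     [GF4_1, GF4_wb, GF4_0, GF4_wb, GF4_w, GF4_wb, GF4_w, GF4_w, GF4_0],
     [GF4_1, GF4_wb, GF4_wb, GF4_0, GF4_1, GF4_w, GF4_wb, GF4_wb, GF4_0],
     [GF4_wb, GF4_w, GF4_1, GF4_1, GF4_wb, GF4_wb, GF4_wb, GF4_1, GF4_wb]]"
    and p = "[8, 7, 1, 0, 6, 2, 3, 17, 14, 11, 12, 9, 10, 5, 4, 15, 16, 13]"
    and d = "[GF4_1, GF4_1, GF4_wb, GF4_1, GF4_1, GF4_w, GF4_w, GF4_w, GF4_1,
     GF4_w, GF4_1, GF4_wb, GF4_1, GF4_1, GF4_wb, GF4_wb, GF4_wb, GF4_wb]"];
    code_simp)

lemma certified_66: "certified 12 66"
  by (rule certifiedI [where A =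
    "[[GF4_w, GF4_w, GF4_wb, GF4_wb, GF4_0, GF4_w, GF4_1, GF4_0, GF4_1],
     [GF4_w, GF4_1, GF4_1, GF4_0, GF4_wb, GF4_0, GF4_0, GF4_w, GF4_0],
     [GF4_w, GF4_wb, GF4_1, GF4_wb, GF4_1, GF4_1, GF4_1, GF4_w, GF4_w],
     [GF4_wb, GF4_wb, GF4_wb, GF4_0, GF4_wb, GF4_1, GF4_0, GF4_1, GF4_w],
     [GF4_0, GF4_0, GF4_0, GF4_1, GF4_wb, GF4_0, GF4_wb, GF4_w, GF4_1],
     [GF4_w, GF4_wb, GF4_wb, GF4_0, GF4_wb, GF4_wb, GF4_w, GF4_0, GF4_w],
     [GF4_0, GF4_1, GF4_wb, GF4_0, GF4_1, GF4_1, GF4_1, GF4_0, GF4_0],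
     [GF4_1, GF4_wb, GF4_1, GF4_w, GF4_0, GF4_wb, GF4_w, GF4_w, GF4_0],
     [GF4_1, GF4_0, GF4_0, GF4_w, GF4_w, GF4_1, GF4_wb, GF4_0, GF4_0]]"
    and p = "[1, 0, 3, 2, 4, 7, 6, 5, 9, 8, 11, 10, 12, 13, 14, 15, 17, 16]"
    and d = "[GF4_1, GF4_1, GF4_w, GF4_wb, GF4_1, GF4_wb, GF4_1, GF4_w, GF4_1,
     GF4_1, GF4_w, GF4_wb, GF4_1, GF4_1, GF4_1, GF4_1, GF4_w, GF4_wb]"];
    code_simp)

lemma certified_80: "certified 16 80"
  by (rule certifiedI [where A =
    "[[GF4_0, GF4_1, GF4_1, GF4_w, GF4_wb, GF4_wb, GF4_0, GF4_0, GF4_0],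
     [GF4_1, GF4_w, GF4_wb, GF4_wb, GF4_wb, GF4_1, GF4_w, GF4_1, GF4_wb],
     [GF4_0, GF4_wb, GF4_1, GF4_1, GF4_w, GF4_1, GF4_1, GF4_0, GF4_w],
     [GF4_wb, GF4_1, GF4_wb, GF4_0, GF4_w, GF4_wb, GF4_wb, GF4_wb, GF4_0],
     [GF4_wb, GF4_wb, GF4_w, GF4_wb, GF4_wb, GF4_1, GF4_w, GF4_1, GF4_w],
     [GF4_wb, GF4_1, GF4_1, GF4_0, GF4_1, GF4_1, GF4_0, GF4_w, GF4_w],
     [GF4_w, GF4_1, GF4_1, GF4_wb, GF4_1, GF4_0, GF4_0, GF4_w, GF4_1],
     [GF4_0, GF4_1, GF4_w, GF4_wb, GF4_wb, GF4_0, GF4_wb, GF4_wb, GF4_wb],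
     [GF4_0, GF4_wb, GF4_w, GF4_w, GF4_1, GF4_1, GF4_0, GF4_wb, GF4_1]]"
    and p = "[0, 1, 5, 4, 3, 2, 15, 9, 8, 7, 10, 13, 12, 11, 14, 6, 17, 16]"
    and d = "[GF4_1, GF4_1, GF4_1, GF4_w, GF4_wb, GF4_1, GF4_w, GF4_wb, GF4_1,
     GF4_w, GF4_1, GF4_w, GF4_1, GF4_wb, GF4_1, GF4_wb, GF4_wb, GF4_w]"];
    code_simp)

lemma certified_104: "certified 16 104"
  by (rule certifiedI [where A =
    "[[GF4_wb, GF4_1, GF4_wb, GF4_wb, GF4_0, GF4_1, GF4_wb, GF4_1, GF4_0],
     [GF4_1, GF4_wb, GF4_w, GF4_w, GF4_wb, GF4_wb, GF4_wb, GF4_wb, GF4_wb],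
     [GF4_w, GF4_w, GF4_1, GF4_0, GF4_0, GF4_0, GF4_wb, GF4_w, GF4_0],
     [GF4_w, GF4_1, GF4_1, GF4_w, GF4_0, GF4_1, GF4_wb, GF4_wb, GF4_0],
     [GF4_w, GF4_0, GF4_wb, GF4_0, GF4_wb, GF4_0, GF4_1, GF4_0, GF4_w],
     [GF4_0, GF4_wb, GF4_1, GF4_0, GF4_w, GF4_0, GF4_0, GF4_1, GF4_w],
     [GF4_wb, GF4_0, GF4_wb, GF4_1, GF4_wb, GF4_wb, GF4_wb, GF4_0, GF4_w],
     [GF4_0, GF4_1, GF4_0, GF4_w, GF4_w, GF4_0, GF4_wb, GF4_wb, GF4_0],
     [GF4_wb, GF4_w, GF4_0, GF4_0, GF4_0, GF4_w, GF4_0, GF4_1, GF4_wb]]"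
    and p = "[1, 0, 5, 11, 6, 2, 4, 15, 9, 8, 10, 3, 13, 12, 17, 7, 16, 14]"
    and d = "[GF4_w, GF4_1, GF4_wb, GF4_wb, GF4_wb, GF4_wb, GF4_wb, GF4_1, GF4_1,
     GF4_w, GF4_wb, GF4_wb, GF4_wb, GF4_wb, GF4_w, GF4_w, GF4_wb, GF4_1]"];
    code_simp)

lemma certified_0: "certified 18 0"
  by (rule certifiedI [where A =
    "[[GF4_0, GF4_w, GF4_wb, GF4_w, GF4_wb, GF4_w, GF4_w, GF4_wb, GF4_0],
     [GF4_wb, GF4_1, GF4_wb, GF4_1, GF4_w, GF4_1, GF4_wb, GF4_w, GF4_1],
     [GF4_0, GF4_wb, GF4_0, GF4_1, GF4_wb, GF4_w, GF4_wb, GF4_w, GF4_w],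
     [GF4_0, GF4_w, GF4_0, GF4_w, GF4_wb, GF4_w, GF4_1, GF4_w, GF4_wb],
     [GF4_wb, GF4_w, GF4_1, GF4_1, GF4_0, GF4_wb, GF4_wb, GF4_0, GF4_w],
     [GF4_1, GF4_w, GF4_w, GF4_1, GF4_1, GF4_0, GF4_1, GF4_0, GF4_wb],
     [GF4_1, GF4_1, GF4_0, GF4_w, GF4_wb, GF4_1, GF4_wb, GF4_1, GF4_0],
     [GF4_w, GF4_wb, GF4_w, GF4_1, GF4_w, GF4_wb, GF4_wb, GF4_wb, GF4_wb],
     [GF4_0, GF4_1, GF4_0, GF4_wb, GF4_0, GF4_0, GF4_wb, GF4_w, GF4_w]]"
    and p = "[5, 13, 0, 1, 8, 2, 10, 12, 11, 14, 15, 4, 17, 3, 16, 6, 9, 7]"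
    and d = "[GF4_1, GF4_w, GF4_1, GF4_wb, GF4_1, GF4_wb, GF4_w, GF4_1, GF4_w,
     GF4_w, GF4_wb, GF4_w, GF4_wb, GF4_wb, GF4_w, GF4_wb, GF4_1, GF4_1]"];
    code_simp)

lemma certified_44: "certified 24 44"
  by (rule certifiedI [where A =
    "[[GF4_1, GF4_1, GF4_1, GF4_1, GF4_w, GF4_wb, GF4_w, GF4_wb, GF4_w],
     [GF4_1, GF4_0, GF4_w, GF4_1, GF4_w, GF4_wb, GF4_w, GF4_w, GF4_0],
     [GF4_0, GF4_w, GF4_0, GF4_0, GF4_w, GF4_1, GF4_1, GF4_0, GF4_wb],
     [GF4_w, GF4_wb, GF4_wb, GF4_1, GF4_0, GF4_1, GF4_wb, GF4_w, GF4_0],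
     [GF4_w, GF4_0, GF4_0, GF4_1, GF4_0, GF4_1, GF4_0, GF4_w, GF4_wb],
     [GF4_0, GF4_w, GF4_wb, GF4_0, GF4_w, GF4_w, GF4_0, GF4_0, GF4_1],
     [GF4_w, GF4_0, GF4_w, GF4_w, GF4_wb, GF4_1, GF4_0, GF4_w, GF4_w],
     [GF4_wb, GF4_w, GF4_wb, GF4_1, GF4_wb, GF4_1, GF4_0, GF4_0, GF4_1],
     [GF4_wb, GF4_0, GF4_wb, GF4_w, GF4_w, GF4_wb, GF4_1, GF4_0, GF4_w]]"
    and p = "[2, 5, 0, 3, 4, 1, 13, 8, 7, 9, 15, 11, 12, 6, 16, 10, 14, 17]"
    and d = "[GF4_1, GF4_1, GF4_1, GF4_1, GF4_1, GF4_1, GF4_w, GF4_wb, GF4_w,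
     GF4_1, GF4_1, GF4_1, GF4_1, GF4_wb, GF4_wb, GF4_1, GF4_w, GF4_1]"];
    code_simp)

section \<open>Exclusion of all lengths below 20\<close>

lemma orbit_self: "C \<subseteq> carrier_vec n \<Longrightarrow> C \<in> orbit n b C"
proof -
  assume C: "C \<subseteq> carrier_vec n"
  let ?g = "(False, id, restrict (\<lambda>_. 1) {..<n})"
  have g: "?g \<in> semi_maps n b" by (rule semi_mapsI) (auto simp: permutes_id)
  have "act n ?g x = x" if "x \<in> C" for x
    using that C by (intro eq_vecI) (auto simp: act_index)
  then have "C = (\<lambda>g. act n g ` C) ?g" by simp
  then show ?thesis unfolding orbit_def using g by (rule image_eqI)
qed

text \<open>A word of weight 4 would yield an automorphism that moves a coordinate. If some code of
  the orbit were movable, mapping it back would make \<open>C\<close> movable. Only monomial maps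
  occur, since triviality says nothing about semilinear ones.\<close>

lemma trivial_orbit:
  assumes C: "hermitian_self_dual n C" and triv: "trivial_code_aut n C"
  shows "orbit n False C \<subseteq> {D \<in> no_weight_4 n. \<not> movable n D}"
    and "fact n * 3 ^ n \<le> 3 * card (orbit n False C)"
proof -
  have Cn: "C \<subseteq> carrier_vec n" by (rule hermitian_self_dual_subset [OF C])
  have nm: "\<not> movable n C"
    using trivial_code_autD(2) [OF triv Cn] unfolding movable_def by blast
  have "wt x \<noteq> 4" if "x \<in> C" for x
  proof
    assume "wt x = 4"
    then show False
      using weight_4_automorphism [OF C that] nm unfolding movable_def by metis
  qed
  then have C4: "C \<in> no_weight_4 n" using C by (simp add: no_weight_4_def self_dual_codes_def)
  show "orbit n False C \<subseteq> {D \<in> no_weight_4 n. \<not> movable n D}"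
  proof
    fix D assume D: "D \<in> orbit n False C"
    then obtain g where g: "g \<in> semi_maps n False" "D = act n g ` C" unfolding orbit_def by blast
    have D4: "D \<in> no_weight_4 n" unfolding g(2) by (rule no_weight_4_act [OF C4 g(1)])
    have Dn: "D \<subseteq> carrier_vec n" by (rule no_weight_4_subset [OF D4])
    have "C \<in> orbit n False D" using orbit_eq [OF Cn D] orbit_self [OF Cn] by simp
    then obtain h where h: "h \<in> semi_maps n False" "C = act n h ` D" unfolding orbit_def by blast
    have "\<not> movable n D" using movable_act [OF Dn h(1)] nm h(2) by metis
    then show "D \<in> {D \<in> no_weight_4 n. \<not> movable n D}" using D4 by simp
  qed
  show "fact n * 3 ^ n \<le> 3 * card (orbit n False C)"
    using card_orbit [OF Cn trivial_code_autD(1) [OF triv Cn]] by (simp add: card_semi_maps)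
qed

text \<open>The movable codes contain twelve classes told apart by the invariant, the others an
  orbit of at least \<open>fact 18 * 3 ^ 17\<close> codes. In this unit the parts exceed 3.527, but
  the whole is below 3.498.\<close>

lemma no_trivial_18:
  assumes C: "hermitian_self_dual 18 C" and triv: "trivial_code_aut 18 C"
  shows False
proof -
  let ?W = "no_weight_4 18"
  let ?Y = "{D \<in> ?W. \<not> movable 18 D}" and ?Z = "{D \<in> ?W. movable 18 D}"
  define c where "c h = card {D \<in> ?W. movable 18 D \<and> degree_2_pairs 18 (low_supports 18 D) = h}" for h
  let ?H = "{52, 32, 48, 60, 72, 94, 40, 66, 80, 104, 0, 44} :: nat set"
  have fin: "finite ?W" by (rule finite_no_weight_4)
  have "card (orbit 18 False C) \<le> card ?Y"
    by (rule card_mono [OF _ trivial_orbit(1) [OF C triv]]) (simp add: fin)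
  then have G: "fact 18 * 3 ^ 18 \<le> 3 * card ?Y"
    using trivial_orbit(2) [OF C triv] by linarith
  have "(\<Sum>h\<in>?H. c h) = card (\<Union>h\<in>?H. {D \<in> ?W. movable 18 D \<and> degree_2_pairs 18 (low_supports 18 D) = h})"
    unfolding c_def by (rule card_UN_disjoint [symmetric]) (auto simp: fin)
  also have "\<dots> \<le> card ?Z"
    by (rule card_mono) (auto simp: fin)
  finally have "c 52 + c 32 + c 48 + c 60 + c 72 + c 94 + c 40 + c 66 + c 80 + c 104 + c 0 + c 44 \<le> card ?Z" by simp
  moreover have "card ?W = card ?Y + card ?Z"
  proof -
    have "?W = ?Y \<union> ?Z" by blast
    moreover have "?Y \<inter> ?Z = {}" by blast
    ultimately show ?thesis using fin card_Un_disjoint [of ?Y ?Z] by (metis (no_types, lifting) finite_Un)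
  qed
  moreover have "(18 :: nat) * card ?W \<le> 52050910388789696272967034"
    using card_no_weight_4_18 by linarith
  moreover have "fact 18 * 3 ^ 18 = (2480410751833883860992000 :: nat)" by (simp add: fact_numeral)
  ultimately show False
    using G
      certified_many [OF certified_52]
      certified_many [OF certified_32]
      certified_many [OF certified_48]
      certified_many [OF certified_60]
      certified_many [OF certified_72]
      certified_many [OF certified_94]
      certified_many [OF certified_40]
      certified_many [OF certified_66]
      certified_many [OF certified_80]
      certified_many [OF certified_104]
      certified_many [OF certified_0]
      certified_many [OF certified_44]
    unfolding c_def [symmetric] by linarith
qed

text \<open>At length 16 an orbit would need about 3.0e20 codes, and only 3.2e19 exist. At length 18
  the inequality turns round, with 8.3e23 against 4.3e24.\<close>

lemma no_trivial_le_16: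
  assumes "0 < n" "n \<le> 16" and C: "hermitian_self_dual n C" and triv: "trivial_code_aut n C"
  shows False
proof -
  have Cn: "C \<subseteq> carrier_vec n" by (rule hermitian_self_dual_subset [OF C])
  obtain m where m: "n = 2 * m" using self_dual_even_length [OF C] by (auto elim: evenE)
  have "orbit n False C \<subseteq> self_dual_codes n"
    using trivial_orbit(1) [OF C triv] by (auto simp: no_weight_4_def)
  then have "card (orbit n False C) \<le> (\<Prod>i<m. 2 ^ (2 * i + 1) + 1)"
    using card_mono [OF finite_self_dual_codes] card_self_dual_codes [of m] m by metis
  then have le: "fact (2 * m) * 3 ^ (2 * m) \<le> 3 * (\<Prod>i<m. 2 ^ (2 * i + 1) + 1 :: nat)"
    using trivial_orbit(2) [OF C triv] unfolding m by linarith
  have "m \<in> {1, 2, 3, 4, 5, 6, 7, 8}" using assms(1,2) m by auto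
  then show False
    using le by (elim insertE) (simp_all add: fact_numeral lessThan_nat_numeral lessThan_Suc)
qed

section \<open>A code of length 20 with trivial automorphism group\<close>

text \<open>With the bound 1 every automorphism has the identity permutation, and rigidity makes it
  scalar.\<close>

lemma check_code_trivial:
  assumes "check_code A 1 h"
  shows "trivial_code_aut (2 * length A) (gen_code A)"
proof -
  let ?n = "2 * length A" and ?C = "gen_code A"
  note ch = check_code [OF assms]
  have sd: "hermitian_self_dual ?n ?C" using ch(1) by (simp add: no_weight_4_def self_dual_codes_def)
  then have lin: "linear_code ?n ?C" by (simp add: hermitian_self_dual_def)
  have Cn: "?C \<subseteq> carrier_vec ?n" by (rule linear_codeD(1) [OF lin])
  have "permute_list_by ?n id s = s" if "s \<in> low_supports ?n ?C" for s
    using length_low_supports [OF that] by (intro nth_equalityI) (auto simp: permute_list_by_def)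
  then have id: "id \<in> support_perms ?n (low_supports ?n ?C)"
    by (auto simp: support_perms_def permutes_id)
  have "p = id" if "p \<in> support_perms ?n (low_supports ?n ?C)" for p
    using ch(3) id that card_le_Suc0_iff_eq [OF finite_support_perms] by auto
  then have p: "p = id" if "(False, p, d) \<in> stab ?n False ?C" for p d
    using stab_support_perms [OF Cn that] by blast
  have "\<forall>j<?n. d j = d 0" if "(False, id, d) \<in> stab ?n False ?C" for d
  proof -
    have "(False, id, d) \<in> stab ?n True ?C" using that semi_maps_mono by (simp add: stab_def)
    then show ?thesis using ch(2) unfolding rigid_def by blast
  qed
  then show ?thesis using p by (intro trivial_code_autI [OF lin ch(6)]) blast
qed

lemma exists_trivial_20: "\<exists>C. hermitian_self_dual 20 C \<and> trivial_code_aut 20 C"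
proof -
  \<comment> \<open>Here only the identity preserves the supports of the words of weight 6; 92 is
    the value of the pair degree invariant.\<close>
  obtain A where A: "length A = 10" "check_code A 1 92"
  proof
    show "length ([[GF4_0, GF4_1, GF4_w, GF4_w, GF4_w, GF4_wb, GF4_w, GF4_1, GF4_1, GF4_wb],
     [GF4_w, GF4_1, GF4_wb, GF4_1, GF4_1, GF4_wb, GF4_wb, GF4_0, GF4_0, GF4_0],
     [GF4_w, GF4_1, GF4_1, GF4_1, GF4_wb, GF4_w, GF4_w, GF4_0, GF4_wb, GF4_1],
     [GF4_w, GF4_0, GF4_0, GF4_1, GF4_wb, GF4_0, GF4_w, GF4_wb, GF4_w, GF4_wb],
     [GF4_1, GF4_0, GF4_wb, GF4_wb, GF4_0, GF4_0, GF4_wb, GF4_0, GF4_0, GF4_1],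
     [GF4_0, GF4_1, GF4_0, GF4_0, GF4_w, GF4_w, GF4_0, GF4_1, GF4_w, GF4_0],
     [GF4_0, GF4_1, GF4_0, GF4_w, GF4_w, GF4_0, GF4_wb, GF4_0, GF4_0, GF4_w],
     [GF4_1, GF4_0, GF4_wb, GF4_1, GF4_1, GF4_wb, GF4_w, GF4_wb, GF4_wb, GF4_1],
     [GF4_1, GF4_0, GF4_wb, GF4_w, GF4_wb, GF4_0, GF4_w, GF4_1, GF4_1, GF4_0],
     [GF4_1, GF4_0, GF4_w, GF4_wb, GF4_1, GF4_0, GF4_1, GF4_0, GF4_1, GF4_1]]) = 10" by simp
    show "check_code ([[GF4_0, GF4_1, GF4_w, GF4_w, GF4_w, GF4_wb, GF4_w, GF4_1, GF4_1, GF4_wb],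
     [GF4_w, GF4_1, GF4_wb, GF4_1, GF4_1, GF4_wb, GF4_wb, GF4_0, GF4_0, GF4_0],
     [GF4_w, GF4_1, GF4_1, GF4_1, GF4_wb, GF4_w, GF4_w, GF4_0, GF4_wb, GF4_1],
     [GF4_w, GF4_0, GF4_0, GF4_1, GF4_wb, GF4_0, GF4_w, GF4_wb, GF4_w, GF4_wb],
     [GF4_1, GF4_0, GF4_wb, GF4_wb, GF4_0, GF4_0, GF4_wb, GF4_0, GF4_0, GF4_1],
     [GF4_0, GF4_1, GF4_0, GF4_0, GF4_w, GF4_w, GF4_0, GF4_1, GF4_w, GF4_0],
     [GF4_0, GF4_1, GF4_0, GF4_w, GF4_w, GF4_0, GF4_wb, GF4_0, GF4_0, GF4_w],
     [GF4_1, GF4_0, GF4_wb, GF4_1, GF4_1, GF4_wb, GF4_w, GF4_wb, GF4_wb, GF4_1],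
     [GF4_1, GF4_0, GF4_wb, GF4_w, GF4_wb, GF4_0, GF4_w, GF4_1, GF4_1, GF4_0],
     [GF4_1, GF4_0, GF4_w, GF4_wb, GF4_1, GF4_0, GF4_1, GF4_0, GF4_1, GF4_1]]) 1 92"
      by code_simp
  qed
  have n: "2 * length A = 20" using A(1) by simp
  have "hermitian_self_dual 20 (gen_code A)"
    using check_code(1) [OF A(2)] unfolding n by (simp add: no_weight_4_def self_dual_codes_def)
  moreover have "trivial_code_aut 20 (gen_code A)"
    using check_code_trivial [OF A(2)] unfolding n .
  ultimately show ?thesis by blast
qed

theorem corollary5:
  shows "(\<exists>C. hermitian_self_dual 20 C \<and> trivial_code_aut 20 C) \<and>
    (\<forall>n. 0 < n \<and> (\<exists>C. hermitian_self_dual n C \<and> trivial_code_aut n C) \<longrightarrow> 20 \<le> n)"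
proof (intro conjI allI impI exists_trivial_20)
  fix n :: nat
  assume n: "0 < n \<and> (\<exists>C. hermitian_self_dual n C \<and> trivial_code_aut n C)"
  then obtain C where C: "hermitian_self_dual n C" "trivial_code_aut n C" by blast
  show "20 \<le> n"
  proof (rule ccontr)
    assume "\<not> 20 \<le> n"
    moreover have "even n" by (rule self_dual_even_length [OF C(1)])
    ultimately have "n \<le> 16 \<or> n = 18" by presburger
    then show False
      using no_trivial_le_16 [OF _ _ C] no_trivial_18 C n by blast
  qed
qed

end
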